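(* Let $A$ be an Artinian Gorenstein local $K$-algebra with Hilbert function $(1,h,n,1)$. Then $A$ is smoothable if $Q_A(0)$ is smoothable.
   Context: $K$ is an algebraically closed field of characteristic $0$. Artinian $K$-algebras are commutative and finite-dimensional over $K$; in particular local ones have residue field $K$. For an Artinian local $K$-algebra $A$ with maximal ideal $\mathfrak m$, the Hilbert function is $HF_A(i)=\dim_K \mathfrak m^i/\mathfrak m^{i+1}$; saying that $A$ has Hilbert function $(1,h,n,1)$ means $HF_A(0)=1$, $HF_A(1)=h$, $HF_A(2)=n$, $HF_A(3)=1$ and $HF_A(i)=0$ for $i\ge4$, where $h,n$ are positive integers (for Gorenstein $A$ necessarily $n\le h$). Smoothability: let $\mathcal{H}ilb_d(\mathbb A^d)$ be the Hilbert scheme parameterizing zero-dimensional closed subschemes of length $d$ of affine space $\mathbb A^d$ over $K$. An Artinian $K$-algebra $A$ of length $d$ is smoothable if the scheme $\mathrm{Spec}(A)\in\mathcal{H}ilb_d(\mathbb A^d)$ (for a closed embedding $\mathrm{Spec}(A)\subseteq\mathbb A^d$; the notion does not depend on the choice) lies in the closure $\mathcal{H}ilb_d^{gen}(\mathbb A^d)$, inside $\mathcal{H}ilb_d(\mathbb A^d)$, of the locus of points representing reduced schemes. If $A$ is Artinian Gorenstein local of socle degree $s$ (that is, $\mathfrak m^s\neq0$, $\mathfrak m^{s+1}=0$), $Q_A(0)$ denotes the unique (up to isomorphism) graded Gorenstein quotient of socle degree $s$ of the associated graded algebra $\mathrm{gr}_{\mathfrak m}(A)=\bigoplus_{i\ge0}\mathfrak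 m^i/\mathfrak m^{i+1}$. Equivalently, if $R=K[[x_1,\dots,x_h]]$ acts on $S=K[y_1,\dots,y_h]$ by $f\circ g=f(\partial_{y_1},\dots,\partial_{y_h})(g)$ and $A\cong R/\mathrm{Ann}_R(F)$ with $F\in S$ of degree $s$, where $\mathrm{Ann}_R(F)=\{g\in R: g\circ F=0\}$, then $Q_A(0)\cong R/\mathrm{Ann}_R(F_s)$, $F_s$ being the homogeneous component of degree $s$ of $F$. *)

theory Defs
  imports
    "HOL-Algebra.Algebra"
    "HOL-Algebra.Algebraic_Closure_Type"
    "HOL-Analysis.Abstract_Topology"
    "HOL-Library.Poly_Mapping"
begin

section \<open>Algebras over a field\<close>

text \<open>
  The ground field is the type \<open>'k\<close>, turned into a record by \<^const>\<open>ring_of_type_algebra\<close>;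
  a commutative \<open>'k\<close>-algebra is an instance of the locale \<^locale>\<open>algebra\<close>.
\<close>

abbreviation k_algebra :: "('k::field, 'a) module \<Rightarrow> bool" where
  "k_algebra A \<equiv> algebra (ring_of_type_algebra :: 'k ring) A"

text \<open>
  Dimension over \<open>'k\<close> of a subspace of \<open>A\<close>. The library notion \<^const>\<open>ring.dimension\<close> takes the
  scalars as a subset of the ring, hence the copy of \<open>'k\<close> inside \<open>A\<close>.
\<close>

definition scalars :: "('k::field, 'a) module \<Rightarrow> 'a set" where
  "scalars A = range (\<lambda>c. c \<odot>\<^bsub>A\<^esub> \<one>\<^bsub>A\<^esub>)"

definition has_kdim :: "('k::field, 'a) module \<Rightarrow> 'a set \<Rightarrow> nat \<Rightarrow> bool" where
  "has_kdim A V d \<longleftrightarrow> ring.dimension A d (scalars A) V"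

definition alg_hom :: "('k::field, 'a) module \<Rightarrow> ('k, 'b) module \<Rightarrow> ('a \<Rightarrow> 'b) set" where
  "alg_hom A B = {\<phi> \<in> ring_hom A B. \<forall>c. \<forall>x\<in>carrier A. \<phi> (c \<odot>\<^bsub>A\<^esub> x) = c \<odot>\<^bsub>B\<^esub> \<phi> x}"

definition alg_isomorphic :: "('k::field, 'a) module \<Rightarrow> ('k, 'b) module \<Rightarrow> bool" where
  "alg_isomorphic A B \<longleftrightarrow> (\<exists>\<phi> \<in> alg_hom A B. bij_betw \<phi> (carrier A) (carrier B))"

definition alg_quot :: "('k::field, 'a) module \<Rightarrow> 'a set \<Rightarrow> ('k, 'a set) module" where
  "alg_quot A I =
     \<lparr>carrier = carrier (A Quot I), monoid.mult = monoid.mult (A Quot I), one = monoid.one (A Quot I),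
      ring.zero = ring.zero (A Quot I), add = ring.add (A Quot I),
      module.smult = (\<lambda>c U. \<Union>x\<in>U. I +>\<^bsub>A\<^esub> (c \<odot>\<^bsub>A\<^esub> x))\<rparr>"


section \<open>Artinian local algebras\<close>

definition artinian_local :: "('k::field, 'a) module \<Rightarrow> bool" where
  "artinian_local A \<longleftrightarrow>
     k_algebra A \<and> (\<exists>d. has_kdim A (carrier A) d) \<and> (\<exists>!m. maximalideal m A)"

definition max_ideal :: "('k::field, 'a) module \<Rightarrow> 'a set" where
  "max_ideal A = (THE m. maximalideal m A)"

primrec ideal_pow :: "('k::field, 'a) module \<Rightarrow> 'a set \<Rightarrow> nat \<Rightarrow> 'a set" where
  "ideal_pow A I 0 = carrier A"
| "ideal_pow A I (Suc n) = I \<cdot>\<^bsub>A\<^esub> ideal_pow A I n"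

abbreviation max_pow :: "('k::field, 'a) module \<Rightarrow> nat \<Rightarrow> 'a set" where
  "max_pow A i \<equiv> ideal_pow A (max_ideal A) i"

text \<open>
  Gorenstein: the socle \<open>(0 : m)\<close> is one-dimensional. This is the usual definition for Artinian
  local rings; the residue field is \<open>'k\<close> when \<open>'k\<close> is algebraically closed.
\<close>

definition socle :: "('k::field, 'a) module \<Rightarrow> 'a set" where
  "socle A = {x \<in> carrier A. \<forall>y\<in>max_ideal A. x \<otimes>\<^bsub>A\<^esub> y = \<zero>\<^bsub>A\<^esub>}"

definition artinian_gorenstein_local :: "('k::field, 'a) module \<Rightarrow> bool" where
  "artinian_gorenstein_local A \<longleftrightarrow> artinian_local A \<and> has_kdim A (socle A) 1"

definition has_socle_degree :: "('k::field, 'a) module \<Rightarrow> nat \<Rightarrow> bool" where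
  "has_socle_degree A s \<longleftrightarrow>
     max_pow A s \<noteq> {\<zero>\<^bsub>A\<^esub>} \<and> max_pow A (Suc s) = {\<zero>\<^bsub>A\<^esub>}"


section \<open>Associated graded algebra, Hilbert function and \<open>Q(0)\<close>\<close>

text \<open>The subspace \<open>m\<^sup>i / m\<^sup>i\<^sup>+\<^sup>1\<close> of \<open>A / m\<^sup>i\<^sup>+\<^sup>1\<close>.\<close>

definition gr_piece :: "('k::field, 'a) module \<Rightarrow> nat \<Rightarrow> 'a set set" where
  "gr_piece A i = (\<lambda>x. max_pow A (Suc i) +>\<^bsub>A\<^esub> x) ` max_pow A i"

definition has_hilbert_function :: "('k::field, 'a) module \<Rightarrow> (nat \<Rightarrow> nat) \<Rightarrow> bool" where
  "has_hilbert_function A H \<longleftrightarrow>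
     (\<forall>i. has_kdim (alg_quot A (max_pow A (Suc i))) (gr_piece A i) (H i))"

text \<open>
  The product of the classes of \<open>x \<in> m\<^sup>i\<close> and \<open>y \<in> m\<^sup>j\<close> is the class of \<open>x y\<close>
  modulo \<open>m\<^bsup>i+j+1\<^esup>\<close>. An element of the direct sum \<open>\<Oplus>\<^sub>i m\<^sup>i / m\<^sup>i\<^sup>+\<^sup>1\<close> is the function
  sending \<open>i\<close> to its component of degree \<open>i\<close>.
\<close>

definition gr_times :: "('k::field, 'a) module \<Rightarrow> nat \<Rightarrow> nat \<Rightarrow> 'a set \<Rightarrow> 'a set \<Rightarrow> 'a set" where
  "gr_times A i j U V = (\<Union>x\<in>U. \<Union>y\<in>V. max_pow A (Suc (i + j)) +>\<^bsub>A\<^esub> (x \<otimes>\<^bsub>A\<^esub> y))"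

definition gr_algebra :: "('k::field, 'a) module \<Rightarrow> ('k, nat \<Rightarrow> 'a set) module" where
  "gr_algebra A =
     \<lparr>carrier = {f. (\<forall>i. f i \<in> gr_piece A i) \<and> finite {i. f i \<noteq> max_pow A (Suc i)}},
      monoid.mult = (\<lambda>f g n. finsum (A Quot max_pow A (Suc n))
                         (\<lambda>i. gr_times A i (n - i) (f i) (g (n - i))) {..n}),
      one = (\<lambda>i. if i = 0 then max_pow A 1 +>\<^bsub>A\<^esub> \<one>\<^bsub>A\<^esub> else max_pow A (Suc i)),
      ring.zero = (\<lambda>i. max_pow A (Suc i)),
      add = (\<lambda>f g i. f i <+>\<^bsub>A\<^esub> g i),
      module.smult = (\<lambda>c f i. \<Union>x\<in>f i. max_pow A (Suc i) +>\<^bsub>A\<^esub> (c \<odot>\<^bsub>A\<^esub> x))\<rparr>"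

definition homogeneous_ideal :: "('k::field, 'a) module \<Rightarrow> (nat \<Rightarrow> 'a set) set \<Rightarrow> bool" where
  "homogeneous_ideal A C \<longleftrightarrow>
     ideal C (gr_algebra A) \<and>
     (\<forall>f\<in>C. \<forall>i. (\<lambda>j. if j = i then f i else max_pow A (Suc j)) \<in> C)"

text \<open>
  \<open>Q\<close> is a graded Gorenstein quotient of \<open>gr A\<close> with the same socle degree as \<open>A\<close>.
  Such a \<open>Q\<close> is unique up to isomorphism, and is denoted \<open>Q\<^sub>A(0)\<close>.
\<close>

definition is_Q0 :: "('k::field, 'a) module \<Rightarrow> ('k, 'q) module \<Rightarrow> bool" where
  "is_Q0 A Q \<longleftrightarrow>
     k_algebra Q \<and>
     (\<exists>C s. homogeneous_ideal A C \<and>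
            has_socle_degree A s \<and>
            artinian_gorenstein_local (alg_quot (gr_algebra A) C) \<and>
            has_socle_degree (alg_quot (gr_algebra A) C) s \<and>
            alg_isomorphic (alg_quot (gr_algebra A) C) Q)"


section \<open>The Hilbert scheme of points of affine space\<close>

text \<open>
  Polynomials are finitely supported maps from monomials to coefficients; a monomial is its
  exponent vector. \<open>poly_alg n\<close> is the polynomial algebra in the variables of index less than \<open>n\<close>.
\<close>

type_synonym monom = "nat \<Rightarrow>\<^sub>0 nat"
type_synonym 'k mpoly = "monom \<Rightarrow>\<^sub>0 'k"

definition monoms :: "nat \<Rightarrow> monom set" where
  "monoms n = {m. Poly_Mapping.keys m \<subseteq> {..<n}}"

definition poly_alg :: "nat \<Rightarrow> ('k::field, 'k mpoly) module" where
  "poly_alg n =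
     \<lparr>carrier = {p. Poly_Mapping.keys p \<subseteq> monoms n}, monoid.mult = (*), one = 1, ring.zero = 0, add = (+),
      module.smult = (\<lambda>c p. Poly_Mapping.single 0 c * p)\<rparr>"

text \<open>
  We use the closed points of the Hilbert scheme: since \<open>'k\<close> is algebraically closed and the
  scheme is of finite type, these are the ideals of colength \<open>d\<close>, and closures of constructible
  sets can be computed on closed points. For each set \<open>B\<close> of \<open>d\<close> monomials there is the
  standard affine open subscheme of those ideals \<open>I\<close> for which \<open>B\<close> is a basis of the
  quotient by \<open>I\<close>. Its coordinate ring is generated by the functions sending \<open>I\<close> to the
  coefficient of \<open>b\<close> in the expansion of a monomial \<open>m\<close> modulo \<open>I\<close> in terms of \<open>B\<close>.
  As every quotient of the polynomial algebra is spanned by monomials, these charts cover the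
  Hilbert scheme, so their principal open subsets form a basis of the Zariski topology.
\<close>

definition hilb_chart :: "nat \<Rightarrow> monom set \<Rightarrow> 'k::field mpoly set set" where
  "hilb_chart n B =
     {I. ideal I (poly_alg n) \<and>
         (\<forall>p\<in>carrier (poly_alg n). \<exists>!q. Poly_Mapping.keys q \<subseteq> B \<and> p - q \<in> I)}"

definition normal_form :: "monom set \<Rightarrow> 'k::field mpoly set \<Rightarrow> 'k mpoly \<Rightarrow> 'k mpoly" where
  "normal_form B I p = (THE q. Poly_Mapping.keys q \<subseteq> B \<and> p - q \<in> I)"

inductive_set regular_functions :: "nat \<Rightarrow> monom set \<Rightarrow> ('k::field mpoly set \<Rightarrow> 'k) set"
  for n :: nat and B :: "monom set" where
  const: "(\<lambda>I. c) \<in> regular_functions n B"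
| coord: "m \<in> monoms n \<Longrightarrow> b \<in> B \<Longrightarrow>
    (\<lambda>I. Poly_Mapping.lookup (normal_form B I (Poly_Mapping.single m 1)) b) \<in> regular_functions n B"
| add: "f \<in> regular_functions n B \<Longrightarrow> g \<in> regular_functions n B \<Longrightarrow>
    (\<lambda>I. f I + g I) \<in> regular_functions n B"
| mult: "f \<in> regular_functions n B \<Longrightarrow> g \<in> regular_functions n B \<Longrightarrow>
    (\<lambda>I. f I * g I) \<in> regular_functions n B"

definition hilb :: "nat \<Rightarrow> nat \<Rightarrow> 'k::field mpoly set topology" where
  "hilb d n = topology_generated_by
     {{I \<in> hilb_chart n B. f I \<noteq> 0} | B f.
        B \<subseteq> monoms n \<and> finite B \<and> card B = d \<and> f \<in> regular_functions n B}"

definition reduced_points :: "nat \<Rightarrow> nat \<Rightarrow> 'k::field mpoly set set" where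
  "reduced_points d n =
     {I \<in> topspace (hilb d n). \<forall>p\<in>carrier (poly_alg n). \<forall>k::nat. p ^ k \<in> I \<longrightarrow> p \<in> I}"

text \<open>
  A closed embedding of \<open>Spec A\<close> into affine \<open>n\<close>-space is a surjection from \<open>poly_alg n\<close>
  onto \<open>A\<close>; the corresponding point of the Hilbert scheme is its kernel.
\<close>

definition smoothable :: "('k::field, 'a) module \<Rightarrow> bool" where
  "smoothable A \<longleftrightarrow>
     (\<exists>d \<phi>. has_kdim A (carrier A) d \<and>
            \<phi> \<in> alg_hom (poly_alg d) A \<and> \<phi> ` carrier (poly_alg d) = carrier A \<and>
            a_kernel (poly_alg d) A \<phi> \<in> hilb d d closure_of reduced_points d d)"

end

theory Submission
  imports Defs "HOL-Library.Function_Algebras" "Jordan_Normal_Form.Char_Poly"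
begin

text \<open>
  Why the theorem holds. Let \<open>m\<close> be the maximal ideal of \<open>A\<close>. The Hilbert function gives
  \<open>m\<^sup>4 = 0\<close> and \<open>m\<^sup>3 \<noteq> 0\<close>, so \<open>m\<^sup>3\<close> is the socle and is spanned by one element
  \<open>\<sigma>\<close>. Products of elements of \<open>(0 : m\<^sup>2)\<close> with elements of \<open>m\<close> lie in the socle, and by
  Gorenstein duality the radical of the resulting symmetric form on \<open>(0 : m\<^sup>2)\<close> is exactly
  \<open>m\<^sup>2\<close>. Diagonalizing this form yields elements \<open>z\<^sub>1, \<dots>, z\<^sub>r\<close> of
  \<open>(0 : m\<^sup>2)\<close> with \<open>z\<^sub>i z\<^sub>j = 0\<close> for \<open>i \<noteq> j\<close> and \<open>z\<^sub>i\<^sup>2 = \<gamma>\<^sub>i \<sigma>\<close>,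
  \<open>\<gamma>\<^sub>i \<noteq> 0\<close>, such that \<open>A\<close> is the direct sum of the span of the \<open>z\<^sub>i\<close> and of the
  subalgebra \<open>B = K \<oplus> W\<close>, where \<open>W\<close> is the set of all \<open>x \<in> m\<close> annihilated by every
  \<open>z\<^sub>i\<close>.

  Two facts about this decomposition prove the theorem.

  First, \<open>B\<close> is isomorphic to \<open>Q\<^sub>A(0)\<close> (\<open>gorenstein_comparison\<close>). Fix a linear functional
  \<open>\<Lambda>\<close> with \<open>\<Lambda> \<sigma> = 1\<close>. A complement of \<open>m\<^sup>2\<close> in \<open>W\<close> can be corrected by elements of
  \<open>m\<^sup>2\<close> to a complement \<open>V\<close> on which \<open>\<Lambda>(v v')\<close> vanishes; this is
  completing the square. With \<open>U = m\<^sup>2 \<inter> ker \<Lambda>\<close> one then has \<open>V V \<subseteq> U\<close>, so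
  \<open>B = K \<oplus> V \<oplus> U \<oplus> K \<sigma>\<close> is a grading, and sending each summand to its symbol in the
  associated graded algebra is multiplicative. The \<open>z\<^sub>i\<close> are killed in \<open>Q\<^sub>A(0)\<close> because their
  symbols are socle elements of degree 1, while the socle of \<open>Q\<^sub>A(0)\<close> lives in degree 3.

  Second, adjoining such an element preserves smoothability
  (\<open>limit_of_reduced_extension\<close>). If \<open>A' = B' \<oplus> K z\<close> with \<open>z\<^sup>2 = s\<close>, where \<open>x z\<close> and
  \<open>x s\<close> are the multiples of \<open>z\<close> and \<open>s\<close> by the residue of \<open>x \<in> B'\<close>, then replacing the
  relation \<open>z\<^sup>2 = s\<close> by \<open>z\<^sup>2 = s + t z\<close> gives a family which is \<open>A'\<close> at \<open>t = 0\<close> and is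
  isomorphic to \<open>B' \<times> K\<close> for \<open>t \<noteq> 0\<close>, because then \<open>(z + s / t) / t\<close> is an idempotent.
  A limit of reduced algebras for \<open>B'\<close> gives one for \<open>B' \<times> K\<close>, hence one for \<open>A'\<close>.

  To make the second argument elementary, smoothability is expressed without the Hilbert scheme. An
  algebra with a basis is a point of the affine space of structure constants, and
  \<open>limit_of_reduced\<close> says that this point lies in the Zariski closure of the points that belong to
  reduced algebras. A smoothable algebra has this property, because the structure constants with
  respect to the monomials of one chart are regular functions on it
  (\<open>smoothable_imp_limit_of_reduced\<close>). Conversely, sending the \<open>d\<close> variables to the \<open>d\<close>
  basis vectors embeds all algebras of dimension \<open>d\<close> at once into affine \<open>d\<close>-space, and the
  resulting map to the Hilbert scheme is continuous by Cramer's rule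
  (\<open>limit_of_reduced_imp_smoothable\<close>).
\<close>

section \<open>Algebras given by structure constants\<close>

definition vecs :: "nat \<Rightarrow> (nat \<Rightarrow> 'k::zero) set" where
  "vecs d = {p. \<forall>i\<ge>d. p i = 0}"

definition scale :: "'k::times \<Rightarrow> (nat \<Rightarrow> 'k) \<Rightarrow> nat \<Rightarrow> 'k" where
  "scale k p = (\<lambda>i. k * p i)"

definition basis_vec :: "nat \<Rightarrow> nat \<Rightarrow> 'k::zero_neq_one" where
  "basis_vec i = (\<lambda>j. if j = i then 1 else 0)"

text \<open>
  The structure constants of a multiplication together with the coordinates of the unit. The
  unit is part of the data because a basis of monomials of a quotient of the polynomial algebra
  need not contain 1.
\<close>

type_synonym 'k algebra_data = "(nat \<Rightarrow> nat \<Rightarrow> nat \<Rightarrow> 'k) \<times> (nat \<Rightarrow> 'k)"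

text \<open>
  Only the coordinates below \<open>d\<close> of the factors enter. The product is therefore
  bilinear, and for an algebra also associative and commutative, on all vectors; only the unit
  law is confined to \<open>vecs d\<close>.
\<close>

definition smul :: "nat \<Rightarrow> (nat \<Rightarrow> nat \<Rightarrow> nat \<Rightarrow> 'k::field) \<Rightarrow> (nat \<Rightarrow> 'k) \<Rightarrow> (nat \<Rightarrow> 'k) \<Rightarrow> nat \<Rightarrow> 'k" where
  "smul d c p q = (\<lambda>l. if l < d then \<Sum>i<d. \<Sum>j<d. p i * q j * c i j l else 0)"

definition consts_of :: "((nat \<Rightarrow> 'k::field) \<Rightarrow> (nat \<Rightarrow> 'k) \<Rightarrow> nat \<Rightarrow> 'k) \<Rightarrow> nat \<Rightarrow> nat \<Rightarrow> nat \<Rightarrow> 'k" where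
  "consts_of m i j l = m (basis_vec i) (basis_vec j) l"

definition is_algebra :: "nat \<Rightarrow> 'k::field algebra_data \<Rightarrow> bool" where
  "is_algebra d S \<longleftrightarrow> snd S \<in> vecs d \<and>
     (\<forall>p\<in>vecs d. smul d (fst S) (snd S) p = p) \<and>
     (\<forall>p\<in>vecs d. \<forall>q\<in>vecs d. smul d (fst S) p q = smul d (fst S) q p) \<and>
     (\<forall>p\<in>vecs d. \<forall>q\<in>vecs d. \<forall>r\<in>vecs d.
        smul d (fst S) (smul d (fst S) p q) r = smul d (fst S) p (smul d (fst S) q r))"

text \<open>
  An algebra is reduced as soon as no nonzero element has square zero.
\<close>

definition is_reduced :: "nat \<Rightarrow> 'k::field algebra_data \<Rightarrow> bool" where
  "is_reduced d S \<longleftrightarrow> (\<forall>p\<in>vecs d. smul d (fst S) p p = 0 \<longrightarrow> p = 0)"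

lemma sum_fun_apply: "(\<Sum>i\<in>A. f i) x = (\<Sum>i\<in>A. f i x)"
  by (induction A rule: infinite_finite_induct) auto

lemma diff_fun_apply [simp]: "(f - g) x = f x - (g x :: 'a::group_add)"
  by (simp add: fun_diff_def)

lemma uminus_fun_apply [simp]: "(- f) x = - (f x :: 'a::group_add)"
  by (simp add: fun_Compl_def)

lemma scale_apply [simp]: "scale k p i = k * p i"
  by (simp add: scale_def)

lemma vecsD: "p \<in> vecs d \<Longrightarrow> d \<le> i \<Longrightarrow> p i = 0"
  by (simp add: vecs_def)

lemma vecs_closed [simp, intro]:
  "0 \<in> vecs d" "p \<in> vecs d \<Longrightarrow> q \<in> vecs d \<Longrightarrow> p + q \<in> vecs d"
  "p \<in> vecs d \<Longrightarrow> q \<in> vecs d \<Longrightarrow> p - q \<in> vecs d"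
  "p \<in> vecs d \<Longrightarrow> scale k p \<in> vecs d"
  "i < d \<Longrightarrow> basis_vec i \<in> vecs d" for p q :: "nat \<Rightarrow> 'k::field"
  by (auto simp: vecs_def basis_vec_def)

lemma vecs_sum: "(\<And>i. i \<in> I \<Longrightarrow> f i \<in> vecs d) \<Longrightarrow> (\<Sum>i\<in>I. f i) \<in> vecs d"
  for f :: "_ \<Rightarrow> nat \<Rightarrow> 'k::field"
  by (auto simp: vecs_def sum_fun_apply)

lemma vecs_mono: "p \<in> vecs d \<Longrightarrow> d \<le> e \<Longrightarrow> p \<in> vecs e"
  by (auto simp: vecs_def)

lemma vecs_expand: "p \<in> vecs d \<Longrightarrow> (\<Sum>i<d. scale (p i) (basis_vec i)) = p"
  for p :: "nat \<Rightarrow> 'k::field"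
  by (rule ext) (auto simp: sum_fun_apply basis_vec_def vecs_def if_distrib sum.delta cong: if_cong)

interpretation vs: vector_space "scale :: 'k::field \<Rightarrow> (nat \<Rightarrow> 'k) \<Rightarrow> _"
  by unfold_locales (auto simp: algebra_simps fun_eq_iff)

lemma smul_in_vecs [simp, intro]: "smul d c p q \<in> vecs d"
  by (simp add: smul_def vecs_def)

lemma smul_add: "smul d c (p + p') q = smul d c p q + smul d c p' q"
  "smul d c p (q + q') = smul d c p q + smul d c p q'"
  by (rule ext, simp add: smul_def algebra_simps sum.distrib)+

lemma smul_scale: "smul d c (scale k p) q = scale k (smul d c p q)"
  "smul d c p (scale k q) = scale k (smul d c p q)"
  by (rule ext, simp add: smul_def algebra_simps sum_distrib_left)+

lemma smul_diff: "smul d c (p - p') q = smul d c p q - smul d c p' q"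
  "smul d c p (q - q') = smul d c p q - smul d c p q'"
  by (rule ext, simp add: smul_def algebra_simps sum_subtractf)+

lemma smul_zero [simp]: "smul d c 0 q = 0" "smul d c p 0 = 0"
  by (rule ext, simp add: smul_def)+

lemma smul_sum_left: "smul d c (\<Sum>i\<in>I. f i) q = (\<Sum>i\<in>I. smul d c (f i) q)"
  by (rule additive.sum[of "\<lambda>p. smul d c p q"]) (simp add: additive_def smul_add)

lemma smul_sum_right: "smul d c p (\<Sum>i\<in>I. f i) = (\<Sum>i\<in>I. smul d c p (f i))"
  by (rule additive.sum[of "smul d c p"]) (simp add: additive_def smul_add)

lemma smul_cong: "(\<And>i. i < d \<Longrightarrow> p i = p' i) \<Longrightarrow> (\<And>i. i < d \<Longrightarrow> q i = q' i) \<Longrightarrow>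
  smul d c p q = smul d c p' q'"
  by (rule ext) (simp add: smul_def)

text \<open>A bilinear product is determined by its structure constants.\<close>

lemma smul_consts_of:
  fixes m :: "(nat \<Rightarrow> 'k::field) \<Rightarrow> (nat \<Rightarrow> 'k) \<Rightarrow> nat \<Rightarrow> 'k"
  assumes add: "\<And>p p' q. p \<in> vecs d \<Longrightarrow> p' \<in> vecs d \<Longrightarrow> q \<in> vecs d \<Longrightarrow> m (p + p') q = m p q + m p' q"
    "\<And>p q q'. p \<in> vecs d \<Longrightarrow> q \<in> vecs d \<Longrightarrow> q' \<in> vecs d \<Longrightarrow> m p (q + q') = m p q + m p q'"
    and scale: "\<And>k p q. p \<in> vecs d \<Longrightarrow> q \<in> vecs d \<Longrightarrow> m (scale k p) q = scale k (m p q)"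
    "\<And>k p q. p \<in> vecs d \<Longrightarrow> q \<in> vecs d \<Longrightarrow> m p (scale k q) = scale k (m p q)"
    and closed: "\<And>p q. p \<in> vecs d \<Longrightarrow> q \<in> vecs d \<Longrightarrow> m p q \<in> vecs d"
    and p: "p \<in> vecs d" and q: "q \<in> vecs d"
  shows "smul d (consts_of m) p q = m p q"
proof -
  have zero: "m 0 r = 0" "m r 0 = 0" if "r \<in> vecs d" for r
    using scale[of 0 r 0] scale(1)[of 0 r 0] scale(2)[of r 0 0] that by (auto simp: fun_eq_iff)
  have sum1: "m (\<Sum>i\<in>I. scale (f i) (b i)) r = (\<Sum>i\<in>I. scale (f i) (m (b i) r))"
    if "finite I" "\<And>i. i \<in> I \<Longrightarrow> b i \<in> vecs d" "r \<in> vecs d" for I :: "nat set" and f b r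
    using that by (induction I rule: finite_induct) (auto simp: zero add scale vecs_sum)
  have sum2: "m r (\<Sum>i\<in>I. scale (f i) (b i)) = (\<Sum>i\<in>I. scale (f i) (m r (b i)))"
    if "finite I" "\<And>i. i \<in> I \<Longrightarrow> b i \<in> vecs d" "r \<in> vecs d" for I :: "nat set" and f b r
    using that by (induction I rule: finite_induct) (auto simp: zero add scale vecs_sum)
  have "m p q = m (\<Sum>i<d. scale (p i) (basis_vec i)) (\<Sum>j<d. scale (q j) (basis_vec j))"
    using p q by (simp add: vecs_expand)
  also have "\<dots> = (\<Sum>i<d. scale (p i) (m (basis_vec i) (\<Sum>j<d. scale (q j) (basis_vec j))))"
    by (rule sum1) (auto intro!: vecs_sum)
  also have "\<dots> = (\<Sum>i<d. scale (p i) (\<Sum>j<d. scale (q j) (m (basis_vec i) (basis_vec j))))"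
    by (intro sum.cong refl arg_cong2[of _ _ _ _ scale] sum2) auto
  finally have *: "m p q = \<dots>" .
  show ?thesis
  proof
    fix l show "smul d (consts_of m) p q l = m p q l"
    proof (cases "l < d")
      case True
      then show ?thesis unfolding *
        by (simp add: smul_def consts_of_def sum_fun_apply sum_distrib_left mult.assoc)
    next
      case False
      then show ?thesis using closed[OF p q] by (simp add: smul_def vecs_def)
    qed
  qed
qed

section \<open>Polynomial functions of the structure constants\<close>

text \<open>
  The algebra of functions generated by \<open>G\<close>. With \<open>G\<close> the coordinate
  functions these are the polynomial functions on the space of structure constants.
\<close>

inductive_set gen_alg :: "('x \<Rightarrow> 'k::comm_ring_1) set \<Rightarrow> ('x \<Rightarrow> 'k) set" for G where
  const: "(\<lambda>_. k) \<in> gen_alg G"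
| gen: "g \<in> G \<Longrightarrow> g \<in> gen_alg G"
| add: "f \<in> gen_alg G \<Longrightarrow> g \<in> gen_alg G \<Longrightarrow> (\<lambda>x. f x + g x) \<in> gen_alg G"
| mult: "f \<in> gen_alg G \<Longrightarrow> g \<in> gen_alg G \<Longrightarrow> (\<lambda>x. f x * g x) \<in> gen_alg G"

lemma gen_alg_uminus: "f \<in> gen_alg G \<Longrightarrow> (\<lambda>x. - f x) \<in> gen_alg G"
  using gen_alg.mult[OF gen_alg.const[of "-1"], of f] by simp

lemma gen_alg_diff: "f \<in> gen_alg G \<Longrightarrow> g \<in> gen_alg G \<Longrightarrow> (\<lambda>x. f x - g x) \<in> gen_alg G"
  using gen_alg.add[OF _ gen_alg_uminus[of g], of f] by simp

lemma gen_alg_divide: "f \<in> gen_alg G \<Longrightarrow> (\<lambda>x. f x / k) \<in> gen_alg G" for k :: "'k::field"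
  using gen_alg.mult[OF _ gen_alg.const[of "inverse k"], of f] by (simp add: divide_inverse)

lemma gen_alg_sum: "(\<And>i. i \<in> I \<Longrightarrow> f i \<in> gen_alg G) \<Longrightarrow> (\<lambda>x. \<Sum>i\<in>I. f i x) \<in> gen_alg G"
  by (induction I rule: infinite_finite_induct) (auto intro: gen_alg.intros)

lemma gen_alg_prod: "(\<And>i. i \<in> I \<Longrightarrow> f i \<in> gen_alg G) \<Longrightarrow> (\<lambda>x. \<Prod>i\<in>I. f i x) \<in> gen_alg G"
  by (induction I rule: infinite_finite_induct) (auto intro: gen_alg.intros)

lemma gen_alg_power: "f \<in> gen_alg G \<Longrightarrow> (\<lambda>x. f x ^ n) \<in> gen_alg G"
  by (induction n) (auto intro: gen_alg.intros)

lemmas gen_alg_intros = gen_alg.const gen_alg.add gen_alg.mult gen_alg_uminus gen_alg_diff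
  gen_alg_divide gen_alg_sum gen_alg_prod gen_alg_power

lemma gen_alg_comp:
  assumes "f \<in> gen_alg G" and "\<And>g. g \<in> G \<Longrightarrow> (\<lambda>x. g (F x)) \<in> gen_alg G'"
  shows "(\<lambda>x. f (F x)) \<in> gen_alg G'"
  using assms(1) by induction (auto intro: gen_alg.intros assms(2))

definition coords :: "('k algebra_data \<Rightarrow> 'k) set" where
  "coords = (\<Union>i j l. {\<lambda>S. fst S i j l}) \<union> (\<Union>l. {\<lambda>S. snd S l})"

lemma coords_in_gen_alg: "(\<lambda>S. fst S i j l) \<in> gen_alg coords" "(\<lambda>S. snd S l) \<in> gen_alg coords"
  by (rule gen_alg.gen, force simp: coords_def)+

text \<open>Along a line of structures, a polynomial function is a polynomial in the parameter.\<close>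

lemma gen_alg_coords_line:
  assumes "f \<in> gen_alg coords"
  shows "\<exists>P. \<forall>t. f (\<lambda>i j l. c i j l + t * b i j l, u) = poly P (t::'k::field)"
  using assms
proof induction
  case (const k) show ?case by (rule exI[of _ "[:k:]"]) simp
next
  case (gen g)
  then consider i j l where "g = (\<lambda>S. fst S i j l)" | l where "g = (\<lambda>S. snd S l)"
    by (auto simp: coords_def)
  then show ?case
  proof cases
    case 1 show ?thesis by (rule exI[of _ "[:c i j l, b i j l:]"]) (use 1 in simp)
  next
    case 2 show ?thesis by (rule exI[of _ "[:u l:]"]) (use 2 in simp)
  qed
next
  case (add f g) then show ?case by (metis poly_add)
next
  case (mult f g) then show ?case by (metis poly_mult)
qed

text \<open>
  Membership in the Zariski closure of the reduced algebras: every principal open set around the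
  point contains one. Since the product of two polynomial functions is one again, it suffices to
  look at principal open sets.
\<close>

definition limit_of_reduced :: "nat \<Rightarrow> 'k::field algebra_data \<Rightarrow> bool" where
  "limit_of_reduced d S \<longleftrightarrow> (\<forall>f\<in>gen_alg coords. f S \<noteq> 0 \<longrightarrow>
      (\<exists>S'. is_algebra d S' \<and> is_reduced d S' \<and> f S' \<noteq> 0))"

section \<open>Adjoining one basis vector\<close>

lemma gen_alg_coords_comp:
  assumes "f \<in> gen_alg coords" and "\<And>i j l. (\<lambda>x. fst (F x) i j l) \<in> gen_alg G"
    and "\<And>l. (\<lambda>x. snd (F x) l) \<in> gen_alg G"
  shows "(\<lambda>x. f (F x)) \<in> gen_alg G"
  using assms(1) by (rule gen_alg_comp) (use assms(2,3) in \<open>auto simp: coords_def\<close>)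

text \<open>
  The laws extend from \<open>vecs d\<close> to all vectors because a product does not change
  when its factors are truncated.
\<close>

lemma is_algebraD:
  assumes "is_algebra d (c, u)"
  shows "u \<in> vecs d" "p \<in> vecs d \<Longrightarrow> smul d c u p = p" "p \<in> vecs d \<Longrightarrow> smul d c p u = p"
    "smul d c p q = smul d c q p" "smul d c (smul d c p q) r = smul d c p (smul d c q r)"
proof -
  define tr where "tr p = (\<lambda>i. if i < d then p i else 0)" for p :: "nat \<Rightarrow> 'a"
  have tr: "tr p \<in> vecs d" "smul d c (tr p) q = smul d c p q" "smul d c q (tr p) = smul d c q p" for p q
    by (auto simp: tr_def vecs_def intro!: smul_cong)
  show u: "u \<in> vecs d" "p \<in> vecs d \<Longrightarrow> smul d c u p = p" using assms by (auto simp: is_algebra_def)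
  show comm: "smul d c p q = smul d c q p" for p q
  proof -
    have "smul d c (tr p) (tr q) = smul d c (tr q) (tr p)"
      using assms tr(1) unfolding is_algebra_def by simp
    then show ?thesis by (simp only: tr)
  qed
  show "p \<in> vecs d \<Longrightarrow> smul d c p u = p" using u comm by simp
  show "smul d c (smul d c p q) r = smul d c p (smul d c q r)"
  proof -
    have "smul d c (smul d c (tr p) (tr q)) (tr r) = smul d c (tr p) (smul d c (tr q) (tr r))"
      using assms tr(1)[of p] tr(1)[of q] tr(1)[of r] unfolding is_algebra_def fst_conv snd_conv by blast
    then show ?thesis by (simp only: tr)
  qed
qed

text \<open>
  The linear form with coefficients \<open>\<epsilon>\<close>; in the applications it is the
  projection to the residue field.
\<close>

definition aug :: "nat \<Rightarrow> (nat \<Rightarrow> 'k::field) \<Rightarrow> (nat \<Rightarrow> 'k) \<Rightarrow> 'k" where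
  "aug d \<epsilon> p = (\<Sum>i<d. \<epsilon> i * p i)"

lemma aug_linear: "aug d \<epsilon> (p + q) = aug d \<epsilon> p + aug d \<epsilon> q" "aug d \<epsilon> (p - q) = aug d \<epsilon> p - aug d \<epsilon> q"
  "aug d \<epsilon> (scale k p) = k * aug d \<epsilon> p"
  by (simp_all add: aug_def sum.distrib sum_subtractf sum_distrib_left algebra_simps)

text \<open>
  Multiplication on \<open>B \<oplus> K z\<close>, with \<open>z\<close> as basis vector number
  \<open>d\<close>, given by \<open>z\<^sup>2 = s\<close> and \<open>x z = \<epsilon>(x)
  z\<close>.
\<close>

definition ext_mult :: "nat \<Rightarrow> (nat \<Rightarrow> 'k::field) \<Rightarrow> (nat \<Rightarrow> 'k) \<Rightarrow> (nat \<Rightarrow> nat \<Rightarrow> nat \<Rightarrow> 'k) \<Rightarrow>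
    (nat \<Rightarrow> 'k) \<Rightarrow> (nat \<Rightarrow> 'k) \<Rightarrow> nat \<Rightarrow> 'k" where
  "ext_mult d \<epsilon> s c P Q = smul d c P Q + scale (P d * Q d) s
      + scale (P d * aug d \<epsilon> Q + Q d * aug d \<epsilon> P) (basis_vec d)"

text \<open>
  The deformed algebra is \<open>B \<times> K\<close> in disguise: the basis vector
  \<open>b\<^sub>i\<close> stands for \<open>(b\<^sub>i, \<epsilon>\<^sub>i)\<close> and
  \<open>z\<close> for \<open>(- s / t, t)\<close>. This is the first component of the vector
  \<open>P\<close>; the second is \<open>aug d \<epsilon> P + t * P d\<close>.
\<close>

definition deform_proj :: "nat \<Rightarrow> (nat \<Rightarrow> 'k::field) \<Rightarrow> 'k \<Rightarrow> (nat \<Rightarrow> 'k) \<Rightarrow> nat \<Rightarrow> 'k" where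
  "deform_proj d s t P = P - scale (P d / t) s - scale (P d) (basis_vec d)"

text \<open>
  The componentwise product of \<open>B \<times> K\<close>, pulled back along that
  identification.
\<close>

definition deform_mult :: "nat \<Rightarrow> (nat \<Rightarrow> 'k::field) \<Rightarrow> (nat \<Rightarrow> 'k) \<Rightarrow> 'k \<Rightarrow> (nat \<Rightarrow> nat \<Rightarrow> nat \<Rightarrow> 'k) \<Rightarrow>
    (nat \<Rightarrow> 'k) \<Rightarrow> (nat \<Rightarrow> 'k) \<Rightarrow> nat \<Rightarrow> 'k" where
  "deform_mult d \<epsilon> s t c P Q =
     (let q = smul d c (deform_proj d s t P) (deform_proj d s t Q);
          \<alpha> = ((aug d \<epsilon> P + t * P d) * (aug d \<epsilon> Q + t * Q d) - aug d \<epsilon> q) / t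
      in q + scale (\<alpha> / t) s + scale \<alpha> (basis_vec d))"

text \<open>
  The vector that stands for \<open>(u, 1)\<close>.
\<close>

definition deform_unit :: "nat \<Rightarrow> (nat \<Rightarrow> 'k::field) \<Rightarrow> (nat \<Rightarrow> 'k) \<Rightarrow> 'k \<Rightarrow> (nat \<Rightarrow> 'k) \<Rightarrow> nat \<Rightarrow> 'k" where
  "deform_unit d \<epsilon> s t u =
     (let \<alpha> = (1 - aug d \<epsilon> u) / t in u + scale (\<alpha> / t) s + scale \<alpha> (basis_vec d))"

lemma aug_basis_vec [simp]: "aug d \<epsilon> (basis_vec d) = 0"
  by (simp add: aug_def basis_vec_def)

lemma smul_basis_vec [simp]: "smul d c (basis_vec d) p = 0" "smul d c p (basis_vec d) = 0"
  by (rule ext, simp add: smul_def basis_vec_def)+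

lemma deform_proj_linear:
  "deform_proj d s t (P + Q) = deform_proj d s t P + deform_proj d s t Q"
  "deform_proj d s t (scale k P) = scale k (deform_proj d s t P)"
  by (rule ext, simp add: deform_proj_def algebra_simps add_divide_distrib)+

locale extension =
  fixes d :: nat and \<epsilon> s :: "nat \<Rightarrow> 'k::field"
  assumes s: "s \<in> vecs d" and eps_s: "aug d \<epsilon> s = 0"
begin

lemma ext_mult_consts: 
  assumes "P \<in> vecs (Suc d)" "Q \<in> vecs (Suc d)" 
  shows "smul (Suc d) (consts_of (ext_mult d \<epsilon> s c)) P Q = ext_mult d \<epsilon> s c P Q"
proof (rule smul_consts_of)
  show "ext_mult d \<epsilon> s c p q \<in> vecs (Suc d)" for p q
    unfolding ext_mult_def by (intro vecs_closed vecs_mono[OF s] vecs_mono[OF smul_in_vecs]) auto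
qed (use assms in \<open>auto simp: ext_mult_def smul_add smul_scale aug_linear fun_eq_iff algebra_simps\<close>)

lemma deform_mult_in_vecs: "deform_mult d \<epsilon> s t c p q \<in> vecs (Suc d)"
  unfolding deform_mult_def Let_def
  by (intro vecs_closed vecs_mono[OF s] vecs_mono[OF smul_in_vecs]) auto

lemma deform_mult_linear:
  assumes "t \<noteq> 0"
  shows "deform_mult d \<epsilon> s t c (p + p') q = deform_mult d \<epsilon> s t c p q + deform_mult d \<epsilon> s t c p' q"
    "deform_mult d \<epsilon> s t c p (q + q') = deform_mult d \<epsilon> s t c p q + deform_mult d \<epsilon> s t c p q'"
    "deform_mult d \<epsilon> s t c (scale k p) q = scale k (deform_mult d \<epsilon> s t c p q)"
    "deform_mult d \<epsilon> s t c p (scale k q) = scale k (deform_mult d \<epsilon> s t c p q)"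
  by (rule ext, simp add: deform_mult_def deform_proj_linear Let_def smul_add smul_scale aug_linear
      algebra_simps add_divide_distrib diff_divide_distrib)+

lemma deform_mult_consts:
  assumes "P \<in> vecs (Suc d)" "Q \<in> vecs (Suc d)" "t \<noteq> 0"
  shows "smul (Suc d) (consts_of (deform_mult d \<epsilon> s t c)) P Q = deform_mult d \<epsilon> s t c P Q"
  by (rule smul_consts_of) (use assms in \<open>auto simp: deform_mult_linear deform_mult_in_vecs\<close>)

text \<open>
  For \<open>q \<in> vecs d\<close> the vector \<open>q + (\<alpha> / t) s + \<alpha> z\<close>
  stands for \<open>(q, aug d \<epsilon> q + t * \<alpha>)\<close>; as \<open>\<alpha>\<close>
  is free, this inverts the identification with \<open>B \<times> K\<close>.
\<close>

lemma deform_proj_section: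
  assumes "q \<in> vecs d"
  shows "deform_proj d s t (q + scale (\<alpha> / t) s + scale \<alpha> (basis_vec d)) = q"
    "(q + scale (\<alpha> / t) s + scale \<alpha> (basis_vec d)) d = \<alpha>"
    "aug d \<epsilon> (q + scale (\<alpha> / t) s + scale \<alpha> (basis_vec d)) = aug d \<epsilon> q"
proof -
  have sd: "s d = 0" and bd: "basis_vec d d = (1::'k)" and ql: "q d = 0" using s assms by (auto simp: vecs_def basis_vec_def)
  show "deform_proj d s t (q + scale (\<alpha> / t) s + scale \<alpha> (basis_vec d)) = q"
    by (rule ext) (simp add: deform_proj_def sd bd ql)
  show "(q + scale (\<alpha> / t) s + scale \<alpha> (basis_vec d)) d = \<alpha>" by (simp add: sd bd ql)
  show "aug d \<epsilon> (q + scale (\<alpha> / t) s + scale \<alpha> (basis_vec d)) = aug d \<epsilon> q"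
    by (simp add: aug_linear eps_s)
qed

lemma deform_proj_in_vecs: "P \<in> vecs (Suc d) \<Longrightarrow> deform_proj d s t P \<in> vecs d"
  using s by (auto simp: vecs_def deform_proj_def basis_vec_def)

lemma deform_proj_mult:
  assumes t: "t \<noteq> 0"
  shows "deform_proj d s t (deform_mult d \<epsilon> s t c P Q) = smul d c (deform_proj d s t P) (deform_proj d s t Q)"
    "aug d \<epsilon> (deform_mult d \<epsilon> s t c P Q) + t * deform_mult d \<epsilon> s t c P Q d =
       (aug d \<epsilon> P + t * P d) * (aug d \<epsilon> Q + t * Q d)"
  using t by (simp_all add: deform_mult_def Let_def deform_proj_section del: plus_fun_apply divide_divide_eq_left)

lemma deform_unit:
  assumes "t \<noteq> 0" "u \<in> vecs d"
  shows "deform_unit d \<epsilon> s t u \<in> vecs (Suc d)" "deform_proj d s t (deform_unit d \<epsilon> s t u) = u"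
    "aug d \<epsilon> (deform_unit d \<epsilon> s t u) + t * deform_unit d \<epsilon> s t u d = 1"
proof -
  show "deform_unit d \<epsilon> s t u \<in> vecs (Suc d)"
    unfolding deform_unit_def Let_def by (intro vecs_closed vecs_mono[OF s] vecs_mono[OF assms(2)]) auto
qed (use assms in \<open>simp_all add: deform_unit_def Let_def deform_proj_section del: plus_fun_apply divide_divide_eq_left\<close>)

lemma deform_inj:
  assumes t: "t \<noteq> 0" and "P \<in> vecs (Suc d)" "Q \<in> vecs (Suc d)"
    and eq: "deform_proj d s t P = deform_proj d s t Q" "aug d \<epsilon> P + t * P d = aug d \<epsilon> Q + t * Q d"
  shows "P = Q"
proof -
  have "aug d \<epsilon> (deform_proj d s t p) = aug d \<epsilon> p" for p
    by (simp add: deform_proj_def aug_linear eps_s)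
  then have "aug d \<epsilon> P = aug d \<epsilon> Q" using eq(1) by metis
  then have "P d = Q d" using eq(2) t by simp
  then show ?thesis using eq(1) by (auto simp: deform_proj_def fun_eq_iff)
qed

lemma deform_algebra:
  assumes t: "t \<noteq> 0" and alg: "is_algebra d (c, u)"
  shows "is_algebra (Suc d) (consts_of (deform_mult d \<epsilon> s t c), deform_unit d \<epsilon> s t u)"
proof -
  note A = is_algebraD[OF alg]
  note [simp] = deform_mult_consts deform_mult_in_vecs deform_unit[OF t A(1)]
    deform_proj_mult[OF t] deform_proj_in_vecs A(2)
  let ?m = "deform_mult d \<epsilon> s t c"
  have unit: "?m (deform_unit d \<epsilon> s t u) P = P" if "P \<in> vecs (Suc d)" for P
    by (rule deform_inj[OF t]) (use that in simp_all)
  have comm: "?m P Q = ?m Q P" for P Q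
    by (rule deform_inj[OF t]) (simp_all add: mult.commute, rule A(4))
  have assoc: "?m (?m P Q) R = ?m P (?m Q R)" for P Q R
    by (rule deform_inj[OF t]) (simp_all add: mult.assoc, rule A(5))
  show ?thesis
    unfolding is_algebra_def fst_conv snd_conv
    using unit assoc by (auto simp: t intro: comm)
qed

lemma deform_reduced:
  assumes t: "t \<noteq> 0" and red: "is_reduced d (c, u)"
  shows "is_reduced (Suc d) (consts_of (deform_mult d \<epsilon> s t c), v)"
  unfolding is_reduced_def fst_conv
proof (intro ballI impI)
  fix P assume P: "P \<in> vecs (Suc d)" and "smul (Suc d) (consts_of (deform_mult d \<epsilon> s t c)) P P = 0"
  then have 0: "deform_mult d \<epsilon> s t c P P = 0" by (simp add: deform_mult_consts t)
  have lin0: "deform_proj d s t 0 = 0" "aug d \<epsilon> 0 = 0"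
    by (auto simp: deform_proj_def fun_eq_iff aug_def)
  have "smul d c (deform_proj d s t P) (deform_proj d s t P) = 0"
    using deform_proj_mult(1)[OF t, of c P P] by (simp add: 0 lin0)
  then have 1: "deform_proj d s t P = 0"
    using red deform_proj_in_vecs[OF P, of t] unfolding is_reduced_def fst_conv by blast
  have 2: "aug d \<epsilon> P + t * P d = 0"
    using deform_proj_mult(2)[OF t, of c P P] by (simp add: 0 lin0)
  show "P = 0" by (rule deform_inj[OF t P]) (simp_all add: 1 2 lin0)
qed

text \<open>
  For fixed \<open>t\<close> the passage from \<open>B\<close> to \<open>B \<times> K\<close> is
  a polynomial map, so it carries limits to limits.
\<close>

lemma gen_alg_deform:
  fixes t :: 'k
  shows "(\<lambda>S. consts_of (deform_mult d \<epsilon> s t (fst S)) i j l) \<in> gen_alg coords"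
    "(\<lambda>S. deform_unit d \<epsilon> s t (snd S) l) \<in> gen_alg coords"
proof -
  have sm: "(\<lambda>S. smul d (fst S) x y l) \<in> gen_alg coords" for x y l
    unfolding smul_def by (cases "l < d") (auto intro!: gen_alg_intros coords_in_gen_alg)
  show "(\<lambda>S. consts_of (deform_mult d \<epsilon> s t (fst S)) i j l) \<in> gen_alg coords"
    by (simp add: consts_of_def deform_mult_def Let_def aug_def)
       (intro gen_alg_intros sm)
  show "(\<lambda>S. deform_unit d \<epsilon> s t (snd S) l) \<in> gen_alg coords"
    by (simp add: deform_unit_def Let_def aug_def)
       (intro gen_alg_intros coords_in_gen_alg)
qed

text \<open>
  A polynomial function that does not vanish at the extension is, along the family
  \<open>z\<^sup>2 = s + t z\<close>, a nonzero polynomial in \<open>t\<close>. Hence it does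
  not vanish for some \<open>t \<noteq> 0\<close>, where the algebra is \<open>B \<times>
  K\<close> for the given \<open>B\<close>. Now \<open>B\<close> can be moved to a reduced
  algebra with \<open>t\<close>, \<open>\<epsilon>\<close> and \<open>s\<close> fixed, since the
  change of basis behind \<open>deform_mult\<close> makes sense for every multiplication on
  \<open>B\<close>.
\<close>

theorem limit_of_reduced_extension:
  fixes c :: "nat \<Rightarrow> nat \<Rightarrow> nat \<Rightarrow> 'k" and u :: "nat \<Rightarrow> 'k"
  assumes inf: "infinite (UNIV :: 'k set)"
    and alg: "is_algebra d (c, u)" and lim: "limit_of_reduced d (c, u)"
    and eps_mult: "\<And>p q. aug d \<epsilon> (smul d c p q) = aug d \<epsilon> p * aug d \<epsilon> q"
    and eps_u: "aug d \<epsilon> u = 1" 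
    and mult_s: "\<And>p. p \<in> vecs d \<Longrightarrow> smul d c p s = scale (aug d \<epsilon> p) s"
  shows "limit_of_reduced (Suc d) (consts_of (ext_mult d \<epsilon> s c), u)"
  unfolding limit_of_reduced_def
proof (intro ballI impI)
  fix f :: "'k algebra_data \<Rightarrow> 'k"
  assume f: "f \<in> gen_alg coords" and nz: "f (consts_of (ext_mult d \<epsilon> s c), u) \<noteq> 0"
  define b :: "nat \<Rightarrow> nat \<Rightarrow> nat \<Rightarrow> 'k" where "b i j l = (if i = d \<and> j = d \<and> l = d then 1 else 0)" for i j l
  obtain H where H: "\<And>t. f (\<lambda>i j l. consts_of (ext_mult d \<epsilon> s c) i j l + t * b i j l, u) = poly H t"
    using gen_alg_coords_line[OF f] by metis
  have "poly H 0 \<noteq> 0" using nz by (simp add: H[symmetric])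
  then have "H \<noteq> 0" by auto
  \<comment> \<open>The factor \<open>[:0, 1:]\<close> makes 0 a root, so that the parameter found is nonzero.\<close>
  then have "finite {t. poly (H * [:0,1:]) t = 0}" by (intro poly_roots_finite) auto
  then obtain t where t: "poly H t \<noteq> 0" "t \<noteq> 0"
    using inf by (metis (mono_tags, lifting) ex_new_if_finite mem_Collect_eq mult_eq_0_iff
        pCons_0_0 poly_mult poly_pCons add.left_neutral mult_zero_left mult_1_right poly_0)
  have sc: "smul d c s P = scale (aug d \<epsilon> P) s" "smul d c P s = scale (aug d \<epsilon> P) s" for P
  proof -
    define P' where "P' = (\<lambda>i. if i < d then P i else 0)"
    have "smul d c P s = smul d c P' s" "aug d \<epsilon> P = aug d \<epsilon> P'" "P' \<in> vecs d"
      by (auto simp: P'_def vecs_def aug_def intro!: smul_cong)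
    then show "smul d c P s = scale (aug d \<epsilon> P) s" using mult_s by simp
    then show "smul d c s P = scale (aug d \<epsilon> P) s" using is_algebraD(4)[OF alg] by metis
  qed
  have q: "smul d c (deform_proj d s t P) (deform_proj d s t Q) =
      smul d c P Q - scale ((P d * aug d \<epsilon> Q + Q d * aug d \<epsilon> P) / t) s" for P Q
    by (rule ext) (simp add: deform_proj_def smul_diff smul_add smul_scale sc eps_s add_divide_distrib algebra_simps)
  have \<alpha>: "((aug d \<epsilon> P + t * P d) * (aug d \<epsilon> Q + t * Q d) - aug d \<epsilon> P * aug d \<epsilon> Q) / t
      = P d * aug d \<epsilon> Q + Q d * aug d \<epsilon> P + t * (P d * Q d)" for P Q
    using t(2) by (simp add: field_simps)
  have "deform_mult d \<epsilon> s t c P Q = ext_mult d \<epsilon> s c P Q + scale (t * (P d * Q d)) (basis_vec d)" for P Q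
    using t(2)
    by (intro ext) (simp add: deform_mult_def ext_mult_def Let_def q aug_linear eps_s eps_mult \<alpha>
        add_divide_distrib algebra_simps del: divide_divide_eq_left)
  then have "consts_of (deform_mult d \<epsilon> s t c) = (\<lambda>i j l. consts_of (ext_mult d \<epsilon> s c) i j l + t * b i j l)"
    by (auto simp: consts_of_def b_def fun_eq_iff basis_vec_def)
  moreover have "deform_unit d \<epsilon> s t u = u"
    by (simp add: deform_unit_def eps_u fun_eq_iff)
  ultimately have nz2: "f (consts_of (deform_mult d \<epsilon> s t c), deform_unit d \<epsilon> s t u) \<noteq> 0"
    using H t by simp
  define F where "F S = (consts_of (deform_mult d \<epsilon> s t (fst S)), deform_unit d \<epsilon> s t (snd S))" for S
  have "(\<lambda>S. f (F S)) \<in> gen_alg coords"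
    using f by (rule gen_alg_coords_comp) (simp_all add: F_def gen_alg_deform)
  moreover have "f (F (c, u)) \<noteq> 0" using nz2 by (simp add: F_def)
  ultimately obtain S where S: "is_algebra d S" "is_reduced d S" "f (F S) \<noteq> 0"
    using lim[unfolded limit_of_reduced_def, rule_format, of "\<lambda>S. f (F S)"] by auto
  obtain c' u' where "S = (c', u')" by (cases S)
  then have "is_algebra (Suc d) (F S)" "is_reduced (Suc d) (F S)"
    using deform_algebra[OF t(2), of c' u'] deform_reduced[OF t(2), of c' u'] S by (auto simp: F_def)
  then show "\<exists>S'. is_algebra (Suc d) S' \<and> is_reduced (Suc d) S' \<and> f S' \<noteq> 0" using S by blast
qed

end

section \<open>The polynomial algebra and its ideals\<close>

lemma poly_alg_simps [simp]:
  "carrier (poly_alg n) = {p. Poly_Mapping.keys p \<subseteq> monoms n}"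
  "x \<otimes>\<^bsub>poly_alg n\<^esub> y = x * y" "\<one>\<^bsub>poly_alg n\<^esub> = 1" "\<zero>\<^bsub>poly_alg n\<^esub> = 0"
  "x \<oplus>\<^bsub>poly_alg n\<^esub> y = x + y" "c \<odot>\<^bsub>poly_alg n\<^esub> x = Poly_Mapping.single 0 c * x"
  by (simp_all add: poly_alg_def)

lemma monoms_add: "m \<in> monoms n \<Longrightarrow> m' \<in> monoms n \<Longrightarrow> m + m' \<in> monoms n"
  using Poly_Mapping.keys_add[of m m'] by (auto simp: monoms_def)

lemma zero_in_monoms [simp]: "0 \<in> monoms n"
  by (simp add: monoms_def)

lemma keys_monoms_closed:
  fixes p q :: "'k::field mpoly"
  shows "Poly_Mapping.keys p \<subseteq> monoms n \<Longrightarrow> Poly_Mapping.keys q \<subseteq> monoms n \<Longrightarrow> Poly_Mapping.keys (p * q) \<subseteq> monoms n"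
    and "Poly_Mapping.keys p \<subseteq> T \<Longrightarrow> Poly_Mapping.keys q \<subseteq> T \<Longrightarrow> Poly_Mapping.keys (p + q) \<subseteq> T"
    and "Poly_Mapping.keys p \<subseteq> T \<Longrightarrow> Poly_Mapping.keys q \<subseteq> T \<Longrightarrow> Poly_Mapping.keys (p - q) \<subseteq> T"
    and "Poly_Mapping.keys p \<subseteq> T \<Longrightarrow> Poly_Mapping.keys (- p) \<subseteq> T"
    and "m \<in> T \<Longrightarrow> Poly_Mapping.keys (Poly_Mapping.single m a) \<subseteq> T"
proof -
  assume "Poly_Mapping.keys p \<subseteq> monoms n" "Poly_Mapping.keys q \<subseteq> monoms n"
  then show "Poly_Mapping.keys (p * q) \<subseteq> monoms n"
    using keys_mult[of p q] monoms_add by blast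
qed (use keys_add[of p q] keys_diff[of p q] in \<open>auto simp: keys_single\<close>)

lemma keys_one_monoms: "Poly_Mapping.keys (1 :: 'k::field mpoly) \<subseteq> monoms n"
  using keys_monoms_closed(5)[OF zero_in_monoms, of "1::'k" n] by (simp only: single_one)

lemma poly_alg_cring: "cring (poly_alg n :: ('k::field, 'k mpoly) module)"
proof (rule cringI)
  have one: "Poly_Mapping.keys (1 :: 'k mpoly) \<subseteq> monoms n" by (rule keys_one_monoms)
  show "abelian_group (poly_alg n :: ('k, 'k mpoly) module)"
  proof (rule abelian_groupI)
    fix x :: "'k mpoly" assume "x \<in> carrier (poly_alg n)"
    then show "\<exists>y\<in>carrier (poly_alg n). y \<oplus>\<^bsub>poly_alg n\<^esub> x = \<zero>\<^bsub>poly_alg n\<^esub>"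
      by (intro bexI[of _ "- x"]) (simp_all only: poly_alg_simps mem_Collect_eq keys_monoms_closed left_minus)
  qed (simp_all only: poly_alg_simps mem_Collect_eq keys_monoms_closed ac_simps add_0_left add_0_right keys_zero empty_subsetI)
  show "comm_monoid (poly_alg n :: ('k, 'k mpoly) module)"
    by (rule comm_monoidI)
       (simp_all only: poly_alg_simps mem_Collect_eq keys_monoms_closed ac_simps mult_1_left mult_1_right one)
qed (simp add: distrib_right)

lemma poly_alg_a_inv:
  fixes p :: "'k::field mpoly"
  assumes "Poly_Mapping.keys p \<subseteq> monoms n"
  shows "\<ominus>\<^bsub>poly_alg n\<^esub> p = - p"
proof -
  interpret cring "poly_alg n :: ('k::field, 'k mpoly) module" by (rule poly_alg_cring)
  show ?thesis
    using assms keys_monoms_closed(4)[OF assms] by (intro minus_equality) auto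
qed

lemma poly_ideal_closed:
  fixes J :: "'k::field mpoly set"
  assumes "ideal J (poly_alg n)"
  shows "0 \<in> J" "p \<in> J \<Longrightarrow> q \<in> J \<Longrightarrow> p + q \<in> J" "p \<in> J \<Longrightarrow> q \<in> J \<Longrightarrow> p - q \<in> J"
    "p \<in> J \<Longrightarrow> - p \<in> J"
    "p \<in> J \<Longrightarrow> Poly_Mapping.keys q \<subseteq> monoms n \<Longrightarrow> q * p \<in> J" 
    "p \<in> J \<Longrightarrow> Poly_Mapping.keys p \<subseteq> monoms n"
proof -
  interpret ideal J "poly_alg n" by fact
  note sub = ideal.axioms(1)[OF assms]
  show "0 \<in> J" using additive_subgroup.zero_closed[OF ideal.axioms(1)[OF assms]] by simp
  show add: "p \<in> J \<Longrightarrow> q \<in> J \<Longrightarrow> p + q \<in> J" for p q using additive_subgroup.a_closed[OF sub] by simp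
  show carr: "p \<in> J \<Longrightarrow> Poly_Mapping.keys p \<subseteq> monoms n" for p using Icarr[of p] by simp
  show uminus: "p \<in> J \<Longrightarrow> - p \<in> J" for p using additive_subgroup.a_inv_closed[OF sub, of p] poly_alg_a_inv[of p n] carr[of p] by simp
  show "p \<in> J \<Longrightarrow> q \<in> J \<Longrightarrow> p - q \<in> J" using add[of p "- q"] uminus by simp
  show "p \<in> J \<Longrightarrow> Poly_Mapping.keys q \<subseteq> monoms n \<Longrightarrow> q * p \<in> J"
    using I_l_closed[of p q] by simp
qed

lemma poly_ideal_sum:
  fixes J :: "'k::field mpoly set"
  assumes "ideal J (poly_alg n)" "\<And>i. i \<in> I \<Longrightarrow> f i \<in> J"
  shows "(\<Sum>i\<in>I. f i) \<in> J"
  using assms(2) by (induction I rule: infinite_finite_induct) (auto intro: poly_ideal_closed[OF assms(1)])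

lemma hilb_chart_normal_form:
  fixes J :: "'k::field mpoly set"
  assumes "J \<in> hilb_chart n B" "Poly_Mapping.keys p \<subseteq> monoms n"
  shows "Poly_Mapping.keys (normal_form B J p) \<subseteq> B" "p - normal_form B J p \<in> J"
    "Poly_Mapping.keys q \<subseteq> B \<Longrightarrow> p - q \<in> J \<Longrightarrow> normal_form B J p = q"
proof -
  have ex1: "\<exists>!q. Poly_Mapping.keys q \<subseteq> B \<and> p - q \<in> J" using assms by (simp add: hilb_chart_def)
  from theI'[OF ex1] show "Poly_Mapping.keys (normal_form B J p) \<subseteq> B" "p - normal_form B J p \<in> J"
    by (simp_all add: normal_form_def)
  show "Poly_Mapping.keys q \<subseteq> B \<Longrightarrow> p - q \<in> J \<Longrightarrow> normal_form B J p = q"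
    unfolding normal_form_def using ex1 by (intro the1_equality) auto
qed

text \<open>
  An isomorphism from the algebra with structure constants \<open>S\<close> onto
  \<open>A\<close>, that is, a choice of basis of \<open>A\<close> with these structure
  constants.
\<close>

definition presents :: "nat \<Rightarrow> 'k::field algebra_data \<Rightarrow> ('k, 'a) module \<Rightarrow> ((nat \<Rightarrow> 'k) \<Rightarrow> 'a) \<Rightarrow> bool" where
  "presents d S A \<iota> \<longleftrightarrow> bij_betw \<iota> (vecs d) (carrier A) \<and>
     (\<forall>p\<in>vecs d. \<forall>q\<in>vecs d. \<iota> (p + q) = \<iota> p \<oplus>\<^bsub>A\<^esub> \<iota> q) \<and>
     (\<forall>k. \<forall>p\<in>vecs d. \<iota> (scale k p) = k \<odot>\<^bsub>A\<^esub> \<iota> p) \<and>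
     (\<forall>p\<in>vecs d. \<forall>q\<in>vecs d. \<iota> (smul d (fst S) p q) = \<iota> p \<otimes>\<^bsub>A\<^esub> \<iota> q) \<and>
     snd S \<in> vecs d \<and> \<iota> (snd S) = \<one>\<^bsub>A\<^esub>"

section \<open>Structure constants on a chart of the Hilbert scheme\<close>

definition basis_comb :: "nat \<Rightarrow> (nat \<Rightarrow> monom) \<Rightarrow> (nat \<Rightarrow> 'k::field) \<Rightarrow> 'k mpoly" where
  "basis_comb d b p = (\<Sum>i<d. Poly_Mapping.single (b i) (p i))"

text \<open>
  The structure constants of the quotient by \<open>J\<close> with respect to the monomials
  \<open>b 0, \<dots>, b (d - 1)\<close>. Inside the range they are coordinate functions of the
  chart; they are set to 0 for indices outside the range so that all of them are regular.
\<close>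

definition chart_data :: "nat \<Rightarrow> (nat \<Rightarrow> monom) \<Rightarrow> 'k::field mpoly set \<Rightarrow> 'k algebra_data" where
  "chart_data d b J =
     (\<lambda>i j l. if i < d \<and> j < d \<and> l < d
        then Poly_Mapping.lookup (normal_form (b ` {..<d}) J (Poly_Mapping.single (b i + b j) 1)) (b l) else 0,
      \<lambda>l. if l < d then Poly_Mapping.lookup (normal_form (b ` {..<d}) J (Poly_Mapping.single 0 1)) (b l) else 0)"

lemma basis_comb_add: "basis_comb d b (p + q) = basis_comb d b p + basis_comb d b q"
  by (simp add: basis_comb_def single_add sum.distrib)

lemma basis_comb_scale: "basis_comb d b (scale k p) = Poly_Mapping.single 0 k * basis_comb d b p"
  by (simp add: basis_comb_def sum_distrib_left mult_single)

lemma basis_comb_keys: "Poly_Mapping.keys (basis_comb d b p) \<subseteq> b ` {..<d}"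
proof -
  have "Poly_Mapping.keys (basis_comb d b p) \<subseteq> (\<Union>i<d. Poly_Mapping.keys (Poly_Mapping.single (b i) (p i)))"
    unfolding basis_comb_def by (rule keys_sum)
  then show ?thesis by (auto simp: keys_single split: if_splits)
qed

lemma lookup_basis_comb:
  assumes "inj_on b {..<d}" "l < d"
  shows "Poly_Mapping.lookup (basis_comb d b p) (b l) = p l"
proof -
  have "Poly_Mapping.lookup (basis_comb d b p) (b l) = (\<Sum>i<d. if i = l then p i else 0)"
    unfolding basis_comb_def lookup_sum
    by (rule sum.cong) (use assms in \<open>auto simp: lookup_single when_def inj_on_def\<close>)
  also have "\<dots> = p l" using assms by simp
  finally show ?thesis .
qed

lemma basis_comb_lookup:
  assumes "inj_on b {..<d}" "Poly_Mapping.keys q \<subseteq> b ` {..<d}"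
  shows "basis_comb d b (\<lambda>l. if l < d then Poly_Mapping.lookup q (b l) else 0) = q"
proof (rule poly_mapping_eqI)
  fix m show "Poly_Mapping.lookup (basis_comb d b (\<lambda>l. if l < d then Poly_Mapping.lookup q (b l) else 0)) m
      = Poly_Mapping.lookup q m" (is "Poly_Mapping.lookup ?r m = _")
  proof (cases "m \<in> b ` {..<d}")
    case True then show ?thesis using assms(1) by (auto simp: lookup_basis_comb)
  next
    case False
    then have "m \<notin> Poly_Mapping.keys ?r" "m \<notin> Poly_Mapping.keys q"
      using basis_comb_keys assms(2) by blast+
    then show ?thesis by (simp add: in_keys_iff)
  qed
qed

locale chart_point =
  fixes d n :: nat and b :: "nat \<Rightarrow> monom" and J :: "'k::field mpoly set"
  assumes inj: "inj_on b {..<d}" and b_monoms: "b ` {..<d} \<subseteq> monoms n"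
    and J: "J \<in> hilb_chart n (b ` {..<d})"
begin

lemma ideal: "ideal J (poly_alg n)"
  using J by (simp add: hilb_chart_def)

lemmas closed = poly_ideal_closed[OF ideal]

lemma basis_comb_carrier: "Poly_Mapping.keys (basis_comb d b p) \<subseteq> monoms n" for p :: "nat \<Rightarrow> 'k"
  using basis_comb_keys b_monoms by blast

lemma basis_comb_inj:
  assumes "p \<in> vecs d" "q \<in> vecs d" "basis_comb d b p - basis_comb d b q \<in> J"
  shows "p = q"
proof -
  have "normal_form (b ` {..<d}) J (basis_comb d b p) = basis_comb d b q"
    "normal_form (b ` {..<d}) J (basis_comb d b p) = basis_comb d b p"
    using assms(3) closed(1) by (auto intro!: hilb_chart_normal_form(3)[OF J] basis_comb_carrier basis_comb_keys)
  then have "p l = q l" if "l < d" for l using lookup_basis_comb[OF inj that] by metis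
  then show ?thesis using assms(1,2) by (auto simp: vecs_def fun_eq_iff not_less) (metis not_less)
qed

lemma basis_comb_surj:
  assumes "Poly_Mapping.keys q \<subseteq> monoms n"
  obtains p where "p \<in> vecs d" "q - basis_comb d b p \<in> J" "basis_comb d b p = normal_form (b ` {..<d}) J q"
proof
  let ?p = "\<lambda>l. if l < d then Poly_Mapping.lookup (normal_form (b ` {..<d}) J q) (b l) else 0"
  show "?p \<in> vecs d" by (simp add: vecs_def)
  show "basis_comb d b ?p = normal_form (b ` {..<d}) J q"
    by (rule basis_comb_lookup[OF inj hilb_chart_normal_form(1)[OF J assms]])
  then show "q - basis_comb d b ?p \<in> J" using hilb_chart_normal_form(2)[OF J assms] by simp
qed

lemma basis_comb_mult:
  "basis_comb d b (smul d (fst (chart_data d b J)) p q) - basis_comb d b p * basis_comb d b q \<in> J"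
proof -
  define c where "c = fst (chart_data d b J)"
  have c: "basis_comb d b (c i j) - Poly_Mapping.single (b i + b j) 1 \<in> J" if "i < d" "j < d" for i j
  proof -
    have m: "Poly_Mapping.keys (Poly_Mapping.single (b i + b j) (1::'k)) \<subseteq> monoms n"
      using that b_monoms by (intro keys_monoms_closed monoms_add) auto
    have "c i j = (\<lambda>l. if l < d then Poly_Mapping.lookup (normal_form (b ` {..<d}) J
        (Poly_Mapping.single (b i + b j) 1)) (b l) else 0)"
      using that by (simp add: c_def chart_data_def)
    then have "basis_comb d b (c i j) = normal_form (b ` {..<d}) J (Poly_Mapping.single (b i + b j) 1)"
      using basis_comb_lookup[OF inj hilb_chart_normal_form(1)[OF J m]] by simp
    then show ?thesis using closed(4)[OF hilb_chart_normal_form(2)[OF J m]] by simp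
  qed
  have "smul d c p q = (\<Sum>i<d. \<Sum>j<d. scale (p i * q j) (c i j))"
    by (rule ext) (auto simp: smul_def sum_fun_apply c_def chart_data_def)
  moreover have "basis_comb d b (\<Sum>i\<in>I. f i) = (\<Sum>i\<in>I. basis_comb d b (f i))" for f :: "nat \<Rightarrow> nat \<Rightarrow> 'k" and I
    by (rule additive.sum[of "basis_comb d b"]) (simp add: additive_def basis_comb_add)
  ultimately have 1: "basis_comb d b (smul d c p q) =
      (\<Sum>i<d. \<Sum>j<d. Poly_Mapping.single 0 (p i * q j) * basis_comb d b (c i j))"
    by (simp add: basis_comb_scale)
  have 2: "basis_comb d b p * basis_comb d b q =
      (\<Sum>i<d. \<Sum>j<d. Poly_Mapping.single 0 (p i * q j) * Poly_Mapping.single (b i + b j) 1)"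
    by (simp add: basis_comb_def sum_product mult_single)
  have "basis_comb d b (smul d c p q) - basis_comb d b p * basis_comb d b q =
      (\<Sum>i<d. \<Sum>j<d. Poly_Mapping.single 0 (p i * q j) *
         (basis_comb d b (c i j) - Poly_Mapping.single (b i + b j) 1))"
    unfolding 1 2 by (simp add: sum_subtractf right_diff_distrib)
  also have "\<dots> \<in> J"
    by (intro poly_ideal_sum[OF ideal] closed(5) c) (auto simp: keys_single)
  finally show ?thesis by (simp add: c_def)
qed

lemma basis_comb_unit: "1 - basis_comb d b (snd (chart_data d b J)) \<in> J" "snd (chart_data d b J) \<in> vecs d"
proof -
  have m: "Poly_Mapping.keys (1 :: 'k mpoly) \<subseteq> monoms n" by (rule keys_one_monoms)
  have "basis_comb d b (snd (chart_data d b J)) = normal_form (b ` {..<d}) J 1"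
    using basis_comb_lookup[OF inj hilb_chart_normal_form(1)[OF J m]] unfolding chart_data_def snd_conv single_one .
  then show "1 - basis_comb d b (snd (chart_data d b J)) \<in> J"
    using hilb_chart_normal_form(2)[OF J m] by simp
  show "snd (chart_data d b J) \<in> vecs d" by (simp add: chart_data_def vecs_def)
qed

text \<open>
  The algebra laws are inherited from the polynomial ring, as a vector is determined by its
  polynomial modulo \<open>J\<close>.
\<close>

lemma chart_data_algebra: "is_algebra d (chart_data d b J)"
proof -
  let ?c = "fst (chart_data d b J)" and ?u = "snd (chart_data d b J)" and ?r = "basis_comb d b"
  note M = basis_comb_mult and bc = basis_comb_carrier
  have "smul d ?c ?u p = p" if "p \<in> vecs d" for p
  proof (rule basis_comb_inj)
    have "?r (smul d ?c ?u p) - ?r p = (?r (smul d ?c ?u p) - ?r ?u * ?r p) - ?r p * (1 - ?r ?u)"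
      by (simp add: algebra_simps)
    also have "\<dots> \<in> J" by (intro closed M bc basis_comb_unit)
    finally show "?r (smul d ?c ?u p) - ?r p \<in> J" .
  qed (use that in auto)
  moreover have "smul d ?c p q = smul d ?c q p" for p q
  proof (rule basis_comb_inj)
    have "?r (smul d ?c p q) - ?r (smul d ?c q p) =
        (?r (smul d ?c p q) - ?r p * ?r q) - (?r (smul d ?c q p) - ?r q * ?r p)"
      by (simp add: algebra_simps)
    also have "\<dots> \<in> J" by (intro closed M)
    finally show "?r (smul d ?c p q) - ?r (smul d ?c q p) \<in> J" .
  qed auto
  moreover have "smul d ?c (smul d ?c p q) r = smul d ?c p (smul d ?c q r)" for p q r
  proof (rule basis_comb_inj)
    let ?pq = "smul d ?c p q" and ?qr = "smul d ?c q r"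
    have "?r (smul d ?c ?pq r) - ?r (smul d ?c p ?qr) =
        (?r (smul d ?c ?pq r) - ?r ?pq * ?r r) + ?r r * (?r ?pq - ?r p * ?r q)
        - (?r (smul d ?c p ?qr) - ?r p * ?r ?qr) - ?r p * (?r ?qr - ?r q * ?r r)"
      by (simp add: algebra_simps)
    also have "\<dots> \<in> J" by (intro closed M bc)
    finally show "?r (smul d ?c ?pq r) - ?r (smul d ?c p ?qr) \<in> J" .
  qed auto
  ultimately show ?thesis
    unfolding is_algebra_def using basis_comb_unit(2) by blast
qed

lemma chart_data_reduced:
  assumes "\<And>p. Poly_Mapping.keys p \<subseteq> monoms n \<Longrightarrow> p ^ 2 \<in> J \<Longrightarrow> p \<in> J"
  shows "is_reduced d (chart_data d b J)"
  unfolding is_reduced_def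
proof (intro ballI impI)
  fix p assume p: "p \<in> vecs d" "smul d (fst (chart_data d b J)) p p = 0"
  have z: "basis_comb d b 0 = 0" by (simp add: basis_comb_def)
  have "- (basis_comb d b p ^ 2) \<in> J" using basis_comb_mult[of p p] p by (simp add: z power2_eq_square)
  then have "basis_comb d b p \<in> J" using assms[OF basis_comb_carrier] closed(4) by fastforce
  then show "p = 0" using basis_comb_inj[of p 0] p by (simp add: z)
qed

end

lemma chart_data_regular:
  fixes f :: "'k::field algebra_data \<Rightarrow> 'k"
  assumes "f \<in> gen_alg coords" "b ` {..<d} \<subseteq> monoms n"
  shows "(\<lambda>J. f (chart_data d b J)) \<in> regular_functions n (b ` {..<d})"
proof -
  let ?G = "regular_functions n (b ` {..<d}) :: ('k mpoly set \<Rightarrow> 'k) set"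
  have *: "g \<in> ?G" if "g \<in> gen_alg ?G" for g
    using that by induction (auto intro: regular_functions.intros)
  have "(\<lambda>J. fst (chart_data d b J) i j l) \<in> ?G" for i j l
    using assms(2)
    by (cases "i < d \<and> j < d \<and> l < d")
       (auto simp: chart_data_def intro!: regular_functions.const regular_functions.coord monoms_add)
  moreover have "(\<lambda>J. snd (chart_data d b J) l) \<in> ?G" for l
    by (cases "l < d") (auto simp: chart_data_def intro!: regular_functions.const regular_functions.coord[of 0, unfolded single_one])
  ultimately show ?thesis
    by (intro *[OF gen_alg_coords_comp[OF assms(1)]] gen_alg.gen)
qed

lemma ring_homD:
  assumes "\<phi> \<in> Ring.ring_hom R S" "x \<in> carrier R" 
  shows "\<phi> x \<in> carrier S" "y \<in> carrier R \<Longrightarrow> \<phi> (x \<oplus>\<^bsub>R\<^esub> y) = \<phi> x \<oplus>\<^bsub>S\<^esub> \<phi> y"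
    "y \<in> carrier R \<Longrightarrow> \<phi> (x \<otimes>\<^bsub>R\<^esub> y) = \<phi> x \<otimes>\<^bsub>S\<^esub> \<phi> y" "\<phi> \<one>\<^bsub>R\<^esub> = \<one>\<^bsub>S\<^esub>"
  using assms by (auto simp: Ring.ring_hom_def)

text \<open>
  One chart around the given point suffices: a polynomial function of the structure constants is
  a regular function on the chart, and the principal open set that it defines meets the reduced
  points.
\<close>

theorem smoothable_imp_limit_of_reduced:
  fixes Q :: "('k::field, 'q) module"
  assumes alg: "k_algebra Q" and smooth: "smoothable Q"
  obtains d S \<iota> where "is_algebra d S" "presents d S Q \<iota>" "limit_of_reduced d S"
proof -
  obtain d \<phi> where hom: "\<phi> \<in> alg_hom (poly_alg d) Q" and surj: "\<phi> ` carrier (poly_alg d) = carrier Q"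
    and clos: "a_kernel (poly_alg d) Q \<phi> \<in> hilb d d closure_of reduced_points d d"
    using smooth unfolding smoothable_def by blast
  define I where "I = a_kernel (poly_alg d) Q \<phi>"
  have "I \<in> topspace (hilb d d)"
    using clos unfolding I_def in_closure_of by simp
  then obtain B f where B: "B \<subseteq> monoms d" "finite B" "card B = d" "I \<in> hilb_chart d B"
    unfolding hilb_def topology_generated_by_topspace by blast
  obtain b where b: "bij_betw b {..<d} B"
    using ex_bij_betw_nat_finite[OF B(2)] B(3) by (auto simp: atLeast0LessThan)
  have Bb: "B = b ` {..<d}" and inj: "inj_on b {..<d}" using b by (auto simp: bij_betw_def)
  have cp: "chart_point d d b J" if "J \<in> hilb_chart d B" for J :: "'k mpoly set"
    using that B(1) inj by unfold_locales (auto simp: Bb)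
  interpret chart_point d d b I by (rule cp) (rule B)
  interpret Q: algebra ring_of_type_algebra Q by fact
  have rh: "\<phi> \<in> Ring.ring_hom (poly_alg d) Q" and sm: "\<And>c x. x \<in> carrier (poly_alg d) \<Longrightarrow> \<phi> (Poly_Mapping.single 0 c * x) = c \<odot>\<^bsub>Q\<^esub> \<phi> x"
    using hom by (auto simp: alg_hom_def)
  have ker: "p \<in> I \<longleftrightarrow> \<phi> p = \<zero>\<^bsub>Q\<^esub>" if "Poly_Mapping.keys p \<subseteq> monoms d" for p
    using that by (auto simp: I_def a_kernel_def')
  have ker2: "\<phi> p = \<phi> q \<longleftrightarrow> p - q \<in> I" if "Poly_Mapping.keys p \<subseteq> monoms d" "Poly_Mapping.keys q \<subseteq> monoms d" for p q
  proof -
    have pq: "Poly_Mapping.keys (p - q) \<subseteq> monoms d" using that by (intro keys_monoms_closed)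
    have car: "\<phi> (p - q) \<in> carrier Q" "\<phi> q \<in> carrier Q" using ring_homD(1)[OF rh] pq that by auto
    have "\<phi> p = \<phi> (p - q) \<oplus>\<^bsub>Q\<^esub> \<phi> q" using ring_homD(2)[OF rh, of "p - q" q] pq that by simp
    then show ?thesis using car ker[OF pq] by (metis Q.M.add.l_cancel_one' Q.M.add.r_cancel_one Q.M.zero_closed Q.M.l_zero)
  qed
  let ?S = "chart_data d b I" and ?\<iota> = "\<lambda>p. \<phi> (basis_comb d b p)"
  have "presents d ?S Q ?\<iota>"
    unfolding presents_def
  proof (intro conjI ballI allI)
    show "bij_betw ?\<iota> (vecs d) (carrier Q)"
      unfolding bij_betw_def
    proof
      show "inj_on ?\<iota> (vecs d)"
        by (rule inj_onI) (metis ker2 basis_comb_carrier basis_comb_inj)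
      have "y \<in> ?\<iota> ` vecs d" if y: "y \<in> carrier Q" for y
      proof -
        obtain q where q: "Poly_Mapping.keys q \<subseteq> monoms d" "\<phi> q = y"
          using y surj[symmetric] by auto
        obtain p where "p \<in> vecs d" "q - basis_comb d b p \<in> I" using basis_comb_surj[OF q(1)] by metis
        then have "\<phi> q = ?\<iota> p" using ker2 q(1) basis_comb_carrier by blast
        then show ?thesis using q \<open>p \<in> vecs d\<close> by blast
      qed
      moreover have "?\<iota> p \<in> carrier Q" for p using ring_homD(1)[OF rh] basis_comb_carrier by simp
      ultimately show "?\<iota> ` vecs d = carrier Q" by blast
    qed
  next
    fix p q
    show "?\<iota> (p + q) = ?\<iota> p \<oplus>\<^bsub>Q\<^esub> ?\<iota> q"
      using ring_homD(2)[OF rh, of "basis_comb d b p" "basis_comb d b q"] basis_comb_carrier by (simp add: basis_comb_add)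
    show "?\<iota> (scale k p) = k \<odot>\<^bsub>Q\<^esub> ?\<iota> p" for k
      using sm[of "basis_comb d b p" k] basis_comb_carrier by (simp add: basis_comb_scale)
    have "?\<iota> (smul d (fst ?S) p q) = \<phi> (basis_comb d b p * basis_comb d b q)"
      using ker2[OF basis_comb_carrier keys_monoms_closed(1)[OF basis_comb_carrier basis_comb_carrier]]
        basis_comb_mult by blast
    then show "?\<iota> (smul d (fst ?S) p q) = ?\<iota> p \<otimes>\<^bsub>Q\<^esub> ?\<iota> q"
      using ring_homD(3)[OF rh, of "basis_comb d b p" "basis_comb d b q"] basis_comb_carrier by simp
  next
    show "snd ?S \<in> vecs d" by (rule basis_comb_unit)
    have m: "Poly_Mapping.keys (1 :: 'k mpoly) \<subseteq> monoms d" by (rule keys_one_monoms)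
    have "\<phi> 1 = ?\<iota> (snd ?S)"
      using ker2[OF m basis_comb_carrier] basis_comb_unit(1) by blast
    then show "?\<iota> (snd ?S) = \<one>\<^bsub>Q\<^esub>" using ring_homD(4)[OF rh, of 1] m by simp
  qed
  moreover have "limit_of_reduced d ?S"
    unfolding limit_of_reduced_def
  proof (intro ballI impI)
    fix f :: "'k algebra_data \<Rightarrow> 'k" assume f: "f \<in> gen_alg coords" "f ?S \<noteq> 0"
    have reg: "(\<lambda>J. f (chart_data d b J)) \<in> regular_functions d B"
      unfolding Bb using chart_data_regular[OF f(1)] B(1) Bb by blast
    let ?U = "{J \<in> hilb_chart d B. f (chart_data d b J) \<noteq> 0}"
    have "openin (hilb d d) ?U"
      unfolding hilb_def
      by (rule topology_generated_by_Basis, rule CollectI, rule exI[of _ B],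
          rule exI[of _ "\<lambda>J. f (chart_data d b J)"]) (use reg B in simp)
    moreover have "I \<in> ?U" using f B by simp
    ultimately have "\<exists>J. J \<in> reduced_points d d \<and> J \<in> ?U"
      by (intro clos[folded I_def, unfolded in_closure_of, THEN conjunct2, rule_format] conjI)
    then obtain J where J: "J \<in> reduced_points d d" "J \<in> ?U" by (elim exE conjE)
    interpret J: chart_point d d b J by (rule cp) (use J in blast)
    have "is_reduced d (chart_data d b J)"
      using J(1) unfolding reduced_points_def by (intro J.chart_data_reduced) auto
    then show "\<exists>S'. is_algebra d S' \<and> is_reduced d S' \<and> f S' \<noteq> 0"
      using J.chart_data_algebra J(2) by blast
  qed
  ultimately show thesis using that chart_data_algebra by blast
qed

section \<open>Evaluation of polynomials at the basis vectors\<close>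

primrec vpow :: "nat \<Rightarrow> 'k::field algebra_data \<Rightarrow> (nat \<Rightarrow> 'k) \<Rightarrow> nat \<Rightarrow> (nat \<Rightarrow> 'k)" where
  "vpow d S p 0 = snd S"
| "vpow d S p (Suc n) = smul d (fst S) p (vpow d S p n)"

text \<open>
  The value of a monomial in the first \<open>n\<close> variables when variable number
  \<open>i\<close> is sent to the basis vector number \<open>i\<close>.
\<close>

primrec monom_val :: "nat \<Rightarrow> 'k::field algebra_data \<Rightarrow> nat \<Rightarrow> monom \<Rightarrow> nat \<Rightarrow> 'k" where
  "monom_val d S 0 m = snd S"
| "monom_val d S (Suc n) m =
     smul d (fst S) (vpow d S (basis_vec n) (Poly_Mapping.lookup m n)) (monom_val d S n m)"

definition evaluate :: "nat \<Rightarrow> 'k::field algebra_data \<Rightarrow> 'k mpoly \<Rightarrow> nat \<Rightarrow> 'k" where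
  "evaluate d S P = (\<Sum>m\<in>Poly_Mapping.keys P. scale (Poly_Mapping.lookup P m) (monom_val d S d m))"

text \<open>
  The point of the Hilbert scheme of affine \<open>d\<close>-space that belongs to the structure
  constants \<open>S\<close>.
\<close>

definition eval_kernel :: "nat \<Rightarrow> 'k::field algebra_data \<Rightarrow> 'k mpoly set" where
  "eval_kernel d S = {P \<in> carrier (poly_alg d). evaluate d S P = 0}"

lemma gen_alg_monom_val:
  "(\<lambda>S. monom_val d S n m l) \<in> gen_alg (coords :: ('k::field algebra_data \<Rightarrow> 'k) set)"
proof -
  have sm: "(\<lambda>S. smul d (fst S) (x S) (y S) l) \<in> gen_alg coords"
    if "\<And>i. (\<lambda>S. x S i) \<in> gen_alg coords" "\<And>i. (\<lambda>S. y S i) \<in> gen_alg coords"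
    for x y :: "'k algebra_data \<Rightarrow> nat \<Rightarrow> 'k" and l
    unfolding smul_def by (cases "l < d") (auto intro!: gen_alg_intros coords_in_gen_alg that)
  have vp: "(\<lambda>S. vpow d S p k l) \<in> gen_alg coords" for p :: "nat \<Rightarrow> 'k" and k l
    by (induction k arbitrary: l) (auto intro!: coords_in_gen_alg sm gen_alg.const)
  show ?thesis
    by (induction n arbitrary: l) (auto intro!: coords_in_gen_alg sm vp)
qed

lemma mpoly_expand: "P = (\<Sum>m\<in>Poly_Mapping.keys P. Poly_Mapping.single m (Poly_Mapping.lookup P m))"
  for P :: "'k::field mpoly"
proof (rule poly_mapping_eqI)
  fix m
  have "Poly_Mapping.lookup (\<Sum>m\<in>Poly_Mapping.keys P. Poly_Mapping.single m (Poly_Mapping.lookup P m)) m =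
      (\<Sum>m'\<in>Poly_Mapping.keys P. if m' = m then Poly_Mapping.lookup P m' else 0)"
    unfolding lookup_sum by (rule sum.cong) (auto simp: lookup_single when_def)
  also have "\<dots> = Poly_Mapping.lookup P m" by (simp add: in_keys_iff)
  finally show "Poly_Mapping.lookup P m =
      Poly_Mapping.lookup (\<Sum>m\<in>Poly_Mapping.keys P. Poly_Mapping.single m (Poly_Mapping.lookup P m)) m" by simp
qed

lemma evaluate_superset:
  assumes "finite K" "Poly_Mapping.keys P \<subseteq> K"
  shows "evaluate d S P = (\<Sum>m\<in>K. scale (Poly_Mapping.lookup P m) (monom_val d S d m))"
  unfolding evaluate_def using assms
  by (intro sum.mono_neutral_left) (auto simp: in_keys_iff fun_eq_iff)

lemma evaluate_add: "evaluate d S (P + Q) = evaluate d S P + evaluate d S Q"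
proof -
  let ?K = "Poly_Mapping.keys P \<union> Poly_Mapping.keys Q"
  have "evaluate d S (P + Q) = (\<Sum>m\<in>?K. scale (Poly_Mapping.lookup (P + Q) m) (monom_val d S d m))"
    "evaluate d S P = (\<Sum>m\<in>?K. scale (Poly_Mapping.lookup P m) (monom_val d S d m))"
    "evaluate d S Q = (\<Sum>m\<in>?K. scale (Poly_Mapping.lookup Q m) (monom_val d S d m))"
    by (intro evaluate_superset; use Poly_Mapping.keys_add[of P Q] in auto)+
  then show ?thesis by (simp add: lookup_add vs.scale_left_distrib sum.distrib)
qed

lemma evaluate_single: "evaluate d S (Poly_Mapping.single m a) = scale a (monom_val d S d m)"
  using evaluate_superset[of "{m}" "Poly_Mapping.single m a" d S] by (simp add: keys_single)

lemma evaluate_zero [simp]: "evaluate d S 0 = 0"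
  by (simp add: evaluate_def)

lemma evaluate_diff: "evaluate d S (P - Q) = evaluate d S P - evaluate d S Q"
  using evaluate_add[of d S "P - Q" Q] by simp

lemma evaluate_sum: "evaluate d S (\<Sum>i\<in>I. f i) = (\<Sum>i\<in>I. evaluate d S (f i))"
  by (rule additive.sum[of "evaluate d S"]) (simp add: additive_def evaluate_add)

locale algebra_structure =
  fixes d :: nat and S :: "'k::field algebra_data"
  assumes alg: "is_algebra d S"
begin

abbreviation mul (infixl "\<star>" 70) where "p \<star> q \<equiv> smul d (fst S) p q"

lemmas mul_unit = is_algebraD(1-3)[of d "fst S" "snd S", unfolded prod.collapse, OF alg]
lemmas mul_comm = is_algebraD(4)[of d "fst S" "snd S", unfolded prod.collapse, OF alg]
lemmas mul_assoc = is_algebraD(5)[of d "fst S" "snd S", unfolded prod.collapse, OF alg]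

lemma mul_left_comm: "p \<star> (q \<star> r) = q \<star> (p \<star> r)"
  by (metis mul_assoc mul_comm)

lemma vpow_in_vecs: "vpow d S p n \<in> vecs d"
  using mul_unit(1) by (cases n) auto

lemma monom_val_in_vecs: "monom_val d S n m \<in> vecs d"
  using mul_unit(1) by (cases n) auto

lemma evaluate_in_vecs: "evaluate d S P \<in> vecs d"
  unfolding evaluate_def by (intro vecs_sum vecs_closed monom_val_in_vecs)

lemma vpow_add: "vpow d S p (m + n) = vpow d S p m \<star> vpow d S p n"
  by (induction m) (simp_all add: mul_unit vpow_in_vecs mul_assoc)

lemma monom_val_add: "monom_val d S n (m + m') = monom_val d S n m \<star> monom_val d S n m'"
proof (induction n)
  case 0 then show ?case by (simp add: mul_unit)
next
  case (Suc n)
  have "(a \<star> b) \<star> (x \<star> y) = (a \<star> x) \<star> (b \<star> y)" for a b x y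
    by (simp only: mul_assoc mul_left_comm[of b])
  with Suc show ?case by (simp add: lookup_add vpow_add)
qed

lemma monom_val_zero: "monom_val d S n 0 = snd S"
  by (induction n) (simp_all add: mul_unit)

lemma monom_val_single:
  assumes "i < d"
  shows "monom_val d S d (Poly_Mapping.single i 1) = basis_vec i"
proof -
  have "monom_val d S n (Poly_Mapping.single i 1) = (if i < n then basis_vec i else snd S)" if "n \<le> d" for n
    using that
  proof (induction n)
    case (Suc n) then show ?case using assms
      by (cases "i = n") (auto simp: lookup_single mul_unit)
  qed simp
  then show ?thesis using assms by simp
qed

lemma evaluate_mult: "evaluate d S (P * Q) = evaluate d S P \<star> evaluate d S Q"
proof -
  have single: "evaluate d S (Poly_Mapping.single m a * Q) = evaluate d S (Poly_Mapping.single m a) \<star> evaluate d S Q" for m a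
  proof -
    have "Poly_Mapping.single m a * Q = (\<Sum>m'\<in>Poly_Mapping.keys Q. Poly_Mapping.single (m + m') (a * Poly_Mapping.lookup Q m'))"
      by (subst mpoly_expand[of Q]) (simp only: sum_distrib_left mult_single)
    then show ?thesis
      by (simp add: evaluate_sum evaluate_single monom_val_add evaluate_def[of d S Q] smul_sum_right smul_scale
          mult.commute[of a] del: vs.scale_scale flip: vs.scale_scale)
  qed
  have "P * Q = (\<Sum>m\<in>Poly_Mapping.keys P. Poly_Mapping.single m (Poly_Mapping.lookup P m) * Q)"
    by (subst mpoly_expand[of P]) (simp only: sum_distrib_right)
  then have "evaluate d S (P * Q) = (\<Sum>m\<in>Poly_Mapping.keys P. evaluate d S (Poly_Mapping.single m (Poly_Mapping.lookup P m))) \<star> evaluate d S Q"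
    by (simp add: evaluate_sum single smul_sum_left)
  then show ?thesis by (simp add: evaluate_single evaluate_def[of d S P])
qed

lemma evaluate_one: "evaluate d S 1 = snd S"
  using evaluate_single[of d S 0 1] by (simp add: monom_val_zero single_one)

definition lin :: "(nat \<Rightarrow> 'k) \<Rightarrow> 'k mpoly" where
  "lin p = basis_comb d (\<lambda>i. Poly_Mapping.single i 1) p"

lemma var_monoms: "(\<lambda>i. Poly_Mapping.single i (1::nat)) ` {..<d} \<subseteq> monoms d"
  by (auto simp: monoms_def keys_single)

lemma lin_carrier: "Poly_Mapping.keys (lin p) \<subseteq> monoms d"
  using basis_comb_keys[of d "\<lambda>i. Poly_Mapping.single i 1" p] var_monoms unfolding lin_def by blast

lemma evaluate_basis_comb: "evaluate d S (basis_comb d b p) = (\<Sum>i<d. scale (p i) (monom_val d S d (b i)))"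
  by (simp add: basis_comb_def evaluate_sum evaluate_single)

lemma evaluate_lin: "p \<in> vecs d \<Longrightarrow> evaluate d S (lin p) = p"
  by (simp add: lin_def evaluate_basis_comb monom_val_single[simplified] vecs_expand)

lemma eval_kernel_ideal: "ideal (eval_kernel d S) (poly_alg d)"
proof -
  interpret cring "poly_alg d :: ('k, 'k mpoly) module" by (rule poly_alg_cring)
  have mult: "x * a \<in> eval_kernel d S" if "a \<in> eval_kernel d S" "x \<in> carrier (poly_alg d)" for a x
    using that keys_monoms_closed(1)[of x d a] by (simp add: eval_kernel_def evaluate_mult)
  show ?thesis
  proof (rule idealI)
    show "subgroup (eval_kernel d S) (add_monoid (poly_alg d))"
    proof (rule subgroup.intro)
      fix x y assume xy: "x \<in> eval_kernel d S" 
      then have "inv\<^bsub>add_monoid (poly_alg d)\<^esub> x = - x"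
        using poly_alg_a_inv[of x d] by (simp add: a_inv_def eval_kernel_def)
      then show "inv\<^bsub>add_monoid (poly_alg d)\<^esub> x \<in> eval_kernel d S"
        using xy keys_monoms_closed(4)[of x "monoms d"] evaluate_diff[of d S 0 x] by (simp add: eval_kernel_def)
      assume "y \<in> eval_kernel d S"
      then show "x \<otimes>\<^bsub>add_monoid (poly_alg d)\<^esub> y \<in> eval_kernel d S"
        using xy keys_monoms_closed(2)[of x "monoms d" y] by (simp add: eval_kernel_def evaluate_add)
    qed (auto simp: eval_kernel_def)
  qed (use mult in \<open>auto simp: mult.commute ring_axioms\<close>)
qed

end

section \<open>Solving linear systems polynomially\<close>

text \<open>
  By the Leibniz formula.
\<close>

lemma gen_alg_det:
  assumes "\<And>i j. i < n \<Longrightarrow> j < n \<Longrightarrow> (\<lambda>x. E x i j) \<in> gen_alg G"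
  shows "(\<lambda>x. det (mat n n (\<lambda>(i, j). E x i j))) \<in> gen_alg G"
proof -
  have "(\<lambda>x. det (mat n n (\<lambda>(i, j). E x i j))) =
     (\<lambda>x. \<Sum>p\<in>{p. p permutes {0..<n}}. signof p * (\<Prod>i = 0..<n. E x i (p i)))"
    by (rule ext) (auto simp: det_def intro!: sum.cong prod.cong dest: permutes_in_image)
  also have "\<dots> \<in> gen_alg G"
    by (intro gen_alg_intros assms) (auto simp: permutes_in_image)
  finally show ?thesis .
qed

lemma gen_alg_adj:
  assumes "\<And>i j. i < n \<Longrightarrow> j < n \<Longrightarrow> (\<lambda>x. E x i j) \<in> gen_alg G" and "k < n" "l < n"
  shows "(\<lambda>x. adj_mat (mat n n (\<lambda>(i, j). E x i j)) $$ (k, l)) \<in> gen_alg G"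
proof -
  have "mat_delete (mat n n (\<lambda>(i, j). E x i j)) l k =
      mat (n - 1) (n - 1) (\<lambda>(i, j). E x (if i < l then i else Suc i) (if j < k then j else Suc j))" for x
    unfolding mat_delete_def using assms(2,3) by (intro eq_matI) auto
  then have "(\<lambda>x. adj_mat (mat n n (\<lambda>(i, j). E x i j)) $$ (k, l)) =
    (\<lambda>x. (-1) ^ (l + k) * det (mat (n - 1) (n - 1) (\<lambda>(i, j). E x (if i < l then i else Suc i) (if j < k then j else Suc j))))"
    using assms(2,3) by (simp add: adj_mat_def cofactor_def)
  also have "\<dots> \<in> gen_alg G"
    by (intro gen_alg.mult gen_alg.const gen_alg_det assms) auto
  finally show ?thesis .
qed

text \<open>
  The solution is written with the adjugate matrix, so that up to a power of the determinant it
  depends polynomially on the entries of \<open>M\<close>.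
\<close>

lemma cramer:
  fixes M :: "'k::field mat"
  assumes M: "M \<in> carrier_mat d d" and nz: "det M \<noteq> 0"
  shows "i < d \<Longrightarrow> (\<Sum>j<d. M $$ (i, j) * ((\<Sum>k<d. adj_mat M $$ (j, k) * v k) / det M)) = v i"
    and "(\<And>i. i < d \<Longrightarrow> (\<Sum>j<d. M $$ (i, j) * a j) = v i) \<Longrightarrow> l < d \<Longrightarrow>
       a l = (\<Sum>k<d. adj_mat M $$ (l, k) * v k) / det M"
proof -
  have entry: "(A * B) $$ (i, j) = (\<Sum>k<d. A $$ (i, k) * B $$ (k, j))"
    if "A \<in> carrier_mat d d" "B \<in> carrier_mat d d" "i < d" "j < d" for A B :: "'k mat" and i j
    using that by (auto simp: scalar_prod_def atLeast0LessThan)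
  note adj = adj_mat[OF M]
  have e1: "(\<Sum>k<d. M $$ (i, k) * adj_mat M $$ (k, j)) = (if i = j then det M else 0)" if "i < d" "j < d" for i j
    by (subst entry[OF M adj(1) that, symmetric]) (simp add: adj(2) that)
  have e2: "(\<Sum>k<d. adj_mat M $$ (i, k) * M $$ (k, j)) = (if i = j then det M else 0)" if "i < d" "j < d" for i j
    by (subst entry[OF adj(1) M that, symmetric]) (simp add: adj(3) that)
  show "(\<Sum>j<d. M $$ (i, j) * ((\<Sum>k<d. adj_mat M $$ (j, k) * v k) / det M)) = v i" if "i < d"
  proof -
    have "(\<Sum>j<d. M $$ (i, j) * ((\<Sum>k<d. adj_mat M $$ (j, k) * v k) / det M)) =
       (\<Sum>k<d. (\<Sum>j<d. M $$ (i, j) * adj_mat M $$ (j, k)) * v k / det M)"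
      unfolding sum_distrib_left sum_divide_distrib sum_distrib_right times_divide_eq_right
      by (subst sum.swap) (simp add: mult.assoc)
    also have "\<dots> = (\<Sum>k<d. if i = k then v k else 0)"
      by (rule sum.cong) (use e1[OF that] nz in auto)
    finally show ?thesis using that by simp
  qed
  show "a l = (\<Sum>k<d. adj_mat M $$ (l, k) * v k) / det M"
    if v: "\<And>i. i < d \<Longrightarrow> (\<Sum>j<d. M $$ (i, j) * a j) = v i" and "l < d"
  proof -
    have "(\<Sum>k<d. adj_mat M $$ (l, k) * v k) = (\<Sum>k<d. adj_mat M $$ (l, k) * (\<Sum>j<d. M $$ (k, j) * a j))"
      by (simp add: v)
    also have "\<dots> = (\<Sum>j<d. (\<Sum>k<d. adj_mat M $$ (l, k) * M $$ (k, j)) * a j)"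
      unfolding sum_distrib_left sum_distrib_right by (subst sum.swap) (simp add: mult.assoc)
    also have "\<dots> = (\<Sum>j<d. if l = j then det M * a j else 0)"
      by (rule sum.cong) (use e2[OF that(2)] in auto)
    finally show ?thesis using that(2) nz by simp
  qed
qed

section \<open>The map from structure constants to the Hilbert scheme\<close>

definition monom_matrix :: "nat \<Rightarrow> (nat \<Rightarrow> monom) \<Rightarrow> 'k::field algebra_data \<Rightarrow> 'k mat" where
  "monom_matrix d b S = mat d d (\<lambda>(i, j). monom_val d S d (b j) i)"

lemma monom_matrix_carrier [simp]: "monom_matrix d b S \<in> carrier_mat d d"
  by (simp add: monom_matrix_def)

context algebra_structure
begin

lemma evaluate_basis_comb_eq_iff:
  assumes "v \<in> vecs d"
  shows "evaluate d S (basis_comb d b a) = v \<longleftrightarrow> (\<forall>i<d. (\<Sum>j<d. monom_matrix d b S $$ (i, j) * a j) = v i)"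
proof -
  have "evaluate d S (basis_comb d b a) i = (\<Sum>j<d. monom_matrix d b S $$ (i, j) * a j)" if "i < d" for i
    using that by (simp add: evaluate_basis_comb sum_fun_apply monom_matrix_def mult.commute)
  then show ?thesis
    using vecsD[OF assms] vecsD[OF evaluate_in_vecs] by (auto simp: fun_eq_iff not_less) (metis not_less)
qed

text \<open>
  If the values of the monomials \<open>b j\<close> form a basis, normal forms modulo the kernel
  are found by solving a linear system.
\<close>

lemma eval_kernel_chart:
  assumes b: "inj_on b {..<d}" "b ` {..<d} \<subseteq> monoms d" and nz: "det (monom_matrix d b S) \<noteq> 0"
  shows "eval_kernel d S \<in> hilb_chart d (b ` {..<d})"
    and "Poly_Mapping.keys P \<subseteq> monoms d \<Longrightarrow> l < d \<Longrightarrow>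
      Poly_Mapping.lookup (normal_form (b ` {..<d}) (eval_kernel d S) P) (b l) =
        (\<Sum>k<d. adj_mat (monom_matrix d b S) $$ (l, k) * evaluate d S P k) / det (monom_matrix d b S)"
proof -
  let ?M = "monom_matrix d b S" and ?B = "b ` {..<d}"
  let ?a = "\<lambda>P l. if l < d then (\<Sum>k<d. adj_mat ?M $$ (l, k) * evaluate d S P k) / det ?M else 0"
  have carr: "Poly_Mapping.keys q \<subseteq> monoms d" if "Poly_Mapping.keys q \<subseteq> ?B" for q :: "'k mpoly" using that b by blast
  have ex: "evaluate d S (basis_comb d b (?a P)) = evaluate d S P" for P
    unfolding evaluate_basis_comb_eq_iff[OF evaluate_in_vecs]
    using cramer(1)[OF monom_matrix_carrier nz] by simp
  have uniq: "q = basis_comb d b (?a P)" if q: "Poly_Mapping.keys q \<subseteq> ?B" "evaluate d S q = evaluate d S P" for q P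
  proof -
    define a where "a = (\<lambda>l. if l < d then Poly_Mapping.lookup q (b l) else 0)"
    have qa: "q = basis_comb d b a" unfolding a_def by (rule basis_comb_lookup[OF b(1) q(1), symmetric])
    have "(\<Sum>j<d. ?M $$ (i, j) * a j) = evaluate d S P i" if "i < d" for i
      using q(2) that unfolding qa evaluate_basis_comb_eq_iff[OF evaluate_in_vecs] by blast
    from cramer(2)[OF monom_matrix_carrier nz this] have "a l = ?a P l" for l
      by (simp add: a_def)
    then show ?thesis unfolding qa by metis
  qed
  have ker: "P - q \<in> eval_kernel d S \<longleftrightarrow> evaluate d S q = evaluate d S P"
    if "Poly_Mapping.keys P \<subseteq> monoms d" "Poly_Mapping.keys q \<subseteq> ?B" for P q
    using keys_monoms_closed(3)[OF that(1) carr[OF that(2)]] by (auto simp: eval_kernel_def evaluate_diff)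
  show chart: "eval_kernel d S \<in> hilb_chart d ?B"
    unfolding hilb_chart_def
  proof (intro CollectI conjI ballI eval_kernel_ideal)
    fix P :: "'k mpoly" assume "P \<in> carrier (poly_alg d)"
    then have P: "Poly_Mapping.keys P \<subseteq> monoms d" by simp
    show "\<exists>!q. Poly_Mapping.keys q \<subseteq> ?B \<and> P - q \<in> eval_kernel d S"
      by (rule ex1I[of _ "basis_comb d b (?a P)"])
        (use ker[OF P] ex uniq basis_comb_keys in blast)+
  qed
  show "Poly_Mapping.lookup (normal_form ?B (eval_kernel d S) P) (b l) =
        (\<Sum>k<d. adj_mat ?M $$ (l, k) * evaluate d S P k) / det ?M"
    if "Poly_Mapping.keys P \<subseteq> monoms d" "l < d"
  proof -
    have "normal_form ?B (eval_kernel d S) P = basis_comb d b (?a P)"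
      by (rule hilb_chart_normal_form(3)[OF chart that(1) basis_comb_keys]) (use ker[OF that(1) basis_comb_keys] ex in blast)
    then show ?thesis using lookup_basis_comb[OF b(1) that(2), of "?a P"] that(2) by simp
  qed
qed

text \<open>
  A linear relation between the values of the monomials would be a nonzero element of the kernel
  supported on \<open>b\<close>, so that 0 would have two normal forms.
\<close>

lemma det_nonzero_if_chart:
  assumes b: "inj_on b {..<d}" "b ` {..<d} \<subseteq> monoms d" and chart: "eval_kernel d S \<in> hilb_chart d (b ` {..<d})"
  shows "det (monom_matrix d b S) \<noteq> 0"
proof
  assume "det (monom_matrix d b S) = 0"
  then obtain v where v: "v \<in> carrier_vec d" "v \<noteq> 0\<^sub>v d" "monom_matrix d b S *\<^sub>v v = 0\<^sub>v d"
    using det_0_iff_vec_prod_zero_field[OF monom_matrix_carrier] by blast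
  define a where "a l = (if l < d then v $ l else 0)" for l
  have "(\<Sum>j<d. monom_matrix d b S $$ (i, j) * a j) = 0" if i: "i < d" for i
  proof -
    have "(monom_matrix d b S *\<^sub>v v) $ i = (\<Sum>j<d. monom_matrix d b S $$ (i, j) * v $ j)"
      using i v(1) by (auto simp: scalar_prod_def atLeast0LessThan monom_matrix_def)
    then show ?thesis using v(3) i by (simp add: a_def)
  qed
  then have "evaluate d S (basis_comb d b a) = 0" by (subst evaluate_basis_comb_eq_iff) auto
  then have "0 - basis_comb d b a \<in> eval_kernel d S" "0 - (0::'k mpoly) \<in> eval_kernel d S"
    using basis_comb_keys[of d b a] b(2) keys_monoms_closed(4)[of "basis_comb d b a" "monoms d"] evaluate_diff[of d S 0 "basis_comb d b a"]
    by (auto simp: eval_kernel_def)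
  then have "basis_comb d b a = 0"
    using hilb_chart_normal_form(3)[OF chart, of 0] basis_comb_keys[of d b a] by (metis empty_subsetI keys_zero)
  then have "a l = 0" if "l < d" for l using lookup_basis_comb[OF b(1) that, of a] by simp
  then have "v = 0\<^sub>v d" using v(1) by (intro eq_vecI) (auto simp: a_def)
  then show False using v by simp
qed

end

text \<open>
  A regular function of a chart becomes a rational function of the structure constants whose
  denominator is a power of the determinant.
\<close>

lemma regular_on_kernels:
  fixes f :: "'k::field mpoly set \<Rightarrow> 'k"
  assumes b: "inj_on b {..<d}" "b ` {..<d} \<subseteq> monoms d" and f: "f \<in> regular_functions d (b ` {..<d})"
  shows "\<exists>k. \<exists>g\<in>gen_alg coords. \<forall>S. is_algebra d S \<and> det (monom_matrix d b S) \<noteq> 0 \<longrightarrow>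
     g S = f (eval_kernel d S) * det (monom_matrix d b S) ^ k"
  using f
proof induction
  case (const c)
  show ?case by (rule exI[of _ 0], rule bexI[of _ "\<lambda>_. c"]) (auto intro: gen_alg.const)
next
  case (coord m b')
  then obtain l where l: "b' = b l" "l < d" by auto
  let ?g = "\<lambda>S. \<Sum>k<d. adj_mat (monom_matrix d b S) $$ (l, k) * monom_val d S d m k"
  have m: "Poly_Mapping.keys (Poly_Mapping.single m (1::'k)) \<subseteq> monoms d"
    using coord by (intro keys_monoms_closed)
  have "?g \<in> gen_alg coords"
    unfolding monom_matrix_def by (intro gen_alg_intros gen_alg_adj gen_alg_monom_val) (use l in auto)
  moreover have "?g S = Poly_Mapping.lookup (normal_form (b ` {..<d}) (eval_kernel d S) (Poly_Mapping.single m 1)) b'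
      * det (monom_matrix d b S) ^ 1" if "is_algebra d S" "det (monom_matrix d b S) \<noteq> 0" for S :: "'k algebra_data"
  proof -
    interpret algebra_structure d S by unfold_locales (rule that)
    show ?thesis using eval_kernel_chart(2)[OF b that(2) m l(2)] that(2)
      by (simp add: evaluate_single l)
  qed
  ultimately show ?case by (intro exI[of _ 1] bexI[of _ ?g] allI impI) (elim conjE)
next
  case (add f1 f2)
  obtain k1 g1 where 1: "g1 \<in> gen_alg coords" "\<And>S. is_algebra d S \<and> det (monom_matrix d b S) \<noteq> 0 \<Longrightarrow>
     g1 S = f1 (eval_kernel d S) * det (monom_matrix d b S) ^ k1" using add.IH(1) by blast
  obtain k2 g2 where 2: "g2 \<in> gen_alg coords" "\<And>S. is_algebra d S \<and> det (monom_matrix d b S) \<noteq> 0 \<Longrightarrow>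
     g2 S = f2 (eval_kernel d S) * det (monom_matrix d b S) ^ k2" using add.IH(2) by blast
  let ?g = "\<lambda>S. g1 S * det (monom_matrix d b S) ^ k2 + g2 S * det (monom_matrix d b S) ^ k1"
  have "?g \<in> gen_alg coords"
    unfolding monom_matrix_def by (intro gen_alg_intros gen_alg_det gen_alg_monom_val 1 2)
  then show ?case
    by (intro exI[of _ "k1 + k2"] bexI[of _ ?g]) (simp_all add: 1 2 power_add algebra_simps)
next
  case (mult f1 f2)
  obtain k1 g1 where 1: "g1 \<in> gen_alg coords" "\<And>S. is_algebra d S \<and> det (monom_matrix d b S) \<noteq> 0 \<Longrightarrow>
     g1 S = f1 (eval_kernel d S) * det (monom_matrix d b S) ^ k1" using mult.IH(1) by blast
  obtain k2 g2 where 2: "g2 \<in> gen_alg coords" "\<And>S. is_algebra d S \<and> det (monom_matrix d b S) \<noteq> 0 \<Longrightarrow>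
     g2 S = f2 (eval_kernel d S) * det (monom_matrix d b S) ^ k2" using mult.IH(2) by blast
  have "(\<lambda>S. g1 S * g2 S) \<in> gen_alg coords" by (intro gen_alg_intros 1 2)
  then show ?case
    by (intro exI[of _ "k1 + k2"] bexI[of _ "\<lambda>S. g1 S * g2 S"]) (simp_all add: 1 2 power_add)
qed

text \<open>
  Continuity of the map to the Hilbert scheme: the preimage of an open set contains a principal
  open set around each of its points. On a subbasic set the witness is the numerator of the
  regular function times the determinant that describes the chart.
\<close>

lemma hilb_open_on_kernels:
  fixes S :: "'k::field algebra_data"
  assumes "openin (hilb d d) T" "eval_kernel d S \<in> T" "is_algebra d S"
  shows "\<exists>g\<in>gen_alg coords. g S \<noteq> 0 \<and> (\<forall>S'. is_algebra d S' \<and> g S' \<noteq> 0 \<longrightarrow> eval_kernel d S' \<in> T)"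
proof -
  have "generate_topology_on {{I \<in> hilb_chart d B. f I \<noteq> 0} | B (f :: 'k mpoly set \<Rightarrow> 'k).
        B \<subseteq> monoms d \<and> finite B \<and> card B = d \<and> f \<in> regular_functions d B} T"
    using assms(1) unfolding hilb_def openin_topology_generated_by_iff .
  then show ?thesis using assms(2)
  proof induction
    case Empty then show ?case by simp
  next
    case (Int T1 T2)
    then obtain g1 g2 where "g1 \<in> gen_alg coords" "g2 \<in> gen_alg coords" "g1 S \<noteq> 0" "g2 S \<noteq> 0"
      "\<forall>S'. is_algebra d S' \<and> g1 S' \<noteq> 0 \<longrightarrow> eval_kernel d S' \<in> T1"
      "\<forall>S'. is_algebra d S' \<and> g2 S' \<noteq> 0 \<longrightarrow> eval_kernel d S' \<in> T2" by blast
    then show ?case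
      by (intro bexI[of _ "\<lambda>S. g1 S * g2 S"]) (auto intro: gen_alg.mult)
  next
    case (UN K)
    then obtain k where "k \<in> K" "eval_kernel d S \<in> k" by blast
    with UN.IH show ?case by blast
  next
    case (Basis T)
    then obtain B f where B: "B \<subseteq> monoms d" "finite B" "card B = d" "f \<in> regular_functions d B"
      and T: "T = {I \<in> hilb_chart d B. f I \<noteq> 0}" by blast
    obtain b where "bij_betw b {..<d} B"
      using ex_bij_betw_nat_finite[OF B(2)] B(3) by (auto simp: atLeast0LessThan)
    then have b: "B = b ` {..<d}" "inj_on b {..<d}" by (auto simp: bij_betw_def)
    note b' = b(2) B(1)[unfolded b(1)]
    obtain k g where g: "g \<in> gen_alg coords" "\<And>S. is_algebra d S \<and> det (monom_matrix d b S) \<noteq> 0 \<Longrightarrow>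
       g S = f (eval_kernel d S) * det (monom_matrix d b S) ^ k"
      using regular_on_kernels[OF b' B(4)[unfolded b(1)]] by blast
    let ?h = "\<lambda>S. g S * det (monom_matrix d b S)"
    interpret algebra_structure d S by unfold_locales (rule assms)
    have "?h \<in> gen_alg coords"
      unfolding monom_matrix_def by (intro gen_alg_intros gen_alg_det gen_alg_monom_val g)
    moreover have "det (monom_matrix d b S) \<noteq> 0"
      using det_nonzero_if_chart[OF b'] Basis T b(1) by blast
    then have "?h S \<noteq> 0" using Basis(2) T g(2) assms(3) by simp
    moreover have "eval_kernel d S' \<in> T" if "is_algebra d S'" "?h S' \<noteq> 0" for S'
    proof -
      interpret S': algebra_structure d S' by unfold_locales (rule that)
      show ?thesis using S'.eval_kernel_chart(1)[OF b'] that g(2)[of S'] by (auto simp: T b(1))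
    qed
    ultimately show ?case by (intro bexI[of _ ?h] conjI allI impI) (elim conjE | assumption)+
  qed
qed

text \<open>
  The variables themselves are mapped to a basis, so they provide a chart.
\<close>

lemma eval_kernel_in_topspace:
  fixes S :: "'k::field algebra_data"
  assumes "is_algebra d S"
  shows "eval_kernel d S \<in> topspace (hilb d d)"
proof -
  interpret algebra_structure d S by unfold_locales (rule assms)
  let ?b = "\<lambda>i. Poly_Mapping.single i (1::nat)"
  have inj: "inj_on ?b {..<d}" by (auto simp: inj_on_def dest: arg_cong[of _ _ Poly_Mapping.keys])
  have "monom_matrix d ?b S = 1\<^sub>m d"
    by (rule eq_matI) (auto simp: monom_matrix_def monom_val_single[simplified] basis_vec_def)
  then have "det (monom_matrix d ?b S) \<noteq> 0" by simp
  then have chart: "eval_kernel d S \<in> hilb_chart d (?b ` {..<d})"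
    by (rule eval_kernel_chart[OF inj var_monoms])
  have card: "card (?b ` {..<d}) = d" using card_image[OF inj] by simp
  show ?thesis
    unfolding hilb_def topology_generated_by_topspace
    by (rule UnionI[of "{I \<in> hilb_chart d (?b ` {..<d}). (\<lambda>I. 1::'k) I \<noteq> 0}"], rule CollectI,
        rule exI[of _ "?b ` {..<d}"], rule exI[of _ "\<lambda>I. 1::'k"])
      (use chart card var_monoms in \<open>auto intro: regular_functions.const\<close>)
qed

text \<open>
  Vanishing of \<open>p\<^sup>k\<close> is reduced to vanishing of \<open>p\<^sup>j\<close> with
  \<open>j = \<lceil>k / 2\<rceil>\<close>, since \<open>p\<^sup>k\<close> divides the square of
  \<open>p\<^sup>j\<close>.
\<close>

lemma eval_kernel_reduced:
  fixes S :: "'k::field algebra_data"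
  assumes "is_algebra d S" "is_reduced d S"
  shows "eval_kernel d S \<in> reduced_points d d"
proof -
  interpret algebra_structure d S by unfold_locales (rule assms)
  have sq: "evaluate d S p = 0" if "evaluate d S (p * p) = 0" for p
    using assms(2) evaluate_in_vecs[of p] that unfolding is_reduced_def evaluate_mult by blast
  have pow: "evaluate d S p = 0" if "evaluate d S (p ^ k) = 0" "k > 0" for p and k :: nat
    using that
  proof (induction k rule: less_induct)
    case (less k)
    show ?case
    proof (cases "k = 1")
      case False
      then have k2: "k \<ge> 2" using less by simp
      let ?j = "(k + 1) div 2"
      have eq: "p ^ ?j * p ^ ?j = p ^ k * p ^ (2 * ?j - k)"
        by (simp add: mult_2 flip: power_add)
      have "evaluate d S (p ^ ?j) = 0"
        by (rule sq, unfold eq, unfold evaluate_mult less.prems(1)) (rule smul_zero)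
      then show ?thesis using k2 by (intro less.IH[of ?j]) auto
    qed (use less in simp)
  qed
  have "p \<in> eval_kernel d S" if p: "p \<in> carrier (poly_alg d)" "p ^ k \<in> eval_kernel d S" for p and k :: nat
  proof (cases "k = 0")
    case False
    then show ?thesis using pow[of p k] p by (simp add: eval_kernel_def)
  next
    case True
    \<comment> \<open>Here 1 lies in the kernel, so the algebra is zero.\<close>
    then have "snd S = 0" using p by (simp add: eval_kernel_def evaluate_one)
    then have "evaluate d S p = 0" using mul_unit(2)[OF evaluate_in_vecs, of p] by simp
    then show ?thesis using p by (simp add: eval_kernel_def)
  qed
  then show ?thesis
    unfolding reduced_points_def using eval_kernel_in_topspace[OF assms(1)] by blast
qed

theorem limit_of_reduced_imp_smoothable:
  fixes A :: "('k::field, 'a) module"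
  assumes alg: "k_algebra A" and dim: "has_kdim A (carrier A) d"
    and S: "is_algebra d S" "presents d S A \<iota>" "limit_of_reduced d S"
  shows "smoothable A"
  unfolding smoothable_def
proof (intro exI conjI)
  interpret algebra_structure d S by unfold_locales (rule S)
  interpret A: algebra ring_of_type_algebra A by fact
  let ?\<phi> = "\<lambda>P. \<iota> (evaluate d S P)"
  show "has_kdim A (carrier A) d" by fact
  note pr = S(2)[unfolded presents_def]
  have add: "\<iota> (p + q) = \<iota> p \<oplus>\<^bsub>A\<^esub> \<iota> q" if "p \<in> vecs d" "q \<in> vecs d" for p q using pr that by blast
  have scl: "\<iota> (scale k p) = k \<odot>\<^bsub>A\<^esub> \<iota> p" if "p \<in> vecs d" for p k using pr that by blast
  have mul: "\<iota> (p \<star> q) = \<iota> p \<otimes>\<^bsub>A\<^esub> \<iota> q" if "p \<in> vecs d" "q \<in> vecs d" for p q using pr that by blast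
  have one: "\<iota> (snd S) = \<one>\<^bsub>A\<^esub>" using pr by blast
  have bij: "bij_betw \<iota> (vecs d) (carrier A)" using pr by blast
  have car: "\<iota> p \<in> carrier A" if "p \<in> vecs d" for p using bij that by (auto simp: bij_betw_def)
  have zero: "\<iota> 0 = \<zero>\<^bsub>A\<^esub>" using add[of 0 0] car[of 0] by (metis A.M.add.r_cancel_one' add_0 vecs_closed(1))
  have sc: "evaluate d S (Poly_Mapping.single 0 c * P) = scale c (evaluate d S P)" for c P
    by (simp add: evaluate_mult evaluate_single monom_val_zero smul_scale mul_unit evaluate_in_vecs)
  show "?\<phi> \<in> alg_hom (poly_alg d) A"
    unfolding alg_hom_def
  proof (intro CollectI conjI allI ballI)
    show "?\<phi> \<in> Ring.ring_hom (poly_alg d) A"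
      unfolding Ring.ring_hom_def
      by (simp add: evaluate_add evaluate_mult evaluate_one add mul one car evaluate_in_vecs)
  qed (simp add: sc scl evaluate_in_vecs)
  show "?\<phi> ` carrier (poly_alg d) = carrier A"
  proof -
    have "\<iota> p \<in> ?\<phi> ` carrier (poly_alg d)" if "p \<in> vecs d" for p
      using lin_carrier[of p] evaluate_lin[OF that] by (intro image_eqI[of _ _ "lin p"]) auto
    moreover have "carrier A = \<iota> ` vecs d" using bij by (simp add: bij_betw_def)
    ultimately show ?thesis using car evaluate_in_vecs by auto
  qed
  have "a_kernel (poly_alg d) A ?\<phi> = eval_kernel d S"
  proof -
    have "\<iota> (evaluate d S P) = \<zero>\<^bsub>A\<^esub> \<longleftrightarrow> evaluate d S P = 0" for P
      using bij zero evaluate_in_vecs[of P] by (metis bij_betw_inv_into_left vecs_closed(1))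
    then show ?thesis by (simp add: a_kernel_def' eval_kernel_def)
  qed
  moreover have "eval_kernel d S \<in> hilb d d closure_of reduced_points d d"
    unfolding in_closure_of
  proof (intro conjI allI impI eval_kernel_in_topspace S)
    fix T assume "eval_kernel d S \<in> T \<and> openin (hilb d d) T"
    then obtain g where "g \<in> gen_alg coords" "g S \<noteq> 0" 
      and T: "\<And>S'. is_algebra d S' \<and> g S' \<noteq> 0 \<Longrightarrow> eval_kernel d S' \<in> T"
      using hilb_open_on_kernels[of d T S] S(1) by blast
    then obtain S' where "is_algebra d S'" "is_reduced d S'" "g S' \<noteq> 0"
      using S(3) unfolding limit_of_reduced_def by blast
    then show "\<exists>I. I \<in> reduced_points d d \<and> I \<in> T" using T eval_kernel_reduced by blast
  qed
  ultimately show "a_kernel (poly_alg d) A ?\<phi> \<in> hilb d d closure_of reduced_points d d" by simp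
qed

section \<open>Linear functionals\<close>

definition is_functional :: "((nat \<Rightarrow> 'k::field) \<Rightarrow> 'k) \<Rightarrow> bool" where
  "is_functional f \<longleftrightarrow> (\<forall>p q. f (p + q) = f p + f q) \<and> (\<forall>k p. f (scale k p) = k * f p)"

lemma is_functionalD:
  assumes "is_functional f"
  shows "f (p + q) = f p + f q" "f (scale k p) = k * f p" "f 0 = 0" "f (p - q) = f p - f q" "f (- p) = - f p"
    "f (\<Sum>i\<in>I. g i) = (\<Sum>i\<in>I. f (g i))"
proof -
  show add: "f (p + q) = f p + f q" for p q using assms by (simp add: is_functional_def)
  show "f (scale k p) = k * f p" using assms by (simp add: is_functional_def)
  interpret additive f by (rule additive.intro) (rule add)
  show "f 0 = 0" "f (p - q) = f p - f q" "f (- p) = - f p" "f (\<Sum>i\<in>I. g i) = (\<Sum>i\<in>I. f (g i))"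
    by (rule zero diff minus sum)+
qed

lemma functional_on_independent:
  fixes g :: "(nat \<Rightarrow> 'k::field) \<Rightarrow> 'k"
  assumes "vs.independent B"
  obtains f where "is_functional f" "\<And>b. b \<in> B \<Longrightarrow> f b = g b"
proof -
  interpret vector_space_pair "scale :: 'k \<Rightarrow> (nat \<Rightarrow> 'k) \<Rightarrow> _" "(*) :: 'k \<Rightarrow> 'k \<Rightarrow> 'k"
    by unfold_locales (auto simp: algebra_simps)
  obtain f where f: "Vector_Spaces.linear scale (*) f" "\<forall>b\<in>B. f b = g b"
    using linear_independent_extend[OF assms] by blast
  interpret f: Vector_Spaces.linear scale "(*)" f by (rule f)
  show thesis using that[of f] f(2) f.add f.scale by (auto simp: is_functional_def)
qed

lemma functional_separation:
  fixes x :: "nat \<Rightarrow> 'k::field"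
  assumes "vs.subspace U" "x \<notin> U"
  obtains f where "is_functional f" "f x = 1" "\<And>y. y \<in> U \<Longrightarrow> f y = 0"
proof -
  obtain B where B: "B \<subseteq> U" "vs.independent B" "U \<subseteq> vs.span B" using vs.maximal_independent_subset by blast
  have "vs.span B = U" using B assms(1) vs.span_minimal by blast
  then have "vs.independent (insert x B)" using B(2) assms(2) by (intro vs.independent_insertI) auto
  then obtain f where f: "is_functional f" "\<And>b. b \<in> insert x B \<Longrightarrow> f b = (if b = x then 1 else 0)"
    using functional_on_independent[of "insert x B" "\<lambda>b. if b = x then 1 else 0"] by blast
  have fB: "f b = 0" if "b \<in> B" for b using f(2)[of b] that B(1) assms(2) by auto
  have "f y = 0" if "y \<in> vs.span B" for y
    using that fB by (induction rule: vs.span_induct_alt) (auto simp: is_functionalD[OF f(1)])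
  then show thesis using that[OF f(1)] f(2)[of x] B(3) by auto
qed

text \<open>
  A local Gorenstein algebra with \<open>m\<^sup>4 = 0 \<noteq> m\<^sup>3\<close> in
  coordinates. The sets \<open>M1\<close>, \<open>M2\<close>, \<open>M3\<close> stand for the
  powers of the maximal ideal; they enter through the inclusions between their products.
\<close>

locale short_gorenstein = algebra_structure d S for d and S :: "'k::field_char_0 algebra_data" +
  fixes M1 M2 M3 :: "(nat \<Rightarrow> 'k) set" and \<sigma> :: "nat \<Rightarrow> 'k"
  assumes sub1: "vs.subspace M1" and sub2: "vs.subspace M2"
    and M1_vecs: "M1 \<subseteq> vecs d" and M2_M1: "M2 \<subseteq> M1" and M3_M2: "M3 \<subseteq> M2"
    and ideal2: "x \<in> vecs d \<Longrightarrow> y \<in> M2 \<Longrightarrow> x \<star> y \<in> M2"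
    and mult11: "x \<in> M1 \<Longrightarrow> y \<in> M1 \<Longrightarrow> x \<star> y \<in> M2"
    and mult12: "x \<in> M1 \<Longrightarrow> y \<in> M2 \<Longrightarrow> x \<star> y \<in> M3"
    and mult13: "x \<in> M1 \<Longrightarrow> y \<in> M3 \<Longrightarrow> x \<star> y = 0"
    and mult22: "x \<in> M2 \<Longrightarrow> y \<in> M2 \<Longrightarrow> x \<star> y = 0"
    and residue: "x \<in> vecs d \<Longrightarrow> \<exists>k. x - scale k (snd S) \<in> M1"
    and one_notin: "snd S \<notin> M1"
    and sigma: "\<sigma> \<in> M3" "\<sigma> \<noteq> 0"
    and socle: "x \<in> vecs d \<Longrightarrow> (\<And>y. y \<in> M1 \<Longrightarrow> x \<star> y = 0) \<Longrightarrow> \<exists>k. x = scale k \<sigma>"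
begin

lemmas M1_closed = vs.subspace_add[OF sub1] vs.subspace_diff[OF sub1] vs.subspace_scale[OF sub1]
  vs.subspace_0[OF sub1] vs.subspace_neg[OF sub1]
lemmas M2_closed = vs.subspace_add[OF sub2] vs.subspace_diff[OF sub2] vs.subspace_scale[OF sub2]
  vs.subspace_0[OF sub2] vs.subspace_neg[OF sub2]

lemma sigma_in: "\<sigma> \<in> M2" "\<sigma> \<in> M1" "\<sigma> \<in> vecs d"
  using sigma M3_M2 M2_M1 M1_vecs by auto

lemma mul_sigma: "x \<in> M1 \<Longrightarrow> x \<star> \<sigma> = 0" "x \<in> M1 \<Longrightarrow> \<sigma> \<star> x = 0"
  using mult13 sigma by (auto simp: mul_comm[of \<sigma>])

lemma in_vecs: "x \<in> M1 \<Longrightarrow> x \<in> vecs d" "x \<in> M2 \<Longrightarrow> x \<in> vecs d"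
  using M1_vecs M2_M1 by auto

lemma M3_sigma: "x \<in> M3 \<Longrightarrow> \<exists>k. x = scale k \<sigma>"
  using M3_M2 M2_M1 M1_vecs mult13 by (intro socle) (auto simp: mul_comm)

text \<open>
  Projection to the residue field.
\<close>

definition eps :: "(nat \<Rightarrow> 'k) \<Rightarrow> 'k" where
  "eps x = (SOME k. x - scale k (snd S) \<in> M1)"

lemma eps: "x \<in> vecs d \<Longrightarrow> x - scale (eps x) (snd S) \<in> M1"
  unfolding eps_def using residue by (rule someI_ex)

lemma eps_eqI:
  assumes "x - scale k (snd S) \<in> M1"
  shows "eps x = k"
proof (rule ccontr)
  assume ne: "eps x \<noteq> k"
  have "x = (x - scale k (snd S)) + scale k (snd S)" by simp
  then have "x \<in> vecs d" using assms in_vecs mul_unit(1) by (metis vecs_closed(2,4))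
  then have "(x - scale k (snd S)) - (x - scale (eps x) (snd S)) \<in> M1" using eps assms M1_closed by blast
  then have "scale (eps x - k) (snd S) \<in> M1" by (simp add: vs.scale_left_diff_distrib)
  from M1_closed(3)[OF this, of "1 / (eps x - k)"] show False using ne one_notin by simp
qed

lemma eps_rules:
  "x \<in> vecs d \<Longrightarrow> y \<in> vecs d \<Longrightarrow> eps (x + y) = eps x + eps y"
  "x \<in> vecs d \<Longrightarrow> eps (scale k x) = k * eps x"
  "x \<in> vecs d \<Longrightarrow> y \<in> vecs d \<Longrightarrow> eps (x \<star> y) = eps x * eps y"
  "eps (snd S) = 1" "x \<in> M1 \<Longrightarrow> eps x = 0"
proof -
  show "eps (x + y) = eps x + eps y" if "x \<in> vecs d" "y \<in> vecs d"
    by (rule eps_eqI) (use M1_closed(1)[OF eps[OF that(1)] eps[OF that(2)]] in \<open>simp add: algebra_simps vs.scale_left_distrib\<close>)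
  show "eps (scale k x) = k * eps x" if "x \<in> vecs d"
    by (rule eps_eqI) (use M1_closed(3)[OF eps[OF that], of k] in \<open>simp add: vs.scale_right_diff_distrib\<close>)
  show "eps (x \<star> y) = eps x * eps y" if xy: "x \<in> vecs d" "y \<in> vecs d"
  proof (rule eps_eqI)
    let ?x = "x - scale (eps x) (snd S)" and ?y = "y - scale (eps y) (snd S)"
    have "x \<star> y - scale (eps x * eps y) (snd S) = ?x \<star> ?y + scale (eps y) ?x + scale (eps x) ?y"
      using xy mul_unit(1)
      by (simp add: smul_diff smul_scale mul_unit vs.scale_right_diff_distrib mult.commute algebra_simps)
    then show "x \<star> y - scale (eps x * eps y) (snd S) \<in> M1"
      using eps[OF xy(1)] eps[OF xy(2)] mult11 M2_M1 by (auto intro!: M1_closed)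
  qed
  show "eps (snd S) = 1" by (rule eps_eqI) (simp add: M1_closed)
  show "eps x = 0" if "x \<in> M1" by (rule eps_eqI) (use that in simp)
qed

lemma mul_eps_sigma:
  assumes "x \<in> vecs d"
  shows "x \<star> \<sigma> = scale (eps x) \<sigma>"
proof -
  have "(x - scale (eps x) (snd S)) \<star> \<sigma> = 0" by (rule mul_sigma(1)[OF eps[OF assms]])
  then show ?thesis by (simp add: smul_diff smul_scale mul_unit sigma_in)
qed

section \<open>Gorenstein duality\<close>

text \<open>
  A functional with value 1 on the socle generator. The bilinear form \<open>\<Lambda> (x
  \<star> y)\<close> is then nondegenerate, which is the form of Gorenstein duality used below.
\<close>

definition \<Lambda> :: "(nat \<Rightarrow> 'k) \<Rightarrow> 'k" where
  "\<Lambda> = (SOME f. is_functional f \<and> f \<sigma> = 1)"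

lemma Lambda: "is_functional \<Lambda>" "\<Lambda> \<sigma> = 1"
proof -
  obtain f where "is_functional f" "f \<sigma> = 1"
    using functional_separation[of "{0}" \<sigma>] sigma by (auto simp: vs.subspace_def)
  then have "is_functional \<Lambda> \<and> \<Lambda> \<sigma> = 1" unfolding \<Lambda>_def by (intro someI[of "\<lambda>f. is_functional f \<and> f \<sigma> = 1"]) auto
  then show "is_functional \<Lambda>" "\<Lambda> \<sigma> = 1" by auto
qed

lemmas Lambda_simps = is_functionalD[OF Lambda(1)] Lambda(2)

text \<open>
  A nonzero element can be multiplied into the socle without becoming 0: multiply by elements of
  \<open>M1\<close> as long as the product is nonzero. The fourth product vanishes, and the last
  nonzero one is a multiple of \<open>\<sigma>\<close>, where \<open>\<Lambda>\<close> detects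
  it.
\<close>

lemma nondegenerate:
  assumes x: "x \<in> vecs d" and z: "\<And>y. y \<in> vecs d \<Longrightarrow> \<Lambda> (x \<star> y) = 0"
  shows "x = 0"
proof -
  have ann: "u = 0" if u: "u \<in> vecs d" "\<And>y. y \<in> vecs d \<Longrightarrow> \<Lambda> (u \<star> y) = 0" "\<And>y. y \<in> M1 \<Longrightarrow> u \<star> y = 0" for u
  proof -
    obtain k where k: "u = scale k \<sigma>" using socle u by blast
    have "\<Lambda> (u \<star> snd S) = k" using mul_unit(3)[OF u(1)] by (simp add: k Lambda_simps)
    then show ?thesis using u(2) mul_unit(1) k by simp
  qed
  have Lmul: "\<Lambda> (a \<star> y) = 0" if "\<And>y. y \<in> vecs d \<Longrightarrow> \<Lambda> (b \<star> y) = 0" "a = b \<star> c" for a b c y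
    using that by (simp add: mul_assoc)
  have 2: "x \<star> y \<star> y' = 0" if "y \<in> M1" "y' \<in> M1" for y y'
  proof (rule ann)
    show "\<Lambda> (x \<star> y \<star> y' \<star> v) = 0" for v using Lmul[OF z, of "x \<star> y \<star> y'" "y \<star> y'"] by (simp add: mul_assoc)
    show "x \<star> y \<star> y' \<star> v = 0" if "v \<in> M1" for v
    proof -
      have "x \<star> y \<star> y' \<star> v = x \<star> (y \<star> (y' \<star> v))" by (simp add: mul_assoc)
      also have "y \<star> (y' \<star> v) \<in> M3" using \<open>y \<in> M1\<close> \<open>y' \<in> M1\<close> that mult11 mult12 by blast
      then obtain k where k: "y \<star> (y' \<star> v) = scale k \<sigma>" using M3_sigma by blast
      have "x \<star> (y \<star> (y' \<star> v)) = scale (k * eps x) \<sigma>" using k by (simp add: smul_scale mul_eps_sigma x)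
      moreover have "eps x = 0"
      proof -
        have "\<Lambda> (x \<star> \<sigma>) = 0" using z sigma_in by blast
        then show ?thesis by (simp add: mul_eps_sigma x Lambda_simps)
      qed
      ultimately show ?thesis by (simp add: mul_assoc)
    qed
  qed auto
  have 1: "x \<star> y = 0" if "y \<in> M1" for y
    by (rule ann) (use Lmul[OF z, of "x \<star> y" y] 2[OF that] in auto)
  show ?thesis by (rule ann) (use x z 1 in auto)
qed

text \<open>
  The Gram matrix of a nondegenerate form is invertible, so the coordinates of the representing
  vector are the solution of a linear system.
\<close>

lemma represent:
  assumes f: "is_functional f"
  obtains a where "a \<in> vecs d" "\<And>x. x \<in> vecs d \<Longrightarrow> \<Lambda> (a \<star> x) = f x"
proof -
  define G where "G = mat d d (\<lambda>(i, j). \<Lambda> (basis_vec i \<star> basis_vec j))"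
  have G: "G \<in> carrier_mat d d" by (simp add: G_def)
  have G_mult: "(\<Sum>j<d. G $$ (i, j) * a j) = \<Lambda> ((\<Sum>j<d. scale (a j) (basis_vec j)) \<star> basis_vec i)" if "i < d" for i a
    using that by (simp add: G_def smul_sum_left smul_scale Lambda_simps mul_comm[of "basis_vec i"] mult.commute)
  have ext: "\<Lambda> (a \<star> x) = f x" if a: "\<And>i. i < d \<Longrightarrow> \<Lambda> (a \<star> basis_vec i) = f (basis_vec i)" and x: "x \<in> vecs d"
    and f: "is_functional f" for a x f
  proof -
    have "\<Lambda> (a \<star> (\<Sum>i<d. scale (x i) (basis_vec i))) = f (\<Sum>i<d. scale (x i) (basis_vec i))"
      by (simp add: smul_sum_right smul_scale Lambda_simps is_functionalD[OF f] a)
    then show ?thesis by (simp add: vecs_expand[OF x])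
  qed
  have "det G \<noteq> 0"
  proof
    assume "det G = 0"
    then obtain v where v: "v \<in> carrier_vec d" "v \<noteq> 0\<^sub>v d" "G *\<^sub>v v = 0\<^sub>v d"
      using det_0_iff_vec_prod_zero_field[OF G] by blast
    define a where "a = (\<Sum>j<d. scale (v $ j) (basis_vec j))"
    have "\<Lambda> (a \<star> basis_vec i) = 0" if i: "i < d" for i
    proof -
      have "(G *\<^sub>v v) $ i = (\<Sum>j<d. G $$ (i, j) * v $ j)"
        using i v(1) G by (auto simp: scalar_prod_def atLeast0LessThan)
      then show ?thesis using v(3) i G_mult[OF i, of "\<lambda>j. v $ j"] by (simp add: a_def)
    qed
    then have "\<Lambda> (a \<star> x) = 0" if "x \<in> vecs d" for x
      by (rule ext[of a "\<lambda>_. 0"]) (use that in \<open>auto simp: is_functional_def\<close>)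
    moreover have "a \<in> vecs d" unfolding a_def by (intro vecs_sum) auto
    ultimately have "a = 0" using nondegenerate by blast
    moreover have "a i = v $ i" if "i < d" for i
      using that by (simp add: a_def sum_fun_apply basis_vec_def if_distrib cong: if_cong)
    ultimately have "v = 0\<^sub>v d" using v(1) by (intro eq_vecI) auto
    then show False using v by simp
  qed
  note cr = cramer(1)[OF G this, of _ "\<lambda>i. f (basis_vec i)"]
  define b where "b j = (\<Sum>k<d. adj_mat G $$ (j, k) * f (basis_vec k)) / det G" for j
  define a where "a = (\<Sum>j<d. scale (b j) (basis_vec j))"
  show thesis
  proof (rule that[of a])
    show "a \<in> vecs d" unfolding a_def by (intro vecs_sum) auto
    show "\<Lambda> (a \<star> x) = f x" if "x \<in> vecs d" for x
      by (rule ext[OF _ that f]) (use cr G_mult[of _ b] in \<open>simp add: a_def b_def\<close>)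
  qed
qed

text \<open>
  The annihilator \<open>(0 : m\<^sup>2)\<close>.
\<close>

definition ann2 :: "(nat \<Rightarrow> 'k) set" where
  "ann2 = {x \<in> vecs d. \<forall>y\<in>M2. x \<star> y = 0}"

lemma ann2_if_functional:
  assumes "a \<in> vecs d" "\<And>y. y \<in> M2 \<Longrightarrow> \<Lambda> (a \<star> y) = 0"
  shows "a \<in> ann2"
proof -
  have "a \<star> y = 0" if y: "y \<in> M2" for y
    by (rule nondegenerate) (use assms ideal2[OF _ y] in \<open>auto simp: mul_assoc mul_comm[of y]\<close>)
  then show ?thesis using assms by (simp add: ann2_def)
qed

text \<open>
  If \<open>x\<close> were not in \<open>M2\<close>, a functional vanishing on \<open>M2\<close>
  but not at \<open>x\<close> would be \<open>\<Lambda> (a \<star> _)\<close> for some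
  \<open>a\<close>; this \<open>a\<close> annihilates \<open>M2\<close> because
  \<open>M2\<close> is an ideal, but not \<open>x\<close>.
\<close>

lemma double_annihilator:
  assumes x: "x \<in> vecs d" "\<And>y. y \<in> ann2 \<Longrightarrow> x \<star> y = 0"
  shows "x \<in> M2"
proof (rule ccontr)
  assume "x \<notin> M2"
  then obtain f where f: "is_functional f" "f x = 1" "\<And>y. y \<in> M2 \<Longrightarrow> f y = 0"
    using functional_separation[OF sub2] by blast
  obtain a where a: "a \<in> vecs d" "\<And>x. x \<in> vecs d \<Longrightarrow> \<Lambda> (a \<star> x) = f x" using represent[OF f(1)] by blast
  have "a \<in> ann2" by (rule ann2_if_functional) (use a f(3) in_vecs in auto)
  then have "\<Lambda> (a \<star> x) = 0" using x(2) by (simp add: mul_comm[of a] Lambda_simps)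
  then show False using a(2)[OF x(1)] f(2) by simp
qed

lemma ann2_M1: "x \<in> ann2 \<Longrightarrow> x \<in> M1"
proof -
  assume x: "x \<in> ann2"
  then have xv: "x \<in> vecs d" and "x \<star> \<sigma> = 0" using sigma_in by (auto simp: ann2_def)
  then have "eps x = 0" using mul_eps_sigma[OF xv] sigma(2) by (auto simp: fun_eq_iff)
  then show "x \<in> M1" using eps[OF xv] by simp
qed

lemma ann2_mult:
  assumes x: "x \<in> ann2" and y: "y \<in> M1"
  shows "x \<star> y = scale (\<Lambda> (x \<star> y)) \<sigma>"
proof -
  have "x \<star> y \<star> v = 0" if "v \<in> M1" for v
    using x mult11[OF y that] by (simp add: mul_assoc ann2_def)
  then obtain k where "x \<star> y = scale k \<sigma>" using socle by blast
  then show ?thesis by (simp add: Lambda_simps)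
qed

lemma sub_ann2: "vs.subspace ann2"
  by (auto simp: vs.subspace_def ann2_def smul_add smul_scale)

lemmas ann2_closed = vs.subspace_add[OF sub_ann2] vs.subspace_diff[OF sub_ann2] vs.subspace_scale[OF sub_ann2]
  vs.subspace_0[OF sub_ann2] vs.subspace_sum[OF sub_ann2]

lemma M2_ann2: "M2 \<subseteq> ann2"
  using mult22 in_vecs by (auto simp: ann2_def)

section \<open>Splitting off squares\<close>

text \<open>
  Orthogonal and anisotropic for the symmetric form on \<open>(0 : m\<^sup>2)\<close> given by
  the multiplication into the socle.
\<close>

definition orthogonal_family :: "nat \<Rightarrow> (nat \<Rightarrow> nat \<Rightarrow> 'k) \<Rightarrow> bool" where
  "orthogonal_family r z \<longleftrightarrow> (\<forall>i<r. z i \<in> ann2 \<and> z i \<star> z i \<noteq> 0 \<and> (\<forall>j<r. i \<noteq> j \<longrightarrow> z i \<star> z j = 0))"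

text \<open>
  Such a family is linearly independent: multiply a relation by one of its members.
\<close>

lemma orthogonal_family_bound:
  assumes "orthogonal_family r z"
  shows "r \<le> d"
proof -
  have z: "z i \<in> vecs d" "z i \<star> z i \<noteq> 0" "j < r \<Longrightarrow> i \<noteq> j \<Longrightarrow> z i \<star> z j = 0" if "i < r" for i j
    using assms that by (auto simp: orthogonal_family_def ann2_def)
  have inj: "inj_on z {..<r}"
    by (rule inj_onI) (metis z(2,3) lessThan_iff)
  have "vs.independent (z ` {..<r})"
  proof
    assume "vs.dependent (z ` {..<r})"
    then obtain u i where u: "i < r" "u (z i) \<noteq> 0" "(\<Sum>v\<in>z ` {..<r}. scale (u v) v) = 0"
      by (subst (asm) vs.dependent_finite) auto
    have "0 = (\<Sum>j<r. scale (u (z j)) (z j)) \<star> z i" using u(3) by (simp add: sum.reindex[OF inj])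
    also have "\<dots> = (\<Sum>j<r. scale (u (z j)) (z j \<star> z i))" by (simp add: smul_sum_left smul_scale)
    also have "\<dots> = (\<Sum>j<r. if j = i then scale (u (z i)) (z i \<star> z i) else 0)"
      by (rule sum.cong) (use z u in auto)
    also have "\<dots> = scale (u (z i)) (z i \<star> z i)" using u(1) by simp
    finally show False using u z(2)[OF u(1)] by (metis vs.scale_eq_0_iff)
  qed
  moreover have "z ` {..<r} \<subseteq> vs.span (basis_vec ` {..<d})"
  proof (rule image_subsetI)
    fix i assume "i \<in> {..<r}"
    then have "z i = (\<Sum>j<d. scale (z i j) (basis_vec j))" using z by (simp add: vecs_expand)
    also have "\<dots> \<in> vs.span (basis_vec ` {..<d})" by (intro vs.span_sum vs.span_scale vs.span_base) auto
    finally show "z i \<in> vs.span (basis_vec ` {..<d})" .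
  qed
  ultimately have "card (z ` {..<r}) \<le> card ((basis_vec :: nat \<Rightarrow> nat \<Rightarrow> 'k) ` {..<d})"
    using vs.independent_span_bound[of "basis_vec ` {..<d}"] by blast
  also have "\<dots> \<le> d" using card_image_le[of "{..<d}" "basis_vec :: nat \<Rightarrow> nat \<Rightarrow> 'k"] by simp
  finally show ?thesis by (simp add: card_image[OF inj])
qed

lemma maximal_orthogonal_family:
  obtains r z where "orthogonal_family r z" "\<And>r' z'. orthogonal_family r' z' \<Longrightarrow> r' \<le> r"
proof -
  have "\<exists>z. orthogonal_family 0 z" by (simp add: orthogonal_family_def)
  then have "\<exists>r. (\<exists>z. orthogonal_family r z) \<and> (\<forall>r'. (\<exists>z. orthogonal_family r' z) \<longrightarrow> r' \<le> r)"
    using orthogonal_family_bound by (intro Nat.ex_has_greatest_nat[where b = d]) auto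
  then show thesis using that by blast
qed

end

text \<open>
  A family of maximal length takes the place of an orthogonal basis of the form modulo its
  radical.
\<close>

locale split_gorenstein = short_gorenstein +
  fixes r :: nat and z :: "nat \<Rightarrow> nat \<Rightarrow> 'a"
  assumes orth: "orthogonal_family r z" and max: "orthogonal_family r' z' \<Longrightarrow> r' \<le> r"
begin

lemma z_ann2: "i < r \<Longrightarrow> z i \<in> ann2" and z_M1: "i < r \<Longrightarrow> z i \<in> M1" and z_vecs: "i < r \<Longrightarrow> z i \<in> vecs d"
  and z_square: "i < r \<Longrightarrow> z i \<star> z i \<noteq> 0" and z_orth: "i < r \<Longrightarrow> j < r \<Longrightarrow> i \<noteq> j \<Longrightarrow> z i \<star> z j = 0"
  using orth ann2_M1 M1_vecs by (auto simp: orthogonal_family_def)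

definition \<gamma> :: "nat \<Rightarrow> 'a" where "\<gamma> i = \<Lambda> (z i \<star> z i)"

lemma z_square_eq: "i < r \<Longrightarrow> z i \<star> z i = scale (\<gamma> i) \<sigma>" and gamma_nonzero: "i < r \<Longrightarrow> \<gamma> i \<noteq> 0"
proof -
  assume i: "i < r"
  show "z i \<star> z i = scale (\<gamma> i) \<sigma>" unfolding \<gamma>_def by (rule ann2_mult[OF z_ann2[OF i] z_M1[OF i]])
  then show "\<gamma> i \<noteq> 0" using z_square[OF i] by auto
qed

text \<open>
  The maximal ideal of the subalgebra that remains after the \<open>z i\<close> have been split
  off.
\<close>

definition W :: "(nat \<Rightarrow> 'a) set" where
  "W = {x \<in> M1. \<forall>i<r. x \<star> z i = 0}"

text \<open>
  Orthogonal projection to the span of the \<open>z i\<close>.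
\<close>

definition z_part :: "(nat \<Rightarrow> 'a) \<Rightarrow> nat \<Rightarrow> 'a" where
  "z_part x = (\<Sum>i<r. scale (\<Lambda> (x \<star> z i) / \<gamma> i) (z i))"

lemma sub_W: "vs.subspace W"
  using M1_closed by (auto simp: vs.subspace_def W_def smul_add smul_scale)

lemmas W_closed = vs.subspace_add[OF sub_W] vs.subspace_diff[OF sub_W] vs.subspace_scale[OF sub_W]
  vs.subspace_0[OF sub_W] vs.subspace_neg[OF sub_W]

lemma W_M1: "x \<in> W \<Longrightarrow> x \<in> M1" by (simp add: W_def)

lemma W_z: "x \<in> W \<Longrightarrow> i < r \<Longrightarrow> x \<star> z i = 0" "x \<in> W \<Longrightarrow> i < r \<Longrightarrow> z i \<star> x = 0"
  by (auto simp: W_def mul_comm[of "z i"])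

lemma M2_W: "x \<in> M2 \<Longrightarrow> x \<in> W"
  using z_ann2 M2_M1 by (auto simp: W_def ann2_def mul_comm[of x])

lemma z_part_ann2: "z_part x \<in> ann2"
  unfolding z_part_def by (intro ann2_closed z_ann2) auto

lemma minus_z_part_W:
  assumes x: "x \<in> M1"
  shows "x - z_part x \<in> W"
proof -
  have "(x - z_part x) \<star> z j = 0" if j: "j < r" for j
  proof -
    have "z_part x \<star> z j = (\<Sum>i<r. scale (\<Lambda> (x \<star> z i) / \<gamma> i) (z i \<star> z j))"
      by (simp add: z_part_def smul_sum_left smul_scale)
    also have "\<dots> = (\<Sum>i<r. if i = j then scale (\<Lambda> (x \<star> z j) / \<gamma> j) (scale (\<gamma> j) \<sigma>) else 0)"
      by (rule sum.cong) (use z_orth z_square_eq j in auto)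
    also have "\<dots> = scale (\<Lambda> (x \<star> z j)) \<sigma>" using j gamma_nonzero[OF j] by simp
    also have "\<dots> = x \<star> z j"
      using ann2_mult[OF z_ann2[OF j] x] by (simp add: mul_comm[of x])
    finally show ?thesis by (simp add: smul_diff)
  qed
  then show ?thesis using x ann2_M1[OF z_part_ann2] by (auto simp: W_def intro: M1_closed)
qed

text \<open>
  By maximality the form is zero on the part of \<open>(0 : m\<^sup>2)\<close> orthogonal to all
  \<open>z i\<close>: every element there has square zero, and by polarization so do all
  products. Such elements therefore annihilate \<open>(0 : m\<^sup>2)\<close>, hence lie in
  \<open>M2\<close> by the double annihilator property.
\<close>

lemma ann2_W: 
  assumes y: "y \<in> ann2" "y \<in> W"
  shows "y \<in> M2"
proof -
  have sq: "u \<star> u = 0" if u: "u \<in> ann2" "u \<in> W" for u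
  proof (rule ccontr)
    assume nz: "u \<star> u \<noteq> 0"
    \<comment> \<open>An anisotropic \<open>u\<close> would make the family longer.\<close>
    have "orthogonal_family (Suc r) (z(r := u))"
      using orth u W_z[OF u(2)] nz by (auto simp: orthogonal_family_def less_Suc_eq)
    then show False using max by fastforce
  qed
  have yy: "y \<star> y' = 0" if y': "y' \<in> ann2" "y' \<in> W" for y'
  proof -
    have "(y + y') \<star> (y + y') = 0" by (intro sq ann2_closed W_closed y y')
    then have "y \<star> y' + y \<star> y' = 0"
      using sq[OF y] sq[OF y'] by (simp add: smul_add mul_comm[of y' y])
    then have "scale 2 (y \<star> y') = 0" by (simp add: fun_eq_iff)
    then show ?thesis by (metis vs.scale_eq_0_iff zero_neq_numeral)
  qed
  show ?thesis
  proof (rule double_annihilator)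
    show "y \<in> vecs d" using y by (simp add: ann2_def)
    fix x assume x: "x \<in> ann2"
    have "y \<star> (x - z_part x) = 0"
      by (rule yy) (use x z_part_ann2 ann2_closed minus_z_part_W ann2_M1 in auto)
    moreover have "y \<star> z_part x = 0" by (simp add: z_part_def smul_sum_right smul_scale W_z[OF y(2)])
    ultimately show "y \<star> x = 0" by (simp add: smul_diff)
  qed
qed

end

text \<open>
  From here on vectors are elements of an abstract algebra; rewriting them pointwise would only
  destroy the structure of the terms.
\<close>

lemmas vec_apply = plus_fun_apply zero_fun_apply scale_apply diff_fun_apply uminus_fun_apply
declare vec_apply [simp del]

text \<open>
  The linear combination of the vectors \<open>a 0, \<dots>, a (n - 1)\<close> with coefficients
  \<open>p\<close>.
\<close>

definition comb :: "nat \<Rightarrow> (nat \<Rightarrow> nat \<Rightarrow> 'k::field) \<Rightarrow> (nat \<Rightarrow> 'k) \<Rightarrow> nat \<Rightarrow> 'k" where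
  "comb n a p = (\<Sum>i<n. scale (p i) (a i))"

definition trunc :: "nat \<Rightarrow> (nat \<Rightarrow> 'k::field) \<Rightarrow> nat \<Rightarrow> 'k" where
  "trunc n p = (\<lambda>i. if i < n then p i else 0)"

lemma trunc_simps: "trunc n p \<in> vecs n" "smul n c (trunc n p) q = smul n c p q"
  "smul n c q (trunc n p) = smul n c q p" "comb n a (trunc n p) = comb n a p" "aug n \<epsilon> (trunc n p) = aug n \<epsilon> p"
  by (auto simp: trunc_def vecs_def comb_def aug_def intro!: smul_cong)

lemma comb_linear: "comb n a (p + q) = comb n a p + comb n a q" "comb n a (scale k p) = scale k (comb n a p)"
  "comb n a (p - q) = comb n a p - comb n a q" "comb n a 0 = 0"
  by (simp_all add: comb_def vec_apply vs.scale_left_distrib sum.distrib vs.scale_sum_right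
      vs.scale_left_diff_distrib sum_subtractf)

lemma comb_in_vecs: "(\<And>i. i < n \<Longrightarrow> a i \<in> vecs d) \<Longrightarrow> comb n a p \<in> vecs d"
  unfolding comb_def by (intro vecs_sum vecs_closed) auto

lemma comb_Suc: "comb (Suc n) (a(n := z)) p = comb n a p + scale (p n) z"
  by (simp add: comb_def)

context algebra_structure
begin

text \<open>
  The vectors \<open>a 0, \<dots>, a (n - 1)\<close> are a basis, with structure constants
  \<open>T\<close>, of a subalgebra that contains the unit.
\<close>

definition realizes :: "nat \<Rightarrow> 'k algebra_data \<Rightarrow> (nat \<Rightarrow> nat \<Rightarrow> 'k) \<Rightarrow> bool" where
  "realizes n T a \<longleftrightarrow> (\<forall>i<n. a i \<in> vecs d) \<and> (\<forall>p\<in>vecs n. comb n a p = 0 \<longrightarrow> p = 0) \<and>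
     (\<forall>p\<in>vecs n. \<forall>q\<in>vecs n. comb n a (smul n (fst T) p q) = comb n a p \<star> comb n a q) \<and>
     snd T \<in> vecs n \<and> comb n a (snd T) = snd S"

lemma realizesD:
  assumes "realizes n T a"
  shows "i < n \<Longrightarrow> a i \<in> vecs d" "p \<in> vecs n \<Longrightarrow> comb n a p = 0 \<Longrightarrow> p = 0"
    "comb n a (smul n (fst T) p q) = comb n a p \<star> comb n a q" "snd T \<in> vecs n" "comb n a (snd T) = snd S"
    "comb n a p \<in> vecs d" "p \<in> vecs n \<Longrightarrow> q \<in> vecs n \<Longrightarrow> comb n a p = comb n a q \<Longrightarrow> p = q"
proof -
  note r = assms[unfolded realizes_def]
  show a: "i < n \<Longrightarrow> a i \<in> vecs d" for i using r by blast
  show 0: "p \<in> vecs n \<Longrightarrow> comb n a p = 0 \<Longrightarrow> p = 0" for p using r by blast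
  show "snd T \<in> vecs n" "comb n a (snd T) = snd S" using r by blast+
  show "comb n a p \<in> vecs d" by (rule comb_in_vecs) (rule a)
  have "comb n a (smul n (fst T) (trunc n p) (trunc n q)) = comb n a (trunc n p) \<star> comb n a (trunc n q)"
    using r trunc_simps(1) by blast
  then show "comb n a (smul n (fst T) p q) = comb n a p \<star> comb n a q" by (simp add: trunc_simps)
  show "p \<in> vecs n \<Longrightarrow> q \<in> vecs n \<Longrightarrow> comb n a p = comb n a q \<Longrightarrow> p = q"
    using 0[of "p - q"] by (simp add: comb_linear)
qed

lemma realizes_is_algebra:
  assumes "realizes n T a"
  shows "is_algebra n T"
proof -
  note r = realizesD[OF assms]
  show ?thesis
    unfolding is_algebra_def
  proof (intro conjI ballI r(4))
    show "smul n (fst T) (snd T) p = p" if "p \<in> vecs n" for p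
      by (rule r(7)) (use that in \<open>auto simp: r(3,5) mul_unit r(6)\<close>)
    show "smul n (fst T) p q = smul n (fst T) q p" for p q
      by (rule r(7)) (auto simp: r(3) intro: mul_comm)
    show "smul n (fst T) (smul n (fst T) p q) t = smul n (fst T) p (smul n (fst T) q t)" for p q t
      by (rule r(7)) (auto simp: r(3) mul_assoc)
  qed
qed

end

context short_gorenstein
begin

lemma eps_sum: "(\<And>i. i \<in> I \<Longrightarrow> f i \<in> vecs d) \<Longrightarrow> eps (\<Sum>i\<in>I. f i) = (\<Sum>i\<in>I. eps (f i))"
  by (induction I rule: infinite_finite_induct) (auto simp: eps_rules M1_closed vecs_sum)

text \<open>
  If \<open>x \<in> M1\<close> is annihilated by the part in \<open>M1\<close> of a realized
  subalgebra and its square is a nonzero multiple of \<open>\<sigma>\<close> in that subalgebra,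
  then the subalgebra and \<open>x\<close> together form a one-point extension in the sense of
  \<open>ext_mult\<close>.
\<close>

lemma adjoin_orthogonal:
  assumes re: "realizes n T a" and lim: "limit_of_reduced n T"
    and x: "x \<in> M1" "x \<star> x = scale g \<sigma>" "g \<noteq> 0" "\<And>i. i < n \<Longrightarrow> a i \<star> x = scale (eps (a i)) x"
    and sv: "s \<in> vecs n" "comb n a s = scale g \<sigma>"
  shows "\<exists>T'. realizes (Suc n) T' (a(n := x)) \<and> limit_of_reduced (Suc n) T'"
proof -
  note r = realizesD[OF re]
  define \<epsilon> where "\<epsilon> i = eps (a i)" for i
  have aug: "aug n \<epsilon> p = eps (comb n a p)" for p
  proof -
    have "eps (comb n a p) = (\<Sum>i<n. eps (scale (p i) (a i)))"
      unfolding comb_def by (rule eps_sum) (use r(1) in auto)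
    also have "\<dots> = aug n \<epsilon> p" unfolding aug_def \<epsilon>_def by (rule sum.cong) (use r(1) in \<open>auto simp: eps_rules\<close>)
    finally show ?thesis by simp
  qed
  have cx: "comb n a p \<star> x = scale (aug n \<epsilon> p) x" for p
  proof -
    have "comb n a p \<star> x = (\<Sum>i<n. scale (p i) (a i \<star> x))" by (simp add: comb_def smul_sum_left smul_scale)
    also have "\<dots> = (\<Sum>i<n. scale (\<epsilon> i * p i) x)"
      by (rule sum.cong) (auto simp: x(4) \<epsilon>_def mult.commute)
    finally show ?thesis by (simp add: aug_def vs.scale_sum_left)
  qed
  have eps_s: "aug n \<epsilon> s = 0"
    unfolding aug sv(2) by (rule eps_rules(5)) (intro M1_closed sigma_in)
  interpret extension n \<epsilon> s by unfold_locales (rule sv eps_s)+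
  obtain c u where T: "T = (c, u)" by (cases T)
  let ?T = "(consts_of (ext_mult n \<epsilon> s c), u)"
  have sn: "s n = 0" using sv(1) by (simp add: vecs_def)
  have mul: "comb (Suc n) (a(n := x)) (ext_mult n \<epsilon> s c P Q) =
      comb (Suc n) (a(n := x)) P \<star> comb (Suc n) (a(n := x)) Q" for P Q
  proof -
    have bn: "comb n a (basis_vec n) = 0" "basis_vec n n = (1::'k)" by (simp_all add: comb_def basis_vec_def)
    have "comb (Suc n) (a(n := x)) (ext_mult n \<epsilon> s c P Q) =
        comb n a (smul n c P Q) + scale (P n * Q n) (scale g \<sigma>) + scale (P n * aug n \<epsilon> Q + Q n * aug n \<epsilon> P) x"
      unfolding comb_Suc by (simp add: ext_mult_def comb_linear sv(2) bn vec_apply sn smul_def[of n c P Q, THEN fun_cong, of n])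
    also have "comb n a (smul n c P Q) = comb n a P \<star> comb n a Q" using r(3) T by simp
    finally show ?thesis
      unfolding comb_Suc
      by (simp add: smul_add smul_scale cx mul_comm[of x "comb n a _"] x(2) vs.scale_left_distrib vs.scale_right_distrib
          mult.commute ac_simps)
  qed
  have un: "u n = 0" using r(4) T by (simp add: vecs_def)
  have "realizes (Suc n) ?T (a(n := x))"
    unfolding realizes_def snd_conv fst_conv
  proof (intro conjI ballI allI impI)
    show "(a(n := x)) i \<in> vecs d" if "i < Suc n" for i using that r(1) in_vecs x(1) by (cases "i = n") auto
    show "u \<in> vecs (Suc n)" using r(4) T by (auto simp: vecs_def)
    show "comb (Suc n) (a(n := x)) u = snd S" unfolding comb_Suc using r(5) T un by simp
    show "comb (Suc n) (a(n := x)) (smul (Suc n) (consts_of (ext_mult n \<epsilon> s c)) p q) =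
        comb (Suc n) (a(n := x)) p \<star> comb (Suc n) (a(n := x)) q" if "p \<in> vecs (Suc n)" "q \<in> vecs (Suc n)" for p q
      by (simp only: ext_mult_consts[OF that] mul)
    fix P :: "nat \<Rightarrow> 'k" assume P: "P \<in> vecs (Suc n)" and "comb (Suc n) (a(n := x)) P = 0"
    then have 0: "comb n a P = scale (- P n) x" unfolding comb_Suc by (simp add: eq_neg_iff_add_eq_0)
    then have "eps (comb n a P) = 0" using x(1) by (simp only:) (intro eps_rules(5) M1_closed)
    then have "comb n a P \<star> x = 0" unfolding cx aug by simp
    then have "scale (- P n * g) \<sigma> = 0" unfolding 0 smul_scale x(2) by (simp only: vs.scale_scale)
    then have Pn: "P n = 0" using x(3) sigma(2) by simp
    then have Pv: "P \<in> vecs n" using P by (auto simp: vecs_def le_less_Suc_eq) (metis Suc_leI le_neq_implies_less)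
    show "P = 0" by (rule r(2)[OF Pv]) (use 0 Pn in simp)
  qed
  moreover have "limit_of_reduced (Suc n) ?T"
  proof (rule limit_of_reduced_extension)
    show "infinite (UNIV :: 'k set)" by (rule infinite_UNIV_char_0)
    show "is_algebra n (c, u)" using realizes_is_algebra[OF re] T by simp
    show "limit_of_reduced n (c, u)" using lim T by simp
    have c3: "comb n a (smul n c p q) = comb n a p \<star> comb n a q" for p q using r(3) T by simp
    show "aug n \<epsilon> (smul n c p q) = aug n \<epsilon> p * aug n \<epsilon> q" for p q
      unfolding aug c3 by (rule eps_rules(3)) (rule r(6))+
    show "aug n \<epsilon> u = 1" unfolding aug using r(5) T by (simp add: eps_rules)
    show "smul n c p s = scale (aug n \<epsilon> p) s" if "p \<in> vecs n" for p
    proof (rule r(7))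
      show "comb n a (smul n c p s) = comb n a (scale (aug n \<epsilon> p) s)"
        unfolding c3 comb_linear sv(2) aug by (simp add: smul_scale mul_eps_sigma[OF r(6)] mult.commute)
    qed (use sv in auto)
  qed
  ultimately show ?thesis by blast
qed

end

section \<open>Comparison with the graded quotient\<close>

context split_gorenstein
begin

text \<open>
  Take basis vectors \<open>v\<close> of \<open>W\<close> modulo \<open>M2\<close> and replace
  each by \<open>v + q v\<close> with \<open>q v \<in> M2\<close>. As \<open>M2\<close>
  annihilates itself, \<open>\<Lambda>\<close> of the product of the corrections of two vectors
  \<open>v\<close> and \<open>u\<close> is \<open>\<Lambda> (v \<star> u) + \<Lambda> (q v
  \<star> u) + \<Lambda> (v \<star> q u)\<close>, which vanishes if \<open>\<Lambda> (q v
  \<star> u) = - \<Lambda> (v \<star> u) / 2\<close> for all basis vectors \<open>v\<close> and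
  \<open>u\<close>. Duality yields such a \<open>q v\<close>: a functional on \<open>W\<close>
  that vanishes on \<open>M2\<close> is represented by an element of \<open>(0 :
  m\<^sup>2)\<close>, and removing the component along the \<open>z i\<close> leads into
  \<open>M2\<close>. The last correction by a multiple of \<open>\<sigma>\<close> makes
  \<open>\<Lambda>\<close> vanish on \<open>V\<close> itself.
\<close>

lemma isotropic_complement:
  obtains V where "vs.subspace V" "V \<subseteq> W" "\<And>v. v \<in> V \<Longrightarrow> \<Lambda> v = 0"
    "\<And>v v'. v \<in> V \<Longrightarrow> v' \<in> V \<Longrightarrow> \<Lambda> (v \<star> v') = 0"
    "\<And>w. w \<in> W \<Longrightarrow> \<exists>v\<in>V. w - v \<in> M2"
proof -
  obtain B2 where B2: "B2 \<subseteq> M2" "vs.independent B2" "M2 \<subseteq> vs.span B2"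
    using vs.maximal_independent_subset by blast
  have "B2 \<subseteq> W" using B2 M2_W by blast
  then obtain B where B: "B2 \<subseteq> B" "B \<subseteq> W" "vs.independent B" "W \<subseteq> vs.span B"
    using vs.maximal_independent_subset_extend B2(2) by blast
  have "\<exists>q\<in>M2. \<forall>b\<in>B. b \<notin> B2 \<longrightarrow> \<Lambda> (q \<star> b) = - \<Lambda> (v \<star> b) / 2" for v
  proof -
    obtain f where f: "is_functional f" "\<And>b. b \<in> B \<Longrightarrow> f b = (if b \<in> B2 then 0 else - \<Lambda> (v \<star> b) / 2)"
      using functional_on_independent[OF B(3), of "\<lambda>b. if b \<in> B2 then 0 else - \<Lambda> (v \<star> b) / 2"] by blast
    obtain a where a: "a \<in> vecs d" "\<And>x. x \<in> vecs d \<Longrightarrow> \<Lambda> (a \<star> x) = f x" using represent[OF f(1)] by blast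
    have fB2: "f b = 0" if "b \<in> B2" for b using f(2)[of b] that B(1) by auto
    have "f y = 0" if "y \<in> vs.span B2" for y
      using that fB2 by (induction rule: vs.span_induct_alt) (auto simp: is_functionalD[OF f(1)])
    then have "a \<in> ann2" using a B2(3) in_vecs by (intro ann2_if_functional) auto
    \<comment> \<open>Products with elements of \<open>W\<close> do not see the component along the \<open>z i\<close>.\<close>
    then have "a - z_part a \<in> M2"
      using z_part_ann2 ann2_M1 by (intro ann2_W minus_z_part_W ann2_closed) auto
    moreover have "\<Lambda> ((a - z_part a) \<star> b) = - \<Lambda> (v \<star> b) / 2" if "b \<in> B" "b \<notin> B2" for b
    proof -
      have bW: "b \<in> W" using that B by blast
      have "z_part a \<star> b = 0" by (simp add: z_part_def smul_sum_left smul_scale W_z(2)[OF bW])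
      then show ?thesis using a(2)[of b] f(2)[of b] that in_vecs(1)[OF W_M1[OF bW]] by (simp add: smul_diff)
    qed
    ultimately show ?thesis by blast
  qed
  then obtain q where q: "\<And>v. q v \<in> M2" "\<And>v b. b \<in> B \<Longrightarrow> b \<notin> B2 \<Longrightarrow> \<Lambda> (q v \<star> b) = - \<Lambda> (v \<star> b) / 2"
    by metis
  \<comment> \<open>Subtracting a multiple of \<open>\<sigma>\<close> changes no product with elements of \<open>M1\<close>.\<close>
  define g where "g v = v + q v - scale (\<Lambda> (v + q v)) \<sigma>" for v
  have gW: "g v \<in> W" if "v \<in> B" for v
    unfolding g_def using that B(2) M2_W[OF q(1)] M2_W[OF sigma_in(1)] by (intro W_closed) auto
  have g0: "\<Lambda> (g v) = 0" for v by (simp add: g_def Lambda_simps)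
  have gg: "\<Lambda> (g v \<star> g v') = 0" if v: "v \<in> B - B2" "v' \<in> B - B2" for v v'
  proof -
    have v1: "v \<in> M1" "v' \<in> M1" using v B(2) W_M1 by auto
    have q1: "q v \<in> M1" "q v' \<in> M1" using q(1) M2_M1 by auto
    have "g v \<star> g v' = v \<star> v' + q v \<star> v' + q v' \<star> v"
      by (simp add: g_def smul_add smul_diff smul_scale mul_sigma v1 q1 mult22 q(1) sigma_in mul_comm[of v "q v'"])
    moreover have "\<Lambda> (q v \<star> v') = - \<Lambda> (v \<star> v') / 2" "\<Lambda> (q v' \<star> v) = - \<Lambda> (v \<star> v') / 2"
      using q(2)[of v' v] q(2)[of v v'] v by (auto simp: mul_comm[of v' v])
    ultimately show ?thesis by (simp add: Lambda_simps)
  qed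
  define V where "V = vs.span (g ` (B - B2))"
  have sV: "vs.subspace V" by (simp add: V_def)
  have VW: "V \<subseteq> W" unfolding V_def by (rule vs.span_minimal[OF _ sub_W]) (use gW in auto)
  have V0: "\<Lambda> v = 0" if "v \<in> V" for v
    using that unfolding V_def by (induction rule: vs.span_induct_alt) (auto simp: Lambda_simps g0)
  have gV: "\<Lambda> (v \<star> g b) = 0" if "v \<in> V" "b \<in> B - B2" for v b
    using that(1) unfolding V_def
    by (induction rule: vs.span_induct_alt) (use that(2) in \<open>auto simp: Lambda_simps smul_add smul_scale gg\<close>)
  have VV: "\<Lambda> (v \<star> v') = 0" if "v \<in> V" "v' \<in> V" for v v'
    using that(2) unfolding V_def
    by (induction rule: vs.span_induct_alt) (use gV[OF that(1)] in \<open>auto simp: Lambda_simps smul_add smul_scale\<close>)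
  have "\<exists>v\<in>V. w - v \<in> M2" if w: "w \<in> vs.span B" for w
    using w
  proof (induction rule: vs.span_induct_alt)
    case base show ?case using sV vs.subspace_0 by (intro bexI[of _ 0])
      (auto simp: M2_closed)
  next
    case (step c b y)
    then obtain v where v: "v \<in> V" "y - v \<in> M2" by blast
    show ?case
    proof (cases "b \<in> B2")
      case True
      have eq: "scale c b + y - v = scale c b + (y - v)" by (simp add: algebra_simps)
      have "scale c b + y - v \<in> M2" unfolding eq using True B2(1) by (intro M2_closed(1)[OF M2_closed(3) v(2)]) auto
      then show ?thesis using v by blast
    next
      case False
      then have gb: "g b \<in> V" using step(1) unfolding V_def by (intro vs.span_base) auto
      have eq: "scale c b + y - (scale c (g b) + v) = (y - v) - scale c (q b - scale (\<Lambda> (b + q b)) \<sigma>)"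
        by (simp add: g_def fun_eq_iff vec_apply algebra_simps)
      have "scale c b + y - (scale c (g b) + v) \<in> M2"
        unfolding eq by (intro M2_closed(2)[OF v(2)] M2_closed(3) M2_closed(2)[OF q(1)] sigma_in)
      moreover have "scale c (g b) + v \<in> V" using gb v sV by (intro vs.subspace_add vs.subspace_scale)
      ultimately show ?thesis by blast
    qed
  qed
  then show thesis using that[OF sV VW V0 VV] B(4) by blast
qed

end

text \<open>
  The graded quotient \<open>Q(0)\<close> enters through structure constants \<open>T\<close>
  and the maps \<open>\<kappa>1\<close>, \<open>\<kappa>2\<close>, \<open>\<kappa>3\<close> that
  send an element of \<open>m\<^sup>i\<close> to the class of its symbol of degree
  \<open>i\<close>.
\<close>

locale gorenstein_quotient = short_gorenstein d S M1 M2 M3 \<sigma> + D: algebra_structure e T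
  for d and S :: "'k::field_char_0 algebra_data" and M1 M2 M3 \<sigma> and e :: nat and T :: "'k algebra_data" +
  fixes \<kappa>1 \<kappa>2 \<kappa>3 :: "(nat \<Rightarrow> 'k) \<Rightarrow> nat \<Rightarrow> 'k"
  assumes k_vecs: "x \<in> M1 \<Longrightarrow> \<kappa>1 x \<in> vecs e" "x \<in> M2 \<Longrightarrow> \<kappa>2 x \<in> vecs e" "x \<in> M3 \<Longrightarrow> \<kappa>3 x \<in> vecs e"
    and k_add: "x \<in> M1 \<Longrightarrow> y \<in> M1 \<Longrightarrow> \<kappa>1 (x + y) = \<kappa>1 x + \<kappa>1 y"
      "x \<in> M2 \<Longrightarrow> y \<in> M2 \<Longrightarrow> \<kappa>2 (x + y) = \<kappa>2 x + \<kappa>2 y"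
    and k_scale: "x \<in> M1 \<Longrightarrow> \<kappa>1 (scale k x) = scale k (\<kappa>1 x)" "x \<in> M2 \<Longrightarrow> \<kappa>2 (scale k x) = scale k (\<kappa>2 x)"
      "x \<in> M3 \<Longrightarrow> \<kappa>3 (scale k x) = scale k (\<kappa>3 x)"
    and k_mult: "x \<in> M1 \<Longrightarrow> y \<in> M1 \<Longrightarrow> smul e (fst T) (\<kappa>1 x) (\<kappa>1 y) = \<kappa>2 (x \<star> y)"
      "x \<in> M1 \<Longrightarrow> y \<in> M2 \<Longrightarrow> smul e (fst T) (\<kappa>1 x) (\<kappa>2 y) = \<kappa>3 (x \<star> y)"
      "x \<in> M1 \<Longrightarrow> y \<in> M3 \<Longrightarrow> smul e (fst T) (\<kappa>1 x) (\<kappa>3 y) = 0"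
      "x \<in> M2 \<Longrightarrow> y \<in> M2 \<Longrightarrow> smul e (fst T) (\<kappa>2 x) (\<kappa>2 y) = 0"
      "x \<in> M2 \<Longrightarrow> y \<in> M3 \<Longrightarrow> smul e (fst T) (\<kappa>2 x) (\<kappa>3 y) = 0"
      "x \<in> M3 \<Longrightarrow> y \<in> M3 \<Longrightarrow> smul e (fst T) (\<kappa>3 x) (\<kappa>3 y) = 0"
    and k1_M2: "x \<in> M2 \<Longrightarrow> \<kappa>1 x = 0" and k2_M3: "x \<in> M3 \<Longrightarrow> \<kappa>2 x = 0"
    and k1_ann2: "x \<in> ann2 \<Longrightarrow> \<kappa>1 x = 0" and k3_sigma: "\<kappa>3 \<sigma> \<noteq> 0"
    and k_surj: "q \<in> vecs e \<Longrightarrow> \<exists>c x y w. x \<in> M1 \<and> y \<in> M2 \<and> w \<in> M3 \<and> q = scale c (snd T) + \<kappa>1 x + \<kappa>2 y + \<kappa>3 w"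

locale gorenstein_comparison = split_gorenstein d S M1 M2 M3 \<sigma> r z +
    gorenstein_quotient d S M1 M2 M3 \<sigma> e T \<kappa>1 \<kappa>2 \<kappa>3
  for d and S :: "'k::field_char_0 algebra_data" and M1 M2 M3 \<sigma> r z e T \<kappa>1 \<kappa>2 \<kappa>3 +
  fixes V :: "(nat \<Rightarrow> 'k) set"
  assumes V: "vs.subspace V" "V \<subseteq> W" "v \<in> V \<Longrightarrow> \<Lambda> v = 0" "v \<in> V \<Longrightarrow> v' \<in> V \<Longrightarrow> \<Lambda> (v \<star> v') = 0"
      "w \<in> W \<Longrightarrow> \<exists>v\<in>V. w - v \<in> M2"
begin

abbreviation dmul (infixl "\<bullet>\<^sub>D" 70) where "p \<bullet>\<^sub>D q \<equiv> smul e (fst T) p q"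

lemma V_M1: "v \<in> V \<Longrightarrow> v \<in> M1" using V(2) W_M1 by blast

lemma V_closed: "v \<in> V \<Longrightarrow> v' \<in> V \<Longrightarrow> v + v' \<in> V" "v \<in> V \<Longrightarrow> scale k v \<in> V" "0 \<in> V"
  using V(1) by (auto simp: vs.subspace_def)

lemma M1_decomp:
  assumes "y \<in> M1"
  obtains v m where "v \<in> V" "m \<in> M2" "y = v + m + z_part y"
proof -
  obtain v where "v \<in> V" "(y - z_part y) - v \<in> M2" using V(5)[OF minus_z_part_W[OF assms]] by blast
  then show thesis using that[of v "(y - z_part y) - v"] by simp
qed

text \<open>
  An element of \<open>W\<close> is orthogonal to all \<open>z i\<close>, so it suffices to test
  it on \<open>1\<close>, \<open>V\<close> and \<open>M2\<close>, which together with the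
  \<open>z i\<close> span the algebra.
\<close>

lemma Lambda_zero:
  assumes x: "x \<in> W" and "\<Lambda> x = 0" "\<And>v. v \<in> V \<Longrightarrow> \<Lambda> (x \<star> v) = 0" "\<And>m. m \<in> M2 \<Longrightarrow> \<Lambda> (x \<star> m) = 0"
  shows "x = 0"
proof (rule nondegenerate)
  show xv: "x \<in> vecs d" using x W_M1 in_vecs by blast
  fix y :: "nat \<Rightarrow> 'k" assume y: "y \<in> vecs d"
  obtain v m where vm: "v \<in> V" "m \<in> M2" "y - scale (eps y) (snd S) = v + m + z_part (y - scale (eps y) (snd S))"
    using M1_decomp[OF eps[OF y]] by blast
  have "x \<star> z_part u = 0" for u by (simp add: z_part_def smul_sum_right smul_scale W_z(1)[OF x])
  then have "x \<star> (y - scale (eps y) (snd S)) = x \<star> v + x \<star> m" by (subst vm(3)) (simp add: smul_add)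
  then have "x \<star> y = scale (eps y) x + x \<star> v + x \<star> m"
    by (simp add: smul_diff smul_scale mul_unit xv algebra_simps)
  then show "\<Lambda> (x \<star> y) = 0" using assms vm by (simp add: Lambda_simps)
qed

lemma V_M2: "x \<in> V \<Longrightarrow> x \<in> M2 \<Longrightarrow> x = 0"
  by (rule Lambda_zero) (use V mult22 Lambda_simps in auto)

text \<open>
  The graph of the isomorphism from \<open>B = K \<oplus> V \<oplus> U \<oplus> K
  \<sigma>\<close> to the graded quotient, with \<open>U = M2 \<inter> ker \<Lambda>\<close>. As
  a relation it is visibly compatible with the operations, and that it is the graph of a
  bijection can be proved afterwards.
\<close>

inductive rel :: "(nat \<Rightarrow> 'k) \<Rightarrow> (nat \<Rightarrow> 'k) \<Rightarrow> bool" where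
  relI: "x \<in> V \<Longrightarrow> y \<in> M2 \<Longrightarrow> \<Lambda> y = 0 \<Longrightarrow>
     rel (scale c (snd S) + x + y + scale w \<sigma>) (scale c (snd T) + \<kappa>1 x + \<kappa>2 y + scale w (\<kappa>3 \<sigma>))"

lemma rel_add: "rel b q \<Longrightarrow> rel b' q' \<Longrightarrow> rel (b + b') (q + q')"
proof (induction b q rule: rel.induct)
  case 1: (relI x y c w)
  from 1(4) show ?case
  proof (induction b' q' rule: rel.induct)
    case 2: (relI x' y' c' w')
    have "rel (scale (c + c') (snd S) + (x + x') + (y + y') + scale (w + w') \<sigma>)
       (scale (c + c') (snd T) + \<kappa>1 (x + x') + \<kappa>2 (y + y') + scale (w + w') (\<kappa>3 \<sigma>))"
      by (rule relI) (use 1 2 in \<open>auto intro!: V_closed M2_closed simp: Lambda_simps\<close>)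
    then show ?case
      using 1 2 by (simp add: k_add V_M1 vs.scale_left_distrib algebra_simps)
  qed
qed

lemma rel_scale: "rel b q \<Longrightarrow> rel (scale k b) (scale k q)"
proof (induction b q rule: rel.induct)
  case 1: (relI x y c w)
  have "rel (scale (k * c) (snd S) + scale k x + scale k y + scale (k * w) \<sigma>)
       (scale (k * c) (snd T) + \<kappa>1 (scale k x) + \<kappa>2 (scale k y) + scale (k * w) (\<kappa>3 \<sigma>))"
    by (rule relI) (use 1 in \<open>auto intro!: V_closed M2_closed simp: Lambda_simps\<close>)
  then show ?case
    using 1 by (simp add: k_scale V_M1 vs.scale_right_distrib)
qed

lemma rel_zero: "rel 0 0"
  using relI[of 0 0 0 0] V_closed M2_closed Lambda_simps k1_M2[of 0] k2_M3[of 0] k_scale(2)[of 0 0] by simp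

lemma rel_sum: "(\<And>i. i \<in> I \<Longrightarrow> rel (f i) (g i)) \<Longrightarrow> rel (\<Sum>i\<in>I. f i) (\<Sum>i\<in>I. g i)"
  by (induction I rule: infinite_finite_induct) (auto intro: rel_zero rel_add)

lemma rel_diff: "rel b q \<Longrightarrow> rel b' q' \<Longrightarrow> rel (b - b') (q - q')"
  using rel_add[of b q "scale (-1) b'" "scale (-1) q'"] rel_scale[of b' q' "-1"] by simp

lemma rel_unit: "rel (snd S) (snd T)"
  using relI[of 0 0 1 0] V_closed M2_closed Lambda_simps k1_M2[of 0] k_scale(2)[of 0 0] by simp

lemma k3_mult: "x \<in> M1 \<Longrightarrow> y \<in> M2 \<Longrightarrow> \<kappa>1 x \<bullet>\<^sub>D \<kappa>2 y = scale (\<Lambda> (x \<star> y)) (\<kappa>3 \<sigma>)"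
  "x \<in> M1 \<Longrightarrow> y \<in> M2 \<Longrightarrow> x \<star> y = scale (\<Lambda> (x \<star> y)) \<sigma>"
proof -
  assume xy: "x \<in> M1" "y \<in> M2"
  obtain k where k: "x \<star> y = scale k \<sigma>" using M3_sigma mult12[OF xy] by blast
  then show "x \<star> y = scale (\<Lambda> (x \<star> y)) \<sigma>" by (simp add: Lambda_simps)
  then have "\<kappa>3 (x \<star> y) = \<kappa>3 (scale (\<Lambda> (x \<star> y)) \<sigma>)" by simp
  then show "\<kappa>1 x \<bullet>\<^sub>D \<kappa>2 y = scale (\<Lambda> (x \<star> y)) (\<kappa>3 \<sigma>)" using k_mult(2)[OF xy] k_scale(3)[OF sigma(1)] by simp
qed

lemma k_vecs' [simp]: "v \<in> V \<Longrightarrow> \<kappa>1 v \<in> vecs e" "\<kappa>3 \<sigma> \<in> vecs e"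
  using k_vecs V_M1 sigma by auto

text \<open>
  The grading is used here: the product of two elements of \<open>V\<close> has no component
  along \<open>\<sigma>\<close>, so its symbol of degree 2 accounts for all of it. The remaining
  products of positive degree are multiples of \<open>\<sigma>\<close> or zero.
\<close>

lemma rel_mult: "rel b q \<Longrightarrow> rel b' q' \<Longrightarrow> rel (b \<star> b') (q \<bullet>\<^sub>D q')"
proof (induction b q rule: rel.induct)
  case 1: (relI x y c w)
  from 1(4) show ?case
  proof (induction b' q' rule: rel.induct)
    case 2: (relI x' y' c' w')
    note x = V_M1[OF 1(1)] V_M1[OF 2(1)] and y = 1(2) 2(2)
    have y1: "y \<in> M1" "y' \<in> M1" using y M2_M1 by auto
    \<comment> \<open>The product of two decomposed elements, sorted by degree; \<open>?q\<close> is its image.\<close>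
    let ?b = "scale (c * c') (snd S) + (scale c x' + scale c' x) + (scale c y' + scale c' y + x \<star> x')
        + scale (c * w' + c' * w + \<Lambda> (x \<star> y') + \<Lambda> (x' \<star> y)) \<sigma>"
    let ?q = "scale (c * c') (snd T) + \<kappa>1 (scale c x' + scale c' x) + \<kappa>2 (scale c y' + scale c' y + x \<star> x')
        + scale (c * w' + c' * w + \<Lambda> (x \<star> y') + \<Lambda> (x' \<star> y)) (\<kappa>3 \<sigma>)"
    have "rel ?b ?q"
      by (rule relI) (use 1 2 in \<open>auto intro!: V_closed M2_closed mult11 V_M1 simp: Lambda_simps V(4)\<close>)
    moreover have "(scale c (snd S) + x + y + scale w \<sigma>) \<star> (scale c' (snd S) + x' + y' + scale w' \<sigma>) = ?b"
    proof -
      have "x \<star> y' = scale (\<Lambda> (x \<star> y')) \<sigma>" "y \<star> x' = scale (\<Lambda> (x' \<star> y)) \<sigma>"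
        using k3_mult(2)[OF x(1) y(2)] k3_mult(2)[OF x(2) y(1)] by (simp_all add: mul_comm[of y x'])
      moreover have "y \<star> y' = 0" by (rule mult22[OF y])
      ultimately show ?thesis
        using mul_unit(2,3)[OF in_vecs(1)[OF x(1)]] mul_unit(2,3)[OF in_vecs(1)[OF x(2)]]
          mul_unit(2,3)[OF in_vecs(2)[OF y(1)]] mul_unit(2,3)[OF in_vecs(2)[OF y(2)]]
          mul_unit(2,3)[OF sigma_in(3)] mul_unit(2)[OF mul_unit(1)] mul_sigma[OF x(1)] mul_sigma[OF x(2)]
          mul_sigma[OF y1(1)] mul_sigma[OF y1(2)] mul_sigma[OF sigma_in(2)]
        by (simp add: smul_add smul_scale vs.scale_left_distrib vs.scale_right_distrib mult.commute ac_simps)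
    qed
    moreover have "(scale c (snd T) + \<kappa>1 x + \<kappa>2 y + scale w (\<kappa>3 \<sigma>)) \<bullet>\<^sub>D (scale c' (snd T) + \<kappa>1 x' + \<kappa>2 y' + scale w' (\<kappa>3 \<sigma>)) = ?q"
    proof -
      have "\<kappa>1 x \<bullet>\<^sub>D \<kappa>2 y' = scale (\<Lambda> (x \<star> y')) (\<kappa>3 \<sigma>)" "\<kappa>2 y \<bullet>\<^sub>D \<kappa>1 x' = scale (\<Lambda> (x' \<star> y)) (\<kappa>3 \<sigma>)"
        using k3_mult(1)[OF x(1) y(2)] k3_mult(1)[OF x(2) y(1)] by (simp_all add: D.mul_comm[of "\<kappa>2 y"])
      moreover have "\<kappa>3 \<sigma> \<bullet>\<^sub>D \<kappa>1 u = 0" if "u \<in> M1" for u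
        using k_mult(3)[OF that sigma(1)] by (simp add: D.mul_comm)
      moreover have "\<kappa>3 \<sigma> \<bullet>\<^sub>D \<kappa>2 u = 0" if "u \<in> M2" for u
        using k_mult(5)[OF that sigma(1)] by (simp add: D.mul_comm)
      moreover have "\<kappa>1 (scale c x' + scale c' x) = scale c (\<kappa>1 x') + scale c' (\<kappa>1 x)"
        using x by (simp add: k_add k_scale M1_closed)
      moreover have "\<kappa>2 (scale c y' + scale c' y + x \<star> x') = scale c (\<kappa>2 y') + scale c' (\<kappa>2 y) + \<kappa>1 x \<bullet>\<^sub>D \<kappa>1 x'"
        using x y by (simp add: k_add k_scale M2_closed mult11 k_mult(1))
      ultimately show ?thesis
        using D.mul_unit(2,3)[OF k_vecs(1)[OF x(1)]] D.mul_unit(2,3)[OF k_vecs(1)[OF x(2)]]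
          D.mul_unit(2,3)[OF k_vecs(2)[OF y(1)]] D.mul_unit(2,3)[OF k_vecs(2)[OF y(2)]]
          D.mul_unit(2,3)[OF k_vecs(3)[OF sigma(1)]] D.mul_unit(2)[OF D.mul_unit(1)]
          k_mult(3)[OF x(1) sigma(1)] k_mult(3)[OF x(2) sigma(1)]
          k_mult(5)[OF y(1) sigma(1)] k_mult(5)[OF y(2) sigma(1)] k_mult(4)[OF y] k_mult(6)[OF sigma(1) sigma(1)] x y
        by (simp add: smul_add smul_scale vs.scale_left_distrib vs.scale_right_distrib mult.commute ac_simps)
    qed
    ultimately show ?case by metis
  qed
qed

text \<open>
  The decomposition of an element of \<open>B\<close> is unique: \<open>V \<inter> M2 =
  0\<close> and \<open>\<Lambda>\<close> separates \<open>U\<close> from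
  \<open>\<sigma>\<close>.
\<close>

lemma rel_zero_left:
  assumes "rel 0 q"
  shows "q = 0"
proof -
  obtain c x y w where x: "x \<in> V" "y \<in> M2" "\<Lambda> y = 0" and 0: "0 = scale c (snd S) + x + y + scale w \<sigma>"
    and q: "q = scale c (snd T) + \<kappa>1 x + \<kappa>2 y + scale w (\<kappa>3 \<sigma>)"
    using assms by (auto elim: rel.cases)
  have xv: "x \<in> M1" "y \<in> M1" using x V_M1 M2_M1 by auto
  have "eps (scale c (snd S) + x + y + scale w \<sigma>) = c"
    using xv in_vecs sigma_in mul_unit(1) by (simp add: eps_rules)
  then have c: "c = 0" using 0 eps_rules(5)[OF M1_closed(4)] by simp
  then have "x = scale (- 1) (y + scale w \<sigma>)" using 0 by (simp add: fun_eq_iff vec_apply eq_neg_iff_add_eq_0 algebra_simps)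
  then have "x \<in> M2" using x sigma_in by (metis M2_closed(1,3))
  then have x0: "x = 0" using V_M2 x by blast
  then have yw: "y + scale w \<sigma> = 0" using 0 c by simp
  then have "\<Lambda> (y + scale w \<sigma>) = 0" by (simp add: Lambda_simps)
  then have w: "w = 0" using x by (simp add: Lambda_simps)
  then have "y = 0" using yw by simp
  then show ?thesis using q x0 c w k1_M2[OF M2_closed(4)] k_scale(2)[OF M2_closed(4), of 0] by simp
qed

text \<open>
  Multiplying a relation in the quotient by \<open>\<kappa>3 \<sigma>\<close>, by
  \<open>\<kappa>2 m\<close> and by \<open>\<kappa>1 v\<close> isolates one component after the
  other; nondegeneracy of \<open>\<Lambda>\<close> shows that each is zero.
\<close>

lemma rel_zero_right:
  assumes "rel b 0"
  shows "b = 0"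
proof -
  obtain c x y w where x: "x \<in> V" "y \<in> M2" "\<Lambda> y = 0" and b: "b = scale c (snd S) + x + y + scale w \<sigma>"
    and 0: "0 = scale c (snd T) + \<kappa>1 x + \<kappa>2 y + scale w (\<kappa>3 \<sigma>)"
    using assms by (auto elim: rel.cases)
  have xM: "x \<in> M1" "x \<in> W" using x V_M1 V(2) by auto
  have "0 = (scale c (snd T) + \<kappa>1 x + \<kappa>2 y + scale w (\<kappa>3 \<sigma>)) \<bullet>\<^sub>D \<kappa>3 \<sigma>" by (subst 0[symmetric]) simp
  also have "\<dots> = scale c (\<kappa>3 \<sigma>)"
    using k_mult(3)[OF xM(1) sigma(1)] k_mult(5)[OF x(2) sigma(1)] k_mult(6)[OF sigma(1) sigma(1)]
    by (simp add: smul_add smul_scale D.mul_unit)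
  finally have c: "c = 0" using k3_sigma by (metis vs.scale_eq_0_iff)
  have 1: "\<kappa>1 x + \<kappa>2 y + scale w (\<kappa>3 \<sigma>) = 0" using 0 c by simp
  have x0: "x = 0"
  proof (rule Lambda_zero)
    fix m assume m: "m \<in> M2"
    have "0 = (\<kappa>1 x + \<kappa>2 y + scale w (\<kappa>3 \<sigma>)) \<bullet>\<^sub>D \<kappa>2 m" by (subst 1) simp
    also have "\<dots> = scale (\<Lambda> (x \<star> m)) (\<kappa>3 \<sigma>)"
      using k3_mult(1)[OF xM(1) m] k_mult(4)[OF x(2) m] k_mult(5)[OF m sigma(1)]
      by (simp add: smul_add smul_scale D.mul_comm[of "\<kappa>3 \<sigma>"])
    finally show "\<Lambda> (x \<star> m) = 0" using k3_sigma by (metis vs.scale_eq_0_iff)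
  qed (use x xM V in auto)
  then have 2: "\<kappa>2 y + scale w (\<kappa>3 \<sigma>) = 0" using 1 k1_M2[OF M2_closed(4)] by simp
  have y0: "y = 0"
  proof (rule Lambda_zero)
    fix v assume v: "v \<in> V"
    have "0 = \<kappa>1 v \<bullet>\<^sub>D (\<kappa>2 y + scale w (\<kappa>3 \<sigma>))" by (subst 2) simp
    also have "\<dots> = scale (\<Lambda> (v \<star> y)) (\<kappa>3 \<sigma>)"
      using k3_mult(1)[OF V_M1[OF v] x(2)] k_mult(3)[OF V_M1[OF v] sigma(1)]
      by (simp add: smul_add smul_scale)
    finally show "\<Lambda> (y \<star> v) = 0" using k3_sigma by (metis vs.scale_eq_0_iff mul_comm)
  qed (use x M2_W mult22 Lambda_simps in auto)
  then have "scale w (\<kappa>3 \<sigma>) = 0" using 2 k_scale(2)[OF M2_closed(4), of 0] by simp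
  then show ?thesis using b x0 y0 c k3_sigma by simp
qed

lemma rel_total_right:
  assumes "q \<in> vecs e"
  shows "\<exists>b. rel b q \<and> b \<in> vecs d"
proof -
  obtain c x y w where x: "x \<in> M1" "y \<in> M2" "w \<in> M3" and q: "q = scale c (snd T) + \<kappa>1 x + \<kappa>2 y + \<kappa>3 w"
    using k_surj[OF assms] by blast
  obtain v m where v: "v \<in> V" "m \<in> M2" "x = v + m + z_part x" using M1_decomp[OF x(1)] by blast
  have k1: "\<kappa>1 x = \<kappa>1 v"
  proof -
    have "\<kappa>1 x = \<kappa>1 (v + (m + z_part x))" using v(3) by (simp add: add.assoc)
    also have "\<dots> = \<kappa>1 v"
      using V_M1[OF v(1)] v(2) z_part_ann2[of x] M2_ann2 ann2_M1 ann2_closed(1)[of m "z_part x"]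
      by (subst k_add) (auto simp: k1_ann2)
    finally show ?thesis .
  qed
  obtain k where k: "w = scale k \<sigma>" using M3_sigma x by blast
  let ?y = "y - scale (\<Lambda> y) \<sigma>"
  have yM: "?y \<in> M2" using x sigma_in by (intro M2_closed)
  have "\<kappa>2 y = \<kappa>2 (?y + scale (\<Lambda> y) \<sigma>)" by simp
  also have "\<dots> = \<kappa>2 ?y + scale (\<Lambda> y) (\<kappa>2 \<sigma>)" using yM sigma_in by (subst k_add) (auto intro: M2_closed simp: k_scale)
  finally have k2: "\<kappa>2 y = \<kappa>2 ?y" using k2_M3[OF sigma(1)] by simp
  have "rel (scale c (snd S) + v + ?y + scale k \<sigma>) (scale c (snd T) + \<kappa>1 v + \<kappa>2 ?y + scale k (\<kappa>3 \<sigma>))"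
    by (rule relI) (use v yM in \<open>auto simp: Lambda_simps\<close>)
  then have "rel (scale c (snd S) + v + ?y + scale k \<sigma>) q"
    using q k1 k2 k k_scale(3)[OF sigma(1)] by simp
  moreover have "scale c (snd S) + v + ?y + scale k \<sigma> \<in> vecs d"
    by (intro vecs_closed(2) vecs_closed(4) in_vecs(1)[OF V_M1[OF v(1)]] in_vecs(2)[OF yM] sigma_in(3) mul_unit(1))
  ultimately show ?thesis by blast
qed

lemma rel_total_left:
  assumes "m \<in> W"
  shows "\<exists>q\<in>vecs e. rel (scale c (snd S) + m) q"
proof -
  obtain v where v: "v \<in> V" "m - v \<in> M2" using V(5)[OF assms] by blast
  let ?l = "\<Lambda> (m - v)"
  let ?y = "m - v - scale ?l \<sigma>"
  have yM: "?y \<in> M2" by (intro M2_closed(2)[OF v(2)] M2_closed(3) sigma_in)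
  have "rel (scale c (snd S) + v + ?y + scale ?l \<sigma>) (scale c (snd T) + \<kappa>1 v + \<kappa>2 ?y + scale ?l (\<kappa>3 \<sigma>))"
    by (rule relI) (use v yM in \<open>auto simp: Lambda_simps\<close>)
  moreover have "scale c (snd S) + v + ?y + scale ?l \<sigma> = scale c (snd S) + m" by (simp add: algebra_simps)
  moreover have "scale c (snd T) + \<kappa>1 v + \<kappa>2 ?y + scale ?l (\<kappa>3 \<sigma>) \<in> vecs e"
    by (intro vecs_closed(2) vecs_closed(4) k_vecs'(1)[OF v(1)] k_vecs(2)[OF yM] k_vecs'(2) D.mul_unit(1))
  ultimately show ?thesis by metis
qed

lemma rel_z:
  assumes "rel b q" "l < r"
  shows "b \<star> z l = scale (eps b) (z l)"
proof -
  obtain c x y w where x: "x \<in> V" "y \<in> M2" and b: "b = scale c (snd S) + x + y + scale w \<sigma>"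
    using assms(1) by (auto elim: rel.cases)
  have m: "x + y + scale w \<sigma> \<in> W"
    using x V(2) M2_W[OF x(2)] M2_W[OF sigma_in(1)] by (intro W_closed) auto
  have bb: "b = scale c (snd S) + (x + y + scale w \<sigma>)" by (simp add: b add.assoc)
  have "eps b = c"
    unfolding bb using in_vecs(1)[OF W_M1[OF m]] mul_unit(1) eps_rules(5)[OF W_M1[OF m]]
    by (subst eps_rules(1)) (auto simp: eps_rules)
  moreover have "b \<star> z l = scale c (z l)"
    unfolding bb using W_z(1)[OF m assms(2)] z_vecs[OF assms(2)] by (simp add: smul_add[of _ _ "scale c (snd S)"] smul_scale mul_unit)
  ultimately show ?thesis by simp
qed

lemma base_realization:
  obtains a where "realizes e T a" "\<And>i. i < e \<Longrightarrow> \<exists>q. rel (a i) q" 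
    "\<And>b q. rel b q \<Longrightarrow> q \<in> vecs e \<Longrightarrow> comb e a q = b"
proof -
  obtain a where a: "rel (a i) (basis_vec i)" "a i \<in> vecs d" if "i < e" for i
    using rel_total_right[OF vecs_closed(5)] by metis
  have rel: "rel (comb e a p) p" if "p \<in> vecs e" for p
  proof -
    have "rel (comb e a p) (\<Sum>i<e. scale (p i) (basis_vec i))"
      unfolding comb_def by (intro rel_sum rel_scale a) auto
    then show ?thesis by (simp add: vecs_expand[OF that])
  qed
  have uniq: "comb e a q = b" if "rel b q" "q \<in> vecs e" for b q
    using rel_zero_right[of "comb e a q - b"] rel_diff[OF rel[OF that(2)] that(1)] by simp
  have "realizes e T a"
    unfolding realizes_def
  proof (intro conjI ballI allI impI a D.mul_unit(1))
    fix p :: "nat \<Rightarrow> 'k" assume p: "p \<in> vecs e"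
    show "p = 0" if "comb e a p = 0" using rel[OF p] rel_zero_left that by simp
    fix q :: "nat \<Rightarrow> 'k" assume q: "q \<in> vecs e"
    show "comb e a (p \<bullet>\<^sub>D q) = comb e a p \<star> comb e a q"
      by (rule uniq[OF rel_mult[OF rel[OF p] rel[OF q]]]) simp
  next
    show "comb e a (snd T) = snd S" by (rule uniq[OF rel_unit D.mul_unit(1)])
  qed
  then show thesis using that a(1) uniq by blast
qed

text \<open>
  Starting from the basis of \<open>B\<close> that corresponds to the basis of the graded
  quotient, the \<open>z l\<close> are adjoined one at a time.
\<close>

lemma realization_chain:
  assumes lim: "limit_of_reduced e T" and "j \<le> r"
  shows "\<exists>T' a. realizes (e + j) T' a \<and> limit_of_reduced (e + j) T' \<and>
     (\<forall>i<e + j. \<forall>l. j \<le> l \<and> l < r \<longrightarrow> a i \<star> z l = scale (eps (a i)) (z l)) \<and>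
     (\<forall>c. \<forall>m\<in>W. \<exists>p\<in>vecs (e + j). comb (e + j) a p = scale c (snd S) + m) \<and>
     (\<forall>l<j. \<exists>p\<in>vecs (e + j). comb (e + j) a p = z l)"
  using assms(2)
proof (induction j)
  case 0
  obtain a where a: "realizes e T a" "\<And>i. i < e \<Longrightarrow> \<exists>q. rel (a i) q"
    "\<And>b q. rel b q \<Longrightarrow> q \<in> vecs e \<Longrightarrow> comb e a q = b" using base_realization by blast
  have 1: "a i \<star> z l = scale (eps (a i)) (z l)" if "i < e" "l < r" for i l using a(2)[OF that(1)] rel_z that(2) by blast
  have 2: "\<exists>p\<in>vecs e. comb e a p = scale c (snd S) + m" if "m \<in> W" for c m
    using rel_total_left[OF that, of c] a(3) by blast
  show ?case by (rule exI[of _ T], rule exI[of _ a]) (use a(1) lim 1 2 in simp)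
next
  case (Suc j)
  then obtain T' a where T': "realizes (e + j) T' a" "limit_of_reduced (e + j) T'"
    and az: "\<And>i l. i < e + j \<Longrightarrow> j \<le> l \<Longrightarrow> l < r \<Longrightarrow> a i \<star> z l = scale (eps (a i)) (z l)"
    and im: "\<And>c m. m \<in> W \<Longrightarrow> \<exists>p\<in>vecs (e + j). comb (e + j) a p = scale c (snd S) + m"
    and iz: "\<And>l. l < j \<Longrightarrow> \<exists>p\<in>vecs (e + j). comb (e + j) a p = z l" by (auto simp: Suc_le_eq)
  have j: "j < r" using Suc by simp
  have "scale (\<gamma> j) \<sigma> \<in> W" using M2_W[OF sigma_in(1)] by (intro W_closed)
  then obtain s where s: "s \<in> vecs (e + j)" "comb (e + j) a s = scale (\<gamma> j) \<sigma>" using im[of _ 0] by auto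
  let ?a = "a(e + j := z j)"
  have "\<exists>T''. realizes (Suc (e + j)) T'' ?a \<and> limit_of_reduced (Suc (e + j)) T''"
    by (rule adjoin_orthogonal[OF T' z_M1[OF j] z_square_eq[OF j] gamma_nonzero[OF j] _ s]) (rule az[OF _ order_refl j])
  then obtain T'' where T'': "realizes (Suc (e + j)) T'' ?a" "limit_of_reduced (Suc (e + j)) T''" by (elim exE conjE)
  have lift: "\<exists>p\<in>vecs (Suc (e + j)). comb (Suc (e + j)) ?a p = y" if "\<exists>p\<in>vecs (e + j). comb (e + j) a p = y" for y
  proof -
    from that obtain p where p: "p \<in> vecs (e + j)" "comb (e + j) a p = y" by (elim bexE)
    have "p (e + j) = 0" by (rule vecsD[OF p(1) order_refl])
    then have "comb (Suc (e + j)) ?a p = y" unfolding comb_Suc p(2) by simp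
    moreover have "p \<in> vecs (Suc (e + j))" by (rule vecs_mono[OF p(1)]) simp
    ultimately show ?thesis by (rule bexI)
  qed
  have zj: "\<exists>p\<in>vecs (Suc (e + j)). comb (Suc (e + j)) ?a p = z j"
  proof (rule bexI[of _ "basis_vec (e + j)"])
    show "comb (Suc (e + j)) ?a (basis_vec (e + j)) = z j"
      unfolding comb_Suc by (simp add: comb_def basis_vec_def)
  qed simp
  have az': "?a i \<star> z l = scale (eps (?a i)) (z l)" if "i < Suc (e + j)" "Suc j \<le> l" "l < r" for i l
  proof (cases "i = e + j")
    case True
    then show ?thesis using z_orth[OF j, of l] that eps_rules(5)[OF z_M1[OF j]] by simp
  qed (use az that in auto)
  have iz': "\<exists>p\<in>vecs (Suc (e + j)). comb (Suc (e + j)) ?a p = z l" if "l < Suc j" for l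
    using lift[OF iz] zj that by (cases "l = j") (auto simp del: fun_upd_apply)
  show ?case
    unfolding add_Suc_right
  proof (rule exI[of _ T''], rule exI[of _ ?a], intro conjI T'' allI impI ballI)
    show "?a i \<star> z l = scale (eps (?a i)) (z l)" if "i < Suc (e + j)" "Suc j \<le> l \<and> l < r" for i l
      using az'[OF that(1)] that(2) by blast
  qed (rule lift[OF im] iz'; assumption)+
qed

lemma realization:
  assumes lim: "limit_of_reduced e T"
  shows "\<exists>n T' a. realizes n T' a \<and> limit_of_reduced n T' \<and> (\<forall>x\<in>vecs d. \<exists>p\<in>vecs n. comb n a p = x)"
proof -
  obtain T' a where T': "realizes (e + r) T' a" "limit_of_reduced (e + r) T'"
    and im: "\<And>c m. m \<in> W \<Longrightarrow> \<exists>p\<in>vecs (e + r). comb (e + r) a p = scale c (snd S) + m"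
    and iz: "\<And>l. l < r \<Longrightarrow> \<exists>p\<in>vecs (e + r). comb (e + r) a p = z l"
    using realization_chain[OF lim order_refl] by blast
  have "\<exists>p\<in>vecs (e + r). comb (e + r) a p = x" if x: "x \<in> vecs d" for x
  proof -
    define m where "m = x - scale (eps x) (snd S)"
    obtain p where p: "p \<in> vecs (e + r)" "comb (e + r) a p = scale (eps x) (snd S) + (m - z_part m)"
      using im[OF minus_z_part_W[OF eps[OF x]]] unfolding m_def by blast
    obtain f where f: "\<And>l. l < r \<Longrightarrow> f l \<in> vecs (e + r) \<and> comb (e + r) a (f l) = z l" using iz by metis
    define q where "q = (\<Sum>l<r. scale (\<Lambda> (m \<star> z l) / \<gamma> l) (f l))"
    have "comb (e + r) a q = (\<Sum>l<r. comb (e + r) a (scale (\<Lambda> (m \<star> z l) / \<gamma> l) (f l)))"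
      unfolding q_def by (rule additive.sum[of "comb (e + r) a"]) (simp add: additive_def comb_linear)
    also have "\<dots> = z_part m" unfolding z_part_def by (rule sum.cong) (use f in \<open>auto simp: comb_linear\<close>)
    finally have "comb (e + r) a (p + q) = x" using p by (simp add: comb_linear m_def)
    moreover have "q \<in> vecs (e + r)" unfolding q_def using f by (intro vecs_sum vecs_closed) auto
    ultimately show ?thesis using p(1) by (metis vecs_closed(2))
  qed
  then show ?thesis using T' by blast
qed

end

theorem (in gorenstein_quotient) limit_realization:
  assumes lim: "limit_of_reduced e T"
  shows "\<exists>n T' a. realizes n T' a \<and> limit_of_reduced n T' \<and> (\<forall>x\<in>vecs d. \<exists>p\<in>vecs n. comb n a p = x)"
proof -
  obtain r z where z: "orthogonal_family r z" "\<And>r' z'. orthogonal_family r' z' \<Longrightarrow> r' \<le> r"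
    using maximal_orthogonal_family by blast
  interpret split_gorenstein d S M1 M2 M3 \<sigma> r z by unfold_locales (use z in auto)
  obtain V where V: "vs.subspace V" "V \<subseteq> W" "\<And>v. v \<in> V \<Longrightarrow> \<Lambda> v = 0"
    "\<And>v v'. v \<in> V \<Longrightarrow> v' \<in> V \<Longrightarrow> \<Lambda> (v \<star> v') = 0" "\<And>w. w \<in> W \<Longrightarrow> \<exists>v\<in>V. w - v \<in> M2"
    using isotropic_complement by blast
  interpret gorenstein_comparison d S M1 M2 M3 \<sigma> r z e T \<kappa>1 \<kappa>2 \<kappa>3 V
    by unfold_locales (use V in auto)
  show ?thesis by (rule realization[OF lim])
qed

section \<open>Algebras over a field\<close>

lemma type_ring_simps [simp]:
  "carrier (ring_of_type_algebra :: 'k::field ring) = UNIV"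
  "x \<oplus>\<^bsub>ring_of_type_algebra\<^esub> y = x + y" "x \<otimes>\<^bsub>ring_of_type_algebra\<^esub> y = x * (y :: 'k)"
  "\<one>\<^bsub>ring_of_type_algebra\<^esub> = (1 :: 'k)" "\<zero>\<^bsub>ring_of_type_algebra\<^esub> = (0 :: 'k)"
  by (simp_all add: ring_of_type_algebra_def)

locale k_alg = algebra "ring_of_type_algebra :: 'k::field ring" A
  for A :: "('k::field, 'a) module" (structure)
begin

lemma smult_rules:
  "x \<in> carrier A \<Longrightarrow> c \<odot> x \<in> carrier A"
  "x \<in> carrier A \<Longrightarrow> (c + c') \<odot> x = c \<odot> x \<oplus> c' \<odot> x"
  "x \<in> carrier A \<Longrightarrow> y \<in> carrier A \<Longrightarrow> c \<odot> (x \<oplus> y) = c \<odot> x \<oplus> c \<odot> y"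
  "x \<in> carrier A \<Longrightarrow> (c * c') \<odot> x = c \<odot> (c' \<odot> x)"
  "x \<in> carrier A \<Longrightarrow> 1 \<odot> x = x" "x \<in> carrier A \<Longrightarrow> 0 \<odot> x = \<zero>" "c \<odot> \<zero> = \<zero>"
  "x \<in> carrier A \<Longrightarrow> y \<in> carrier A \<Longrightarrow> (c \<odot> x) \<otimes> y = c \<odot> (x \<otimes> y)"
  "x \<in> carrier A \<Longrightarrow> y \<in> carrier A \<Longrightarrow> x \<otimes> (c \<odot> y) = c \<odot> (x \<otimes> y)"
  "x \<in> carrier A \<Longrightarrow> (- 1) \<odot> x = \<ominus> x"
proof -
  show *: "x \<in> carrier A \<Longrightarrow> c \<odot> x \<in> carrier A" "x \<in> carrier A \<Longrightarrow> (c + c') \<odot> x = c \<odot> x \<oplus> c' \<odot> x"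
   "x \<in> carrier A \<Longrightarrow> y \<in> carrier A \<Longrightarrow> c \<odot> (x \<oplus> y) = c \<odot> x \<oplus> c \<odot> y" for x y c c'
    using smult_closed[of c x] smult_l_distr[of c c' x] smult_r_distr[of c x y] by simp_all
  show "x \<in> carrier A \<Longrightarrow> (c * c') \<odot> x = c \<odot> (c' \<odot> x)" using smult_assoc1[of c c' x] by simp
  show one: "x \<in> carrier A \<Longrightarrow> 1 \<odot> x = x" for x using smult_one[of x] by simp
  show zero: "x \<in> carrier A \<Longrightarrow> 0 \<odot> x = \<zero>" for x using smult_l_null[of x] by simp
  show "c \<odot> \<zero> = \<zero>" using smult_r_null[of c] by simp
  show sm: "x \<in> carrier A \<Longrightarrow> y \<in> carrier A \<Longrightarrow> (c \<odot> x) \<otimes> y = c \<odot> (x \<otimes> y)" for x y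
    using smult_assoc2[of c x y] by simp
  show "x \<in> carrier A \<Longrightarrow> y \<in> carrier A \<Longrightarrow> x \<otimes> (c \<odot> y) = c \<odot> (x \<otimes> y)"
    using sm[of y x] *(1)[of y c] by (simp add: m_comm)
  show "x \<in> carrier A \<Longrightarrow> (- 1) \<odot> x = \<ominus> x"
    using *(2)[of x "-1" 1] one[of x] zero[of x] *(1)[of x "-1"] by (simp add: minus_equality[symmetric])
qed

lemma ideal_smult:
  assumes "ideal I A" "x \<in> I"
  shows "c \<odot> x \<in> I"
proof -
  interpret I: ideal I A by fact
  have x: "x \<in> carrier A" by (rule I.Icarr) fact
  have "(c \<odot> \<one>) \<otimes> x \<in> I" using x assms(2) by (intro I.I_l_closed) (auto simp: smult_rules)
  then show ?thesis using x by (simp add: smult_rules)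
qed

section \<open>Coordinates on finite-dimensional algebras\<close>

definition lin_iso :: "nat \<Rightarrow> ((nat \<Rightarrow> 'k) \<Rightarrow> 'a) \<Rightarrow> 'a set \<Rightarrow> bool" where
  "lin_iso n \<iota> E \<longleftrightarrow> bij_betw \<iota> (vecs n) E \<and> (\<forall>p\<in>vecs n. \<forall>q\<in>vecs n. \<iota> (p + q) = \<iota> p \<oplus> \<iota> q) \<and>
     (\<forall>k. \<forall>p\<in>vecs n. \<iota> (scale k p) = k \<odot> \<iota> p)"

lemma lin_isoD:
  assumes "lin_iso n \<iota> E" "E \<subseteq> carrier A"
  shows "p \<in> vecs n \<Longrightarrow> \<iota> p \<in> E" "p \<in> vecs n \<Longrightarrow> \<iota> p \<in> carrier A" 
    "p \<in> vecs n \<Longrightarrow> q \<in> vecs n \<Longrightarrow> \<iota> (p + q) = \<iota> p \<oplus> \<iota> q" "p \<in> vecs n \<Longrightarrow> \<iota> (scale k p) = k \<odot> \<iota> p"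
    "\<iota> 0 = \<zero>" "p \<in> vecs n \<Longrightarrow> q \<in> vecs n \<Longrightarrow> \<iota> p = \<iota> q \<longleftrightarrow> p = q" "x \<in> E \<Longrightarrow> \<exists>p\<in>vecs n. x = \<iota> p"
    "p \<in> vecs n \<Longrightarrow> q \<in> vecs n \<Longrightarrow> \<iota> (p - q) = \<iota> p \<ominus> \<iota> q"
proof -
  note l = assms(1)[unfolded lin_iso_def]
  show c: "p \<in> vecs n \<Longrightarrow> \<iota> p \<in> E" "p \<in> vecs n \<Longrightarrow> \<iota> p \<in> carrier A" for p
    using l assms(2) by (auto simp: bij_betw_def)
  show add: "p \<in> vecs n \<Longrightarrow> q \<in> vecs n \<Longrightarrow> \<iota> (p + q) = \<iota> p \<oplus> \<iota> q" for p q using l by blast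
  show sc: "p \<in> vecs n \<Longrightarrow> \<iota> (scale k p) = k \<odot> \<iota> p" for p k using l by blast
  show "\<iota> 0 = \<zero>" using sc[of 0 0] c(2)[of 0] by (simp add: smult_rules)
  show "p \<in> vecs n \<Longrightarrow> q \<in> vecs n \<Longrightarrow> \<iota> p = \<iota> q \<longleftrightarrow> p = q" using l by (auto simp: bij_betw_def inj_on_def)
  show "x \<in> E \<Longrightarrow> \<exists>p\<in>vecs n. x = \<iota> p" using l by (auto simp: bij_betw_def)
  show "p \<in> vecs n \<Longrightarrow> q \<in> vecs n \<Longrightarrow> \<iota> (p - q) = \<iota> p \<ominus> \<iota> q"
    using add[of p "scale (-1) q"] vecs_closed(4)[of q n "-1"] sc[of q "-1"] c(2)[of q] by (simp add: smult_rules a_minus_def)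
qed

lemma line_extension_scalars:
  assumes "v \<in> carrier A" "E \<subseteq> carrier A"
  shows "line_extension (scalars A) v E = {c \<odot> v \<oplus> e | c e. e \<in> E}"
proof -
  have "(c \<odot> \<one>) \<otimes> v = c \<odot> v" for c using assms(1) by (simp add: smult_rules)
  then have "u \<in> line_extension (scalars A) v E \<longleftrightarrow> (\<exists>c. \<exists>e\<in>E. u = c \<odot> v \<oplus> e)" for u
    unfolding scalars_def line_extension_mem_iff by simp
  then show ?thesis by blast
qed

text \<open>
  The library builds a space of dimension \<open>n\<close> by adding one line after the other,
  and each step provides one more coordinate.
\<close>

lemma dimension_imp_lin_iso:
  assumes "dimension n (scalars A) E"
  shows "E \<subseteq> carrier A \<and> (\<exists>\<iota>. lin_iso n \<iota> E)"
  using assms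
proof (induction n "scalars A" E rule: dimension.induct)
  case zero_dim
  have "vecs 0 = {0 :: nat \<Rightarrow> 'k}" by (auto simp: vecs_def fun_eq_iff vec_apply)
  then have "lin_iso 0 (\<lambda>_. \<zero>) {\<zero>}" by (simp add: lin_iso_def bij_betw_def smult_rules)
  then show ?case by auto
next
  case (Suc_dim v E n)
  then obtain \<iota> where \<iota>: "lin_iso n \<iota> E" and E: "E \<subseteq> carrier A" by blast
  note l = lin_isoD[OF \<iota> E]
  note le = line_extension_scalars[OF Suc_dim(1) E]
  have v: "v \<in> carrier A" by fact
  define \<iota>' where "\<iota>' p = p n \<odot> v \<oplus> \<iota> (trunc n p)" for p
  have tr: "trunc n (p + q) = trunc n p + trunc n q" "trunc n (scale k p) = scale k (trunc n p)" for p q :: "nat \<Rightarrow> 'k" and k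
    by (auto simp: trunc_def fun_eq_iff vec_apply)
  have "bij_betw \<iota>' (vecs (Suc n)) (line_extension (scalars A) v E)"
    unfolding bij_betw_def
  proof
    show "inj_on \<iota>' (vecs (Suc n))"
    proof (rule inj_onI)
      fix p q :: "nat \<Rightarrow> 'k" assume pq: "p \<in> vecs (Suc n)" "q \<in> vecs (Suc n)" "\<iota>' p = \<iota>' q"
      have car: "\<iota> (trunc n p) \<in> carrier A" for p by (rule l(2), rule trunc_simps)
      have pn: "p n = q n"
      proof (rule ccontr)
        assume ne: "p n \<noteq> q n"
        have "p n \<odot> v \<ominus> q n \<odot> v = \<iota> (trunc n q) \<ominus> \<iota> (trunc n p)"
        proof -
          have "p n \<odot> v = q n \<odot> v \<oplus> \<iota> (trunc n q) \<ominus> \<iota> (trunc n p)"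
            using pq(3) car[of p] car[of q] v unfolding \<iota>'_def
            by (metis smult_rules(1) add.inv_solve_right' a_minus_def a_closed)
          moreover have "x = y \<oplus> b \<ominus> c \<Longrightarrow> x \<ominus> y = b \<ominus> c"
            if "x \<in> carrier A" "y \<in> carrier A" "b \<in> carrier A" "c \<in> carrier A" for x y b c
            using that by algebra
          ultimately show ?thesis using car[of p] car[of q] v smult_rules(1) by blast
        qed
        also have "\<dots> = \<iota> (trunc n q - trunc n p)" by (simp add: l(8) trunc_simps)
        also have "p n \<odot> v \<ominus> q n \<odot> v = (p n - q n) \<odot> v"
          using smult_rules(2)[OF v, of "p n" "- q n"] smult_rules(4)[OF v, of "-1" "q n"] smult_rules(10)[of "q n \<odot> v"]
            smult_rules(1)[OF v] by (simp add: a_minus_def)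
        finally have "(p n - q n) \<odot> v = \<iota> (trunc n q - trunc n p)" .
        then have "(1 / (p n - q n)) \<odot> ((p n - q n) \<odot> v) = \<iota> (scale (1 / (p n - q n)) (trunc n q - trunc n p))"
          by (simp add: l(4) trunc_simps)
        then have "v = \<iota> (scale (1 / (p n - q n)) (trunc n q - trunc n p))"
          using ne smult_rules(4)[OF v, symmetric] by (simp add: smult_rules v)
        moreover have "\<iota> (scale (1 / (p n - q n)) (trunc n q - trunc n p)) \<in> E"
          by (intro l(1) vecs_closed trunc_simps)
        ultimately show False using Suc_dim(2) by simp
      qed
      then have "\<iota> (trunc n p) = \<iota> (trunc n q)"
        using pq(3) car[of p] car[of q] smult_rules(1)[OF v] unfolding \<iota>'_def by (metis add.l_cancel)
      then have "trunc n p = trunc n q" using l(6) trunc_simps(1) by blast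
      then have tt: "trunc n p i = trunc n q i" for i by simp
      show "p = q"
      proof
        fix i show "p i = q i"
          using tt[of i] pn vecsD[OF pq(1), of i] vecsD[OF pq(2), of i]
          by (cases i n rule: linorder_cases) (auto simp: trunc_def)
      qed
    qed
    show "\<iota>' ` vecs (Suc n) = line_extension (scalars A) v E"
      unfolding le
    proof (intro equalityI subsetI)
      fix x assume "x \<in> \<iota>' ` vecs (Suc n)"
      then obtain p where "x = p n \<odot> v \<oplus> \<iota> (trunc n p)" by (auto simp: \<iota>'_def)
      then show "x \<in> {c \<odot> v \<oplus> e |c e. e \<in> E}" using l(1)[OF trunc_simps(1)] by blast
    next
      fix x assume "x \<in> {c \<odot> v \<oplus> e |c e. e \<in> E}"
      then obtain c p where p: "p \<in> vecs n" "x = c \<odot> v \<oplus> \<iota> p" using l(7) by blast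
      have "trunc n (p(n := c)) = p" using p(1) by (auto simp: trunc_def vecs_def fun_eq_iff)
      then have "x = \<iota>' (p(n := c))" using p by (simp add: \<iota>'_def)
      moreover have "p(n := c) \<in> vecs (Suc n)" using p(1) by (auto simp: vecs_def)
      ultimately show "x \<in> \<iota>' ` vecs (Suc n)" by blast
    qed
  qed
  moreover have "\<iota>' (p + q) = \<iota>' p \<oplus> \<iota>' q" for p q
    using v l(2)[OF trunc_simps(1)] smult_rules(1)[OF v]
    by (simp add: \<iota>'_def tr l(3) trunc_simps vec_apply smult_rules a_ac)
  moreover have "\<iota>' (scale k p) = k \<odot> \<iota>' p" for k p
    using v l(2)[OF trunc_simps(1)] smult_rules(1)[OF v]
    by (simp add: \<iota>'_def tr l(4) trunc_simps vec_apply smult_rules)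
  ultimately have "lin_iso (Suc n) \<iota>' (line_extension (scalars A) v E)" by (simp add: lin_iso_def)
  moreover have "line_extension (scalars A) v E \<subseteq> carrier A" unfolding le using v E by (auto simp: smult_rules)
  ultimately show ?case by blast
qed

lemma lin_iso_imp_dimension:
  assumes \<iota>: "lin_iso n \<iota> E" and E: "E \<subseteq> carrier A"
  shows "dimension n (scalars A) E"
proof -
  note l = lin_isoD[OF \<iota> E]
  have "dimension k (scalars A) (\<iota> ` vecs k)" if "k \<le> n" for k
    using that
  proof (induction k)
    case 0
    have "vecs 0 = {0 :: nat \<Rightarrow> 'k}" by (auto simp: vecs_def fun_eq_iff vec_apply)
    then show ?case by (simp add: l(5) dimension.zero_dim)
  next
    case (Suc k)
    have mono: "p \<in> vecs n" if "p \<in> vecs k" for p :: "nat \<Rightarrow> 'k" using vecs_mono[OF that] Suc by simp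
    have bv: "basis_vec k \<in> vecs n" using Suc by simp
    have sub: "\<iota> ` vecs k \<subseteq> carrier A" using l(2) mono by blast
    have ni: "\<iota> (basis_vec k) \<notin> \<iota> ` vecs k"
    proof
      assume "\<iota> (basis_vec k) \<in> \<iota> ` vecs k"
      then obtain p where p: "p \<in> vecs k" "\<iota> (basis_vec k) = \<iota> p" by (elim imageE)
      have "basis_vec k = p" using l(6)[OF bv mono[OF p(1)]] p(2) by simp
      then have "basis_vec k k = (0 :: 'k)" using vecsD[OF p(1) order_refl] by simp
      then show False by (simp add: basis_vec_def)
    qed
    have "\<iota> ` vecs (Suc k) = line_extension (scalars A) (\<iota> (basis_vec k)) (\<iota> ` vecs k)"
      unfolding line_extension_scalars[OF l(2)[OF bv] sub]
    proof (intro equalityI subsetI)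
      fix x assume "x \<in> \<iota> ` vecs (Suc k)"
      then obtain p where p: "p \<in> vecs (Suc k)" "x = \<iota> p" by blast
      have "p = scale (p k) (basis_vec k) + trunc k p"
        using p(1) by (auto simp: trunc_def vecs_def fun_eq_iff vec_apply basis_vec_def not_less_eq_eq)
      then have "x = \<iota> (scale (p k) (basis_vec k) + trunc k p)" using p by simp
      also have "\<dots> = p k \<odot> \<iota> (basis_vec k) \<oplus> \<iota> (trunc k p)"
        by (simp only: l(3)[OF vecs_closed(4)[OF bv] mono[OF trunc_simps(1)]] l(4)[OF bv])
      finally show "x \<in> {c \<odot> \<iota> (basis_vec k) \<oplus> e |c e. e \<in> \<iota> ` vecs k}" using trunc_simps(1) by blast
    next
      fix x assume "x \<in> {c \<odot> \<iota> (basis_vec k) \<oplus> e |c e. e \<in> \<iota> ` vecs k}"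
      then obtain c p where p: "p \<in> vecs k" "x = c \<odot> \<iota> (basis_vec k) \<oplus> \<iota> p" by blast
      then have "x = \<iota> (scale c (basis_vec k) + p)"
        by (simp only: l(3)[OF vecs_closed(4)[OF bv] mono[OF p(1)]] l(4)[OF bv])
      moreover have "scale c (basis_vec k) + p \<in> vecs (Suc k)" using vecs_mono[OF p(1)] by (intro vecs_closed) auto
      ultimately show "x \<in> \<iota> ` vecs (Suc k)" by blast
    qed
    then show ?case using dimension.Suc_dim[OF l(2)[OF bv] ni] Suc by simp
  qed
  moreover have "\<iota> ` vecs n = E" using \<iota> by (simp add: lin_iso_def bij_betw_def)
  ultimately show ?thesis by blast
qed

lemma has_kdim_iff: "E \<subseteq> carrier A \<Longrightarrow> has_kdim A E n \<longleftrightarrow> (\<exists>\<iota>. lin_iso n \<iota> E)"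
  unfolding has_kdim_def using dimension_imp_lin_iso lin_iso_imp_dimension by blast

lemma presentation_exists:
  assumes "has_kdim A (carrier A) d"
  obtains S \<iota> where "is_algebra d S" "presents d S A \<iota>"
proof -
  obtain \<iota> where \<iota>: "lin_iso d \<iota> (carrier A)" using assms has_kdim_iff by blast
  note l = lin_isoD[OF \<iota> subset_refl]
  define coord where "coord x = (SOME p. p \<in> vecs d \<and> x = \<iota> p)" for x
  have coord: "coord x \<in> vecs d" "\<iota> (coord x) = x" if "x \<in> carrier A" for x
  proof -
    from l(7)[OF that] obtain p where "p \<in> vecs d \<and> x = \<iota> p" by blast
    then have "coord x \<in> vecs d \<and> x = \<iota> (coord x)" unfolding coord_def
      by (rule someI[of "\<lambda>p. p \<in> vecs d \<and> x = \<iota> p"])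
    then show "coord x \<in> vecs d" "\<iota> (coord x) = x" by auto
  qed
  define m where "m p q = coord (\<iota> p \<otimes> \<iota> q)" for p q
  have m: "m p q \<in> vecs d" "\<iota> (m p q) = \<iota> p \<otimes> \<iota> q" if "p \<in> vecs d" "q \<in> vecs d" for p q
    using coord[of "\<iota> p \<otimes> \<iota> q"] l(2) that by (simp_all add: m_def)
  have sm: "smul d (consts_of m) p q = m p q" if "p \<in> vecs d" "q \<in> vecs d" for p q
  proof (rule smul_consts_of)
    show "m (p + p') q = m p q + m p' q" if "p \<in> vecs d" "p' \<in> vecs d" "q \<in> vecs d" for p p' q
      using that m l(2) by (subst l(6)[symmetric]) (simp_all add: l(3) l_distr)
    show "m p (q + q') = m p q + m p q'" if "p \<in> vecs d" "q \<in> vecs d" "q' \<in> vecs d" for p q q'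
      using that m l(2) by (subst l(6)[symmetric]) (simp_all add: l(3) r_distr)
    show "m (scale k p) q = scale k (m p q)" if "p \<in> vecs d" "q \<in> vecs d" for k p q
      using that m l(2) by (subst l(6)[symmetric]) (simp_all add: l(4) smult_rules)
    show "m p (scale k q) = scale k (m p q)" if "p \<in> vecs d" "q \<in> vecs d" for k p q
      using that m l(2) by (subst l(6)[symmetric]) (simp_all add: l(4) smult_rules)
  qed (use that m in auto)
  let ?S = "(consts_of m, coord \<one>)"
  have "is_algebra d ?S"
    unfolding is_algebra_def fst_conv snd_conv
  proof (intro conjI ballI)
    show "coord \<one> \<in> vecs d" by (simp add: coord)
    show "smul d (consts_of m) (coord \<one>) p = p" if "p \<in> vecs d" for p
      using that m[of "coord \<one>" p] coord[of \<one>] l(2) by (subst l(6)[symmetric]) (simp_all add: sm)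
    show "smul d (consts_of m) p q = smul d (consts_of m) q p" if "p \<in> vecs d" "q \<in> vecs d" for p q
      using that m l(2) by (subst l(6)[symmetric]) (simp_all add: sm m_comm)
    show "smul d (consts_of m) (smul d (consts_of m) p q) r = smul d (consts_of m) p (smul d (consts_of m) q r)"
      if "p \<in> vecs d" "q \<in> vecs d" "r \<in> vecs d" for p q r
      using that m l(2) by (subst l(6)[symmetric]) (simp_all add: sm m_assoc)
  qed
  moreover have "presents d ?S A \<iota>"
    using \<iota> m coord[of \<one>] sm by (simp add: presents_def lin_iso_def)
  ultimately show thesis using that by blast
qed

lemma presents_lin_iso: "presents d S A \<iota> \<Longrightarrow> lin_iso d \<iota> (carrier A)"
  by (simp add: presents_def lin_iso_def)

lemma presents_has_kdim: "presents d S A \<iota> \<Longrightarrow> has_kdim A (carrier A) d"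
  using has_kdim_iff presents_lin_iso by blast

end

section \<open>Powers of the maximal ideal and the residue field\<close>

context k_alg
begin

lemma ideal_pow_ideal: "ideal I A \<Longrightarrow> ideal (ideal_pow A I n) A"
  by (induction n) (auto intro: oneideal ideal_prod_is_ideal)

lemma ideal_pow_Suc_subset: "ideal I A \<Longrightarrow> ideal_pow A I (Suc n) \<subseteq> ideal_pow A I n"
  using ideal_prod_inter[OF _ ideal_pow_ideal] by fastforce

lemma ideal_pow_antimono: "ideal I A \<Longrightarrow> i \<le> j \<Longrightarrow> ideal_pow A I j \<subseteq> ideal_pow A I i"
  using lift_Suc_antimono_le[of "ideal_pow A I" i j] ideal_pow_Suc_subset by blast

lemma ideal_pow_one: "ideal I A \<Longrightarrow> ideal_pow A I (Suc 0) = I"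
proof
  assume I: "ideal I A"
  show "ideal_pow A I (Suc 0) \<subseteq> I" using ideal_prod_inter[OF I oneideal] by auto
  show "I \<subseteq> ideal_pow A I (Suc 0)"
  proof
    fix x assume x: "x \<in> I"
    then have "x \<otimes> \<one> \<in> I \<cdot> carrier A" by (intro ideal_prod.prod) auto
    then show "x \<in> ideal_pow A I (Suc 0)" using ideal.Icarr[OF I x] by simp
  qed
qed

lemma ideal_pow_mult:
  assumes I: "ideal I A" and y: "y \<in> ideal_pow A I j"
  shows "x \<in> ideal_pow A I i \<Longrightarrow> x \<otimes> y \<in> ideal_pow A I (i + j)"
proof (induction i arbitrary: x)
  case 0
  then show ?case using ideal.I_l_closed[OF ideal_pow_ideal[OF I] y] by simp
next
  case (Suc i)
  have yc: "y \<in> carrier A" using ideal.Icarr[OF ideal_pow_ideal[OF I] y] .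
  have carr: "b \<in> carrier A" if "b \<in> ideal_pow A I i" for b using ideal.Icarr[OF ideal_pow_ideal[OF I] that] .
  have "x \<in> I \<cdot> ideal_pow A I i" using Suc.prems by simp
  then have "x \<in> carrier A \<and> x \<otimes> y \<in> I \<cdot> ideal_pow A I (i + j)"
  proof induction
    case (prod a b)
    have "(a \<otimes> b) \<otimes> y = a \<otimes> (b \<otimes> y)" using m_assoc[OF ideal.Icarr[OF I prod(1)] carr[OF prod(2)] yc] .
    then show ?case using ideal_prod.prod[OF prod(1) Suc.IH[OF prod(2)]] ideal.Icarr[OF I prod(1)] carr[OF prod(2)] by simp
  next
    case (sum s1 s2)
    then show ?case using ideal_prod.sum[of "s1 \<otimes> y" A I _ "s2 \<otimes> y"] yc by (simp add: l_distr)
  qed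
  then show ?case by simp
qed

lemma ideal_rules:
  assumes "ideal I A"
  shows "\<zero> \<in> I" "x \<in> I \<Longrightarrow> x \<in> carrier A" "x \<in> I \<Longrightarrow> y \<in> I \<Longrightarrow> x \<oplus> y \<in> I" "x \<in> I \<Longrightarrow> \<ominus> x \<in> I"
    "x \<in> I \<Longrightarrow> y \<in> I \<Longrightarrow> x \<ominus> y \<in> I"
    "x \<in> carrier A \<Longrightarrow> I +> x = I \<longleftrightarrow> x \<in> I" "x \<in> carrier A \<Longrightarrow> x \<in> I +> x"
    "x \<in> carrier A \<Longrightarrow> y \<in> carrier A \<Longrightarrow> (I +> x) <+> (I +> y) = I +> (x \<oplus> y)"
    "y \<in> I +> x \<longleftrightarrow> (\<exists>h\<in>I. y = h \<oplus> x)"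
    "x \<in> carrier A \<Longrightarrow> y \<in> I +> x \<Longrightarrow> I +> y = I +> x"
proof -
  interpret I: ideal I A by fact
  note s = I.is_additive_subgroup
  show "\<zero> \<in> I" by (rule additive_subgroup.zero_closed[OF s])
  show c: "x \<in> I \<Longrightarrow> x \<in> carrier A" for x by (rule I.Icarr)
  show a: "x \<in> I \<Longrightarrow> y \<in> I \<Longrightarrow> x \<oplus> y \<in> I" for x y by (rule additive_subgroup.a_closed[OF s])
  show n: "x \<in> I \<Longrightarrow> \<ominus> x \<in> I" for x by (rule additive_subgroup.a_inv_closed[OF s])
  show "x \<in> I \<Longrightarrow> y \<in> I \<Longrightarrow> x \<ominus> y \<in> I" unfolding a_minus_def by (intro a n)
  show self: "x \<in> carrier A \<Longrightarrow> x \<in> I +> x" for x by (rule I.a_rcos_self)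
  show "x \<in> carrier A \<Longrightarrow> I +> x = I \<longleftrightarrow> x \<in> I" using self[of x] I.a_rcos_const[of x] by blast
  show "x \<in> carrier A \<Longrightarrow> y \<in> carrier A \<Longrightarrow> (I +> x) <+> (I +> y) = I +> (x \<oplus> y)" by (rule I.a_rcos_sum)
  show "y \<in> I +> x \<longleftrightarrow> (\<exists>h\<in>I. y = h \<oplus> x)" by (auto simp: a_r_coset_def')
  show "x \<in> carrier A \<Longrightarrow> y \<in> I +> x \<Longrightarrow> I +> y = I +> x"
    using I.a_repr_independence'[of y x] by simp
qed

end

locale local_alg = k_alg A for A :: "('k::field, 'a) module" (structure) +
  assumes max: "maximalideal (max_ideal A) A"
begin

lemma max_ideal: "ideal (max_ideal A) A"
  using max by (rule maximalideal.axioms)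

lemmas max_pow_ideal = ideal_pow_ideal[OF max_ideal]
lemmas max_pow_mult = ideal_pow_mult[OF max_ideal]
lemmas max_pow_antimono = ideal_pow_antimono[OF max_ideal]
lemmas max_pow_one = ideal_pow_one[OF max_ideal]

lemma one_notin_max: "\<one> \<notin> max_ideal A"
  using ideal.one_imp_carrier[OF max_ideal] maximalideal.I_notcarr[OF max] by blast

lemma max_prime: "x \<in> carrier A \<Longrightarrow> y \<in> carrier A \<Longrightarrow> x \<otimes> y \<in> max_ideal A \<Longrightarrow> x \<in> max_ideal A \<or> y \<in> max_ideal A"
  using primeideal.I_prime[OF maximalideal_prime[OF max]] by blast

text \<open>
  If \<open>y\<close> were outside the maximal ideal, it would generate the unit ideal together
  with it, so \<open>1 = \<mu> + a y\<close>. Then \<open>v = \<mu> v = \<mu>\<^sup>2 v =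
  \<dots>\<close>, which is 0 since the maximal ideal is nilpotent.
\<close>

lemma annihilator_in_max:
  assumes nil: "max_pow A k = {\<zero>}" and y: "y \<in> carrier A" and v: "v \<in> carrier A" "v \<noteq> \<zero>" "y \<otimes> v = \<zero>"
  shows "y \<in> max_ideal A"
proof (rule ccontr)
  assume ny: "y \<notin> max_ideal A"
  have PI: "ideal (PIdl y) A" by (rule cgenideal_ideal[OF y])
  have "y \<in> max_ideal A <+> PIdl y"
  proof -
    have "\<zero> \<oplus> y \<in> max_ideal A <+> PIdl y"
      unfolding set_add_def' using ideal_rules(1)[OF max_ideal] cgenideal_self[OF y] by blast
    then show ?thesis using y by simp
  qed
  moreover have "max_ideal A \<subseteq> max_ideal A <+> PIdl y"
  proof
    fix x assume x: "x \<in> max_ideal A"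
    have "x \<oplus> \<zero> \<in> max_ideal A <+> PIdl y"
      unfolding set_add_def' using x ideal_rules(1)[OF PI] by blast
    then show "x \<in> max_ideal A <+> PIdl y" using ideal_rules(2)[OF max_ideal x] by simp
  qed
  moreover have id: "ideal (max_ideal A <+> PIdl y) A" by (rule add_ideals[OF max_ideal PI])
  ultimately have "max_ideal A <+> PIdl y = carrier A"
    using maximalideal.I_maximal[OF max id] ny ideal_rules(2)[OF id] by blast
  then obtain \<mu> b where \<mu>: "\<mu> \<in> max_ideal A" "b \<in> PIdl y" "\<one> = \<mu> \<oplus> b" using one_closed unfolding set_add_def' by blast
  then obtain a where a: "a \<in> carrier A" "b = a \<otimes> y" unfolding cgenideal_def by blast
  have \<mu>c: "\<mu> \<in> carrier A" by (rule ideal_rules(2)[OF max_ideal \<mu>(1)])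
  have "v = \<one> \<otimes> v" using v by simp
  also have "\<dots> = (\<mu> \<oplus> a \<otimes> y) \<otimes> v" by (simp only: \<mu>(3) a(2))
  also have "\<dots> = \<mu> \<otimes> v \<oplus> a \<otimes> (y \<otimes> v)" using \<mu>c a v y by (simp add: l_distr m_assoc)
  finally have vv: "v = \<mu> \<otimes> v" using v \<mu>c a by simp
  have "v \<in> max_pow A i" for i
  proof (induction i)
    case (Suc i)
    then have "\<mu> \<otimes> v \<in> max_ideal A \<cdot> max_pow A i" by (intro ideal_prod.prod \<mu>)
    then show ?case using vv by simp
  qed (use v in simp)
  then show False using nil v by blast
qed

end

lemma (in algebra_structure) exists_eigenvector:
  fixes x :: "nat \<Rightarrow> 'k"
  assumes ac: "\<And>p :: 'k poly. degree p > 0 \<Longrightarrow> \<exists>x. poly p x = 0" and d: "d > 0"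
  obtains c v where "v \<in> vecs d" "v \<noteq> 0" "x \<star> v = scale c v"
proof -
  define M where "M = mat d d (\<lambda>(i, j). (x \<star> basis_vec j) i)"
  have M: "M \<in> carrier_mat d d" by (simp add: M_def)
  have "degree (char_poly M) = d" using degree_monic_char_poly[OF M] by simp
  then obtain c where "poly (char_poly M) c = 0" using ac[of "char_poly M"] d by auto
  then obtain w where w: "w \<in> carrier_vec d" "w \<noteq> 0\<^sub>v d" "M *\<^sub>v w = c \<cdot>\<^sub>v w"
    using eigenvalue_root_char_poly[OF M] M unfolding eigenvalue_def eigenvector_def by auto
  define v where "v = (\<lambda>j. if j < d then w $ j else 0)"
  have v: "v \<in> vecs d" by (simp add: v_def vecs_def)
  have "v \<noteq> 0"
  proof
    assume v0: "v = 0"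
    have "w $ j = v j" if "j < d" for j using that by (simp add: v_def)
    then have "w $ j = 0" if "j < d" for j using that v0 by (simp add: vec_apply)
    then have "w = 0\<^sub>v d" using w(1) by (intro eq_vecI) auto
    then show False using w by simp
  qed
  moreover have "x \<star> v = scale c v"
  proof
    fix i
    show "(x \<star> v) i = scale c v i"
    proof (cases "i < d")
      case True
      have "x \<star> v = x \<star> (\<Sum>j<d. scale (v j) (basis_vec j))" by (simp only: vecs_expand[OF v])
      also have "\<dots> = (\<Sum>j<d. scale (v j) (x \<star> basis_vec j))" by (simp add: smul_sum_right smul_scale)
      finally have "(x \<star> v) i = (\<Sum>j<d. M $$ (i, j) * w $ j)"
        using True by (simp add: sum_fun_apply vec_apply M_def v_def mult.commute)
      also have "\<dots> = (M *\<^sub>v w) $ i" using True w(1) M by (auto simp: scalar_prod_def atLeast0LessThan)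
      also have "\<dots> = c * w $ i" using True w by simp
      finally show ?thesis using True by (simp add: vec_apply v_def)
    next
      case False
      then show ?thesis using v by (simp add: vec_apply vecs_def smul_def)
    qed
  qed
  ultimately show thesis using that v by blast
qed

locale presented_local_alg = local_alg A + S: algebra_structure d S
  for A :: "('k::{alg_closed_field, field_char_0}, 'a) module" (structure) and d and S :: "'k algebra_data" +
  fixes \<iota> :: "(nat \<Rightarrow> 'k) \<Rightarrow> 'a"
  assumes pres: "presents d S A \<iota>" and nil: "max_pow A 4 = {\<zero>}"
begin

notation S.mul (infixl "\<star>" 70)

lemmas \<iota> = lin_isoD[OF presents_lin_iso[OF pres] subset_refl]

lemma \<iota>_mult: "p \<in> vecs d \<Longrightarrow> q \<in> vecs d \<Longrightarrow> \<iota> (p \<star> q) = \<iota> p \<otimes> \<iota> q"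
  and \<iota>_one: "\<iota> (snd S) = \<one>"
  using pres by (auto simp: presents_def)

lemma \<iota>_eq_zero: "p \<in> vecs d \<Longrightarrow> \<iota> p = \<zero> \<longleftrightarrow> p = 0"
  using \<iota>(6)[of p 0] \<iota>(5) by simp

text \<open>
  Multiplication by \<open>x\<close> has an eigenvalue \<open>c\<close> with eigenvector
  \<open>v\<close>, so \<open>x - c\<close> annihilates \<open>v\<close> and belongs to the
  maximal ideal. The eigenvalue exists because the ground field is algebraically closed.
\<close>

lemma residue_field:
  assumes x: "x \<in> carrier A"
  shows "\<exists>c. x \<ominus> c \<odot> \<one> \<in> max_ideal A"
proof -
  have "d > 0"
  proof (rule ccontr)
    assume "\<not> d > 0"
    then have "snd S = 0" using S.mul_unit(1) by (auto simp: vecs_def fun_eq_iff vec_apply)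
    then have "\<one> = \<zero>" using \<iota>_one \<iota>(5) by simp
    then show False using one_notin_max ideal_rules(1)[OF max_ideal] by simp
  qed
  obtain p where p: "p \<in> vecs d" "x = \<iota> p" using \<iota>(7)[OF x] by blast
  obtain c v where v: "v \<in> vecs d" "v \<noteq> 0" "p \<star> v = scale c v"
    using S.exists_eigenvector[OF alg_closed_imp_poly_has_root \<open>d > 0\<close>, of p] by blast
  have vc: "\<iota> v \<in> carrier A" by (rule \<iota>(2)[OF v(1)])
  have "x \<otimes> \<iota> v = c \<odot> \<iota> v" using v p \<iota>_mult[OF p(1) v(1)] \<iota>(4)[OF v(1)] by simp
  then have "(x \<ominus> c \<odot> \<one>) \<otimes> \<iota> v = c \<odot> \<iota> v \<ominus> c \<odot> \<iota> v"
    using x vc smult_rules(1)[OF one_closed, of c] smult_rules(8)[OF one_closed vc, of c]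
    by (simp add: a_minus_def l_distr l_minus)
  also have "\<dots> = \<zero>" using smult_rules(1)[OF vc, of c] by (simp add: a_minus_def r_neg)
  finally have "(x \<ominus> c \<odot> \<one>) \<otimes> \<iota> v = \<zero>" .
  moreover have "x \<ominus> c \<odot> \<one> \<in> carrier A" using x smult_rules(1)[OF one_closed, of c] by simp
  ultimately have "x \<ominus> c \<odot> \<one> \<in> max_ideal A"
    using annihilator_in_max[OF nil _ vc] \<iota>_eq_zero[OF v(1)] v(2) by blast
  then show ?thesis by blast
qed

definition pre :: "'a set \<Rightarrow> (nat \<Rightarrow> 'k) set" where
  "pre I = {p \<in> vecs d. \<iota> p \<in> I}"

lemma subspace_pre: "ideal I A \<Longrightarrow> vs.subspace (pre I)"
  by (auto simp: vs.subspace_def pre_def \<iota> ideal_rules ideal_smult)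

lemma short_gorenstein:
  assumes soc: "has_kdim A (socle A) 1" and nz: "max_pow A 3 \<noteq> {\<zero>}"
  obtains \<sigma> where "short_gorenstein d S (pre (max_pow A 1)) (pre (max_pow A 2)) (pre (max_pow A 3)) \<sigma>"
proof -
  have soc_sub: "socle A \<subseteq> carrier A" by (auto simp: socle_def)
  obtain \<theta> where \<theta>: "lin_iso 1 \<theta> (socle A)" using soc has_kdim_iff[OF soc_sub] by blast
  note th = lin_isoD[OF \<theta> soc_sub]
  let ?e = "basis_vec 0 :: nat \<Rightarrow> 'k"
  have e: "?e \<in> vecs 1" by simp
  have soc_eq: "\<exists>c. x = c \<odot> \<theta> ?e" if "x \<in> socle A" for x
  proof -
    from th(7)[OF that] obtain p where p: "p \<in> vecs 1" "x = \<theta> p" by blast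
    have "scale (p 0) ?e = p" using vecs_expand[OF p(1)] by simp
    then show ?thesis using th(4)[OF e, of "p 0"] p by metis
  qed
  have P3soc: "x \<in> socle A" if "x \<in> max_pow A 3" for x
  proof -
    have "x \<otimes> y = \<zero>" if "y \<in> max_ideal A" for y
      using max_pow_mult[of y "Suc 0" x 3] that \<open>x \<in> max_pow A 3\<close> nil max_pow_one by simp
    then show ?thesis using ideal_rules(2)[OF max_pow_ideal that] by (simp add: socle_def)
  qed
  obtain x where x: "x \<in> max_pow A 3" "x \<noteq> \<zero>" using nz ideal_rules(1)[OF max_pow_ideal] by blast
  obtain c where c: "x = c \<odot> \<theta> ?e" using soc_eq[OF P3soc[OF x(1)]] by blast
  have te: "\<theta> ?e \<in> carrier A" by (rule th(2)[OF e])
  have c0: "c \<noteq> 0" using c x te by (auto simp: smult_rules)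
  have "(1 / c) \<odot> x = \<theta> ?e" using c0 te unfolding c by (simp add: smult_rules flip: smult_rules(4))
  then have te3: "\<theta> ?e \<in> max_pow A 3" using ideal_smult[OF max_pow_ideal x(1)] by metis
  obtain \<sigma> where \<sigma>: "\<sigma> \<in> vecs d" "\<theta> ?e = \<iota> \<sigma>" using \<iota>(7)[OF te] by blast
  have pm: "p \<star> q \<in> pre (max_pow A k)" if "p \<in> pre (max_pow A i)" "q \<in> pre (max_pow A j)" "k = i + j" for p q i j k
    using max_pow_mult[of "\<iota> q" j "\<iota> p" i] that by (simp add: pre_def \<iota>_mult)
  have pre4: "p = 0" if "p \<in> pre (max_pow A 4)" for p using that \<iota>_eq_zero nil by (auto simp: pre_def)
  have mono: "pre (max_pow A i) \<subseteq> pre (max_pow A j)" if "j \<le> i" for i j using max_pow_antimono[OF that] by (auto simp: pre_def)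
  have P0: "p \<in> pre (max_pow A 0)" if "p \<in> vecs d" for p using that \<iota>(2) by (simp add: pre_def)
  show thesis
  proof (rule that[of \<sigma>], unfold_locales)
    show "vs.subspace (pre (max_pow A 1))" "vs.subspace (pre (max_pow A 2))" by (rule subspace_pre, rule max_pow_ideal)+
    show "pre (max_pow A 1) \<subseteq> vecs d" by (auto simp: pre_def)
    show "pre (max_pow A 2) \<subseteq> pre (max_pow A 1)" "pre (max_pow A 3) \<subseteq> pre (max_pow A 2)" by (rule mono, simp)+
    show "x \<star> y \<in> pre (max_pow A 2)" if "x \<in> vecs d" "y \<in> pre (max_pow A 2)" for x y by (rule pm[OF P0[OF that(1)] that(2)]) simp
    show "x \<star> y \<in> pre (max_pow A 2)" if "x \<in> pre (max_pow A 1)" "y \<in> pre (max_pow A 1)" for x y by (rule pm[OF that]) simp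
    show "x \<star> y \<in> pre (max_pow A 3)" if "x \<in> pre (max_pow A 1)" "y \<in> pre (max_pow A 2)" for x y by (rule pm[OF that]) simp
    show "x \<star> y = 0" if "x \<in> pre (max_pow A 1)" "y \<in> pre (max_pow A 3)" for x y by (rule pre4, rule pm[OF that]) simp
    show "x \<star> y = 0" if "x \<in> pre (max_pow A 2)" "y \<in> pre (max_pow A 2)" for x y by (rule pre4, rule pm[OF that]) simp
    show "\<exists>k. x - scale k (snd S) \<in> pre (max_pow A 1)" if x: "x \<in> vecs d" for x
    proof -
      obtain k where "\<iota> x \<ominus> k \<odot> \<one> \<in> max_ideal A" using residue_field[OF \<iota>(2)[OF x]] by blast
      then have "\<iota> (x - scale k (snd S)) \<in> max_ideal A"
        using x S.mul_unit(1) by (simp add: \<iota>(8) \<iota>(4) \<iota>_one)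
      then show ?thesis using x S.mul_unit(1) max_pow_one by (auto simp: pre_def)
    qed
    show "snd S \<notin> pre (max_pow A 1)" using one_notin_max max_pow_one by (simp add: pre_def \<iota>_one)
    show "\<sigma> \<in> pre (max_pow A 3)" using \<sigma> te3 by (simp add: pre_def)
    have "\<theta> ?e \<noteq> \<zero>" using c x by (auto simp: smult_rules)
    then show "\<sigma> \<noteq> 0" using \<sigma> \<iota>(5) by auto
    show "\<exists>k. x = scale k \<sigma>" if x: "x \<in> vecs d" and 0: "\<And>y. y \<in> pre (max_pow A 1) \<Longrightarrow> x \<star> y = 0" for x
    proof -
      have "\<iota> x \<otimes> y = \<zero>" if y: "y \<in> max_ideal A" for y
      proof -
        obtain q where q: "q \<in> vecs d" "y = \<iota> q" using \<iota>(7)[OF ideal_rules(2)[OF max_ideal y]] by blast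
        then have "x \<star> q = 0" using 0 y max_pow_one by (simp add: pre_def)
        then show ?thesis using \<iota>_mult[OF x q(1)] \<iota>(5) q by simp
      qed
      then have "\<iota> x \<in> socle A" using \<iota>(2)[OF x] by (simp add: socle_def)
      then obtain k where "\<iota> x = k \<odot> \<iota> \<sigma>" using soc_eq \<sigma> by metis
      then have "\<iota> x = \<iota> (scale k \<sigma>)" using \<iota>(4)[OF \<sigma>(1)] by simp
      then show ?thesis using \<iota>(6)[OF x vecs_closed(4)[OF \<sigma>(1)]] by blast
    qed
  qed
qed

end

declare ideal_pow.simps(2) [simp del]

section \<open>The associated graded algebra and its Gorenstein quotient\<close>

lemma (in k_alg) smult_coset:
  assumes I: "ideal I A" and x: "x \<in> carrier A"
  shows "(\<Union>y\<in>I +> x. I +> (c \<odot> y)) = I +> (c \<odot> x)"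
proof -
  have "I +> (c \<odot> y) = I +> (c \<odot> x)" if y: "y \<in> I +> x" for y
  proof -
    obtain h where h: "h \<in> I" "y = h \<oplus> x" using y ideal_rules(9)[OF I] by blast
    have "c \<odot> y = c \<odot> h \<oplus> c \<odot> x" using h ideal_rules(2)[OF I] x by (simp add: smult_rules)
    then have "c \<odot> y \<in> I +> (c \<odot> x)" using ideal_smult[OF I h(1)] ideal_rules(9)[OF I] by blast
    then show ?thesis using ideal_rules(10)[OF I smult_rules(1)[OF x]] by blast
  qed
  then show ?thesis using ideal_rules(7)[OF I x] by blast
qed

lemma gr_simps:
  "carrier (gr_algebra A) = {f. (\<forall>i. f i \<in> gr_piece A i) \<and> finite {i. f i \<noteq> max_pow A (Suc i)}}"
  "f \<otimes>\<^bsub>gr_algebra A\<^esub> g = (\<lambda>n. finsum (A Quot max_pow A (Suc n)) (\<lambda>i. gr_times A i (n - i) (f i) (g (n - i))) {..n})"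
  "\<one>\<^bsub>gr_algebra A\<^esub> = (\<lambda>i. if i = 0 then max_pow A 1 +>\<^bsub>A\<^esub> \<one>\<^bsub>A\<^esub> else max_pow A (Suc i))"
  "\<zero>\<^bsub>gr_algebra A\<^esub> = (\<lambda>i. max_pow A (Suc i))"
  "f \<oplus>\<^bsub>gr_algebra A\<^esub> g = (\<lambda>i. f i <+>\<^bsub>A\<^esub> g i)"
  "c \<odot>\<^bsub>gr_algebra A\<^esub> f = (\<lambda>i. \<Union>x\<in>f i. max_pow A (Suc i) +>\<^bsub>A\<^esub> (c \<odot>\<^bsub>A\<^esub> x))"
  by (simp_all add: gr_algebra_def)

lemma alg_quot_simps:
  "carrier (alg_quot G C) = a_rcosets\<^bsub>G\<^esub> C" "U \<otimes>\<^bsub>alg_quot G C\<^esub> V = rcoset_mult G C U V"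
  "\<one>\<^bsub>alg_quot G C\<^esub> = C +>\<^bsub>G\<^esub> \<one>\<^bsub>G\<^esub>" "\<zero>\<^bsub>alg_quot G C\<^esub> = C" "U \<oplus>\<^bsub>alg_quot G C\<^esub> V = U <+>\<^bsub>G\<^esub> V"
  "c \<odot>\<^bsub>alg_quot G C\<^esub> U = (\<Union>x\<in>U. C +>\<^bsub>G\<^esub> (c \<odot>\<^bsub>G\<^esub> x))"
  by (simp_all add: alg_quot_def FactRing_def)

context local_alg
begin

abbreviation P :: "nat \<Rightarrow> 'a set" where "P \<equiv> max_pow A"

lemmas P_rules = ideal_rules[OF max_pow_ideal]

text \<open>
  The symbol of \<open>x \<in> m\<^sup>i\<close> in the associated graded algebra.
\<close>

definition symb :: "nat \<Rightarrow> 'a \<Rightarrow> nat \<Rightarrow> 'a set" where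
  "symb i x = (\<lambda>k. P (Suc k) +> (if k = i then x else \<zero>))"

lemma coset_zero: "P i +> \<zero> = P i"
  using P_rules(1,6) by simp

lemma symb_carrier: "x \<in> P i \<Longrightarrow> symb i x \<in> carrier (gr_algebra A)"
  unfolding gr_simps
proof (intro CollectI conjI allI)
  assume x: "x \<in> P i"
  show "symb i x k \<in> gr_piece A k" for k
    unfolding symb_def gr_piece_def using x P_rules(1) by (intro imageI) auto
  have "{k. symb i x k \<noteq> P (Suc k)} \<subseteq> {i}" by (auto simp: symb_def coset_zero)
  then show "finite {k. symb i x k \<noteq> P (Suc k)}" by (rule finite_subset) simp
qed

lemma symb_add: "x \<in> P i \<Longrightarrow> y \<in> P i \<Longrightarrow> symb i x \<oplus>\<^bsub>gr_algebra A\<^esub> symb i y = symb i (x \<oplus> y)"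
  unfolding gr_simps symb_def by (rule ext) (simp add: P_rules)

lemma symb_zero: "x \<in> P (Suc i) \<Longrightarrow> symb i x = \<zero>\<^bsub>gr_algebra A\<^esub>"
  unfolding gr_simps symb_def by (rule ext) (simp add: P_rules)

lemma symb_one: "\<one>\<^bsub>gr_algebra A\<^esub> = symb 0 \<one>"
  unfolding gr_simps symb_def by (rule ext) (simp add: coset_zero)

lemma symb_smult: "x \<in> P i \<Longrightarrow> c \<odot>\<^bsub>gr_algebra A\<^esub> symb i x = symb i (c \<odot> x)"
  unfolding gr_simps symb_def
proof (rule ext)
  fix k assume x: "x \<in> P i"
  have "(if k = i then x else \<zero>) \<in> carrier A" using P_rules(2)[OF x] by simp
  from smult_coset[OF max_pow_ideal this] show "(\<Union>y\<in>P (Suc k) +> (if k = i then x else \<zero>). P (Suc k) +> c \<odot> y) = P (Suc k) +> (if k = i then c \<odot> x else \<zero>)"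
    by (simp add: smult_rules if_distrib[of "\<lambda>x. c \<odot> x"] cong: if_cong)
qed

lemma gr_times_coset:
  assumes x: "x \<in> P i" and y: "y \<in> P j"
  shows "gr_times A i j (P (Suc i) +> x) (P (Suc j) +> y) = P (Suc (i + j)) +> (x \<otimes> y)"
proof -
  have xc: "x \<in> carrier A" "y \<in> carrier A" using P_rules(2) x y by auto
  have const: "P (Suc (i + j)) +> (u \<otimes> v) = P (Suc (i + j)) +> (x \<otimes> y)"
    if u: "u \<in> P (Suc i) +> x" and v: "v \<in> P (Suc j) +> y" for u v
  proof -
    obtain h where h: "h \<in> P (Suc i)" "u = h \<oplus> x" using u P_rules(9) by blast
    obtain k where k: "k \<in> P (Suc j)" "v = k \<oplus> y" using v P_rules(9) by blast
    have hc: "h \<in> carrier A" "k \<in> carrier A" using P_rules(2) h k by auto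
    have k': "k \<in> P j" using k max_pow_antimono[of j "Suc j"] by auto
    have "(h \<otimes> k \<oplus> h \<otimes> y) \<oplus> x \<otimes> k \<in> P (Suc (i + j))"
      using max_pow_mult[OF k' h(1)] max_pow_mult[OF y h(1)] max_pow_mult[OF k(1) x] by (intro P_rules(3)) auto
    moreover have "u \<otimes> v = ((h \<otimes> k \<oplus> h \<otimes> y) \<oplus> x \<otimes> k) \<oplus> x \<otimes> y"
      unfolding h(2) k(2) using xc hc by algebra
    ultimately have "u \<otimes> v \<in> P (Suc (i + j)) +> (x \<otimes> y)" using P_rules(9) by blast
    then show ?thesis using P_rules(10)[of "x \<otimes> y"] xc by blast
  qed
  have "gr_times A i j (P (Suc i) +> x) (P (Suc j) +> y) =
      (\<Union>u\<in>P (Suc i) +> x. \<Union>v\<in>P (Suc j) +> y. P (Suc (i + j)) +> (x \<otimes> y))"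
    unfolding gr_times_def by (intro SUP_cong refl const)
  moreover have "P (Suc i) +> x \<noteq> {}" "P (Suc j) +> y \<noteq> {}"
    using P_rules(7)[OF xc(1)] P_rules(7)[OF xc(2)] by (metis empty_iff)+
  ultimately show ?thesis by simp
qed

lemma symb_mult:
  assumes x: "x \<in> P i" and y: "y \<in> P j"
  shows "symb i x \<otimes>\<^bsub>gr_algebra A\<^esub> symb j y = symb (i + j) (x \<otimes> y)"
  unfolding gr_simps
proof (rule ext)
  fix n
  interpret I: ideal "P (Suc n)" A by (rule max_pow_ideal)
  interpret Qn: ring "A Quot P (Suc n)" by (rule I.quotient_is_ring)
  have xc: "x \<in> carrier A" "y \<in> carrier A" using P_rules(2) x y by auto
  have zero: "\<zero>\<^bsub>A Quot P (Suc n)\<^esub> = P (Suc n)" by (simp add: FactRing_def)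
  have car: "P (Suc n) +> u \<in> carrier (A Quot P (Suc n))" if "u \<in> carrier A" for u
    using that by (auto simp: FactRing_def A_RCOSETS_def')
  have cxy: "P (Suc n) +> (x \<otimes> y) \<in> carrier (A Quot P (Suc n))" by (rule car) (simp add: xc)
  define F where "F = (\<lambda>k. gr_times A k (n - k) (symb i x k) (symb j y (n - k)))"
  have F: "F k = P (Suc n) +> ((if k = i then x else \<zero>) \<otimes> (if n - k = j then y else \<zero>))" if "k \<le> n" for k
  proof -
    have "(if k = i then x else \<zero>) \<in> P k" "(if n - k = j then y else \<zero>) \<in> P (n - k)" using x y P_rules(1) by auto
    from gr_times_coset[OF this] show ?thesis using that by (simp add: F_def symb_def)
  qed
  have "finsum (A Quot P (Suc n)) F {..n} = symb (i + j) (x \<otimes> y) n"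
  proof (cases "n = i + j")
    case True
    have F': "F k = (if i = k then (\<lambda>_. P (Suc n) +> (x \<otimes> y)) k else \<zero>\<^bsub>A Quot P (Suc n)\<^esub>)" if "k \<le> n" for k
      unfolding F[OF that] zero using True xc that by (cases "i = k") (auto simp: coset_zero)
    have "finsum (A Quot P (Suc n)) F {..n} =
        finsum (A Quot P (Suc n)) (\<lambda>k. if i = k then (\<lambda>_. P (Suc n) +> (x \<otimes> y)) k else \<zero>\<^bsub>A Quot P (Suc n)\<^esub>) {..n}"
      by (rule Qn.finsum_cong') (use cxy F' in auto)
    also have "\<dots> = P (Suc n) +> (x \<otimes> y)"
      by (rule Qn.finsum_singleton) (use True cxy in auto)
    finally show ?thesis using True by (simp add: symb_def)
  next
    case False
    have F': "F k = \<zero>\<^bsub>A Quot P (Suc n)\<^esub>" if "k \<le> n" for k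
      unfolding F[OF that] zero using False xc that by (auto simp: coset_zero)
    have "finsum (A Quot P (Suc n)) F {..n} = finsum (A Quot P (Suc n)) (\<lambda>k. \<zero>\<^bsub>A Quot P (Suc n)\<^esub>) {..n}"
      by (rule Qn.finsum_cong') (use F' in auto)
    also have "\<dots> = \<zero>\<^bsub>A Quot P (Suc n)\<^esub>" by simp
    finally show ?thesis using False by (simp add: symb_def zero coset_zero)
  qed
  then show "finsum (A Quot P (Suc n)) (\<lambda>k. gr_times A k (n - k) (symb i x k) (symb j y (n - k))) {..n} = symb (i + j) (x \<otimes> y) n"
    unfolding F_def .
qed

end

lemma artinian_local_imp_local_alg: "artinian_local A \<Longrightarrow> local_alg A"
  unfolding artinian_local_def local_alg_def local_alg_axioms_def k_alg_def max_ideal_def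
  using theI'[of "\<lambda>m. maximalideal m A"] by blast

text \<open>
  \<open>D\<close> is the graded Gorenstein quotient \<open>Q(0)\<close> of the associated
  graded algebra.
\<close>

locale gr_quotient = local_alg A for A :: "('k::field, 'a) module" (structure) +
  fixes C :: "(nat \<Rightarrow> 'a set) set" and D
  assumes D_def: "D = alg_quot (gr_algebra A) C" and hom: "homogeneous_ideal A C" and D_gor: "artinian_gorenstein_local D"
    and D_deg: "has_socle_degree D 3"
    and nil: "P 4 = {\<zero>}" and res: "x \<in> carrier A \<Longrightarrow> \<exists>c. x \<ominus> c \<odot> \<one> \<in> max_ideal A"
begin

sublocale C: ideal C "gr_algebra A"
  using hom by (simp add: homogeneous_ideal_def)

sublocale D: local_alg D
  using D_gor unfolding artinian_gorenstein_local_def by (blast intro: artinian_local_imp_local_alg)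

lemmas D_simps = alg_quot_simps[of "gr_algebra A" C, folded D_def]

text \<open>
  The class of the symbol of \<open>x\<close> in \<open>Q(0)\<close>.
\<close>

definition \<kappa> :: "nat \<Rightarrow> 'a \<Rightarrow> (nat \<Rightarrow> 'a set) set" where
  "\<kappa> i x = C +>\<^bsub>gr_algebra A\<^esub> symb i x"

lemma coset_in_D: "f \<in> carrier (gr_algebra A) \<Longrightarrow> C +>\<^bsub>gr_algebra A\<^esub> f \<in> carrier D"
  by (auto simp: D_simps A_RCOSETS_def')

lemma kappa_carrier: "x \<in> P i \<Longrightarrow> \<kappa> i x \<in> carrier D"
  unfolding \<kappa>_def by (intro coset_in_D symb_carrier)

lemma kappa_add: "x \<in> P i \<Longrightarrow> y \<in> P i \<Longrightarrow> \<kappa> i (x \<oplus> y) = \<kappa> i x \<oplus>\<^bsub>D\<^esub> \<kappa> i y"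
  unfolding \<kappa>_def D_simps by (simp add: symb_carrier symb_add C.a_rcos_sum)

lemma kappa_mult: "x \<in> P i \<Longrightarrow> y \<in> P j \<Longrightarrow> \<kappa> i x \<otimes>\<^bsub>D\<^esub> \<kappa> j y = \<kappa> (i + j) (x \<otimes> y)"
  unfolding \<kappa>_def D_simps by (simp add: symb_carrier symb_mult C.rcoset_mult_add)

lemma kappa_one: "\<one>\<^bsub>D\<^esub> = \<kappa> 0 \<one>"
  unfolding \<kappa>_def D_simps symb_one ..

lemma coset_eq_C: "f \<in> C \<Longrightarrow> C +>\<^bsub>gr_algebra A\<^esub> f = C"
  by (rule C.a_rcos_const)

lemma kappa_zero: "x \<in> P (Suc i) \<Longrightarrow> \<kappa> i x = \<zero>\<^bsub>D\<^esub>"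
  unfolding \<kappa>_def D_simps using additive_subgroup.zero_closed[OF C.is_additive_subgroup]
  by (simp add: symb_zero coset_eq_C)

text \<open>
  Scalar multiplication on the quotient is defined as a union of cosets. The result is a coset
  because the quotient is an algebra, and a coset that contains another one is equal to it.
\<close>

lemma kappa_smult:
  assumes x: "x \<in> P i"
  shows "\<kappa> i (c \<odot> x) = c \<odot>\<^bsub>D\<^esub> \<kappa> i x"
proof -
  have cx: "c \<odot> x \<in> P i" by (rule ideal_smult[OF max_pow_ideal x])
  have "c \<odot>\<^bsub>D\<^esub> \<kappa> i x \<in> carrier D" by (rule D.smult_rules(1)[OF kappa_carrier[OF x]])
  then obtain g where g: "g \<in> carrier (gr_algebra A)" "c \<odot>\<^bsub>D\<^esub> \<kappa> i x = C +>\<^bsub>gr_algebra A\<^esub> g"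
    by (auto simp: D_simps A_RCOSETS_def')
  have "symb i x \<in> \<kappa> i x" unfolding \<kappa>_def by (rule C.a_rcos_self[OF symb_carrier[OF x]])
  then have "C +>\<^bsub>gr_algebra A\<^esub> (c \<odot>\<^bsub>gr_algebra A\<^esub> symb i x) \<subseteq> c \<odot>\<^bsub>D\<^esub> \<kappa> i x" unfolding D_simps by blast
  then have "\<kappa> i (c \<odot> x) \<subseteq> C +>\<^bsub>gr_algebra A\<^esub> g" using g(2) by (simp add: symb_smult[OF x] \<kappa>_def)
  moreover have "symb i (c \<odot> x) \<in> \<kappa> i (c \<odot> x)" unfolding \<kappa>_def by (rule C.a_rcos_self[OF symb_carrier[OF cx]])
  ultimately have "symb i (c \<odot> x) \<in> C +>\<^bsub>gr_algebra A\<^esub> g" by blast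
  then have "C +>\<^bsub>gr_algebra A\<^esub> g = \<kappa> i (c \<odot> x)" unfolding \<kappa>_def
    using C.a_repr_independence'[OF _ g(1)] by blast
  then show ?thesis using g by simp
qed

lemma kappa_high: "x \<in> P i \<Longrightarrow> 4 \<le> i \<Longrightarrow> \<kappa> i x = \<zero>\<^bsub>D\<^esub>"
  using max_pow_antimono[of 4 i] nil P_rules(1) by (intro kappa_zero) auto

lemma D_decomp:
  assumes "y \<in> carrier D"
  obtains x0 x1 x2 x3 where "x0 \<in> P 0" "x1 \<in> P 1" "x2 \<in> P 2" "x3 \<in> P 3"
    "y = \<kappa> 0 x0 \<oplus>\<^bsub>D\<^esub> \<kappa> 1 x1 \<oplus>\<^bsub>D\<^esub> \<kappa> 2 x2 \<oplus>\<^bsub>D\<^esub> \<kappa> 3 x3"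
proof -
  obtain f where f: "f \<in> carrier (gr_algebra A)" "y = C +>\<^bsub>gr_algebra A\<^esub> f"
    using assms by (auto simp: D_simps A_RCOSETS_def')
  have "\<exists>x\<in>P j. f j = P (Suc j) +> x" for j using f(1) unfolding gr_simps gr_piece_def by blast
  then obtain x where x: "\<And>j. x j \<in> P j" "\<And>j. f j = P (Suc j) +> x j" by metis
  have xc: "x j \<in> carrier A" for j using x(1) P_rules(2) by blast
  have high: "x j = \<zero>" if "j \<ge> 4" for j using x(1)[of j] max_pow_antimono[OF that] nil by auto
  let ?G = "gr_algebra A"
  note s = symb_carrier[OF x(1)]
  have "f = symb 0 (x 0) \<oplus>\<^bsub>?G\<^esub> symb 1 (x 1) \<oplus>\<^bsub>?G\<^esub> symb 2 (x 2) \<oplus>\<^bsub>?G\<^esub> symb 3 (x 3)"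
  proof
    fix j
    have "(symb 0 (x 0) \<oplus>\<^bsub>?G\<^esub> symb 1 (x 1) \<oplus>\<^bsub>?G\<^esub> symb 2 (x 2) \<oplus>\<^bsub>?G\<^esub> symb 3 (x 3)) j =
      P (Suc j) +> ((if j = 0 then x 0 else \<zero>) \<oplus> (if j = 1 then x 1 else \<zero>) \<oplus> (if j = 2 then x 2 else \<zero>) \<oplus> (if j = 3 then x 3 else \<zero>))"
      unfolding gr_simps symb_def using xc by (simp add: P_rules(8))
    also have "(if j = 0 then x 0 else \<zero>) \<oplus> (if j = 1 then x 1 else \<zero>) \<oplus> (if j = 2 then x 2 else \<zero>) \<oplus> (if j = 3 then x 3 else \<zero>) = x j"
      using xc high[of j] by (cases "j \<ge> 4") (auto simp: not_le less_Suc_eq numeral_eq_Suc)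
    finally show "f j = (symb 0 (x 0) \<oplus>\<^bsub>?G\<^esub> symb 1 (x 1) \<oplus>\<^bsub>?G\<^esub> symb 2 (x 2) \<oplus>\<^bsub>?G\<^esub> symb 3 (x 3)) j"
      using x(2) by simp
  qed
  then have "y = \<kappa> 0 (x 0) \<oplus>\<^bsub>D\<^esub> \<kappa> 1 (x 1) \<oplus>\<^bsub>D\<^esub> \<kappa> 2 (x 2) \<oplus>\<^bsub>D\<^esub> \<kappa> 3 (x 3)"
    unfolding f(2) \<kappa>_def D_simps by (simp add: C.a_rcos_sum s)
  then show thesis using that x(1) by blast
qed

text \<open>
  Classes of positive degree are nilpotent, hence contained in the prime ideal \<open>max_ideal
  D\<close>.
\<close>

lemma kappa_max:
  assumes x: "x \<in> P i" and i: "i > 0"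
  shows "\<kappa> i x \<in> max_ideal D"
proof -
  have xx: "x \<otimes> x \<in> P (i + i)" by (rule max_pow_mult[OF x x])
  have "\<kappa> (i + i) (x \<otimes> x) \<otimes>\<^bsub>D\<^esub> \<kappa> (i + i) (x \<otimes> x) = \<kappa> ((i + i) + (i + i)) ((x \<otimes> x) \<otimes> (x \<otimes> x))"
    by (rule kappa_mult[OF xx xx])
  also have "\<dots> = \<zero>\<^bsub>D\<^esub>" using max_pow_mult[OF xx xx] i by (intro kappa_high) auto
  also have "\<zero>\<^bsub>D\<^esub> \<in> max_ideal D" by (rule D.ideal_rules(1)[OF D.max_ideal])
  finally have "\<kappa> (i + i) (x \<otimes> x) \<in> max_ideal D"
    using D.max_prime kappa_carrier[OF xx] by blast
  then show ?thesis using D.max_prime kappa_carrier[OF x] kappa_mult[OF x x] by metis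
qed

lemma kappa_0_scalar:
  assumes x0: "x0 \<in> P 0"
  obtains c where "\<kappa> 0 x0 = c \<odot>\<^bsub>D\<^esub> \<one>\<^bsub>D\<^esub>"
proof -
  have x0c: "x0 \<in> carrier A" by (rule P_rules(2)[OF x0])
  obtain c where c: "x0 \<ominus> c \<odot> \<one> \<in> max_ideal A" using res[OF x0c] by blast
  have cc: "c \<odot> \<one> \<in> carrier A" by (simp add: smult_rules)
  have "x0 = (x0 \<ominus> c \<odot> \<one>) \<oplus> c \<odot> \<one>" using x0c cc by algebra
  then have "\<kappa> 0 x0 = \<kappa> 0 (x0 \<ominus> c \<odot> \<one>) \<oplus>\<^bsub>D\<^esub> \<kappa> 0 (c \<odot> \<one>)"
    using kappa_add[of "x0 \<ominus> c \<odot> \<one>" 0 "c \<odot> \<one>"] x0c cc by simp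
  also have "\<kappa> 0 (x0 \<ominus> c \<odot> \<one>) = \<zero>\<^bsub>D\<^esub>" using c max_pow_one by (intro kappa_zero) simp
  also have "\<kappa> 0 (c \<odot> \<one>) = c \<odot>\<^bsub>D\<^esub> \<one>\<^bsub>D\<^esub>" using kappa_smult[of \<one> 0 c] by (simp add: kappa_one)
  finally have "\<kappa> 0 x0 = c \<odot>\<^bsub>D\<^esub> \<one>\<^bsub>D\<^esub>" by (simp add: D.smult_rules)
  then show thesis by (rule that)
qed

text \<open>
  An element with nonzero component in degree 0 is a nonzero scalar plus an element of the
  maximal ideal, so it is not in the maximal ideal itself.
\<close>

lemma max_D_decomp:
  assumes "y \<in> max_ideal D"
  obtains x1 x2 x3 where "x1 \<in> P 1" "x2 \<in> P 2" "x3 \<in> P 3" "y = \<kappa> 1 x1 \<oplus>\<^bsub>D\<^esub> \<kappa> 2 x2 \<oplus>\<^bsub>D\<^esub> \<kappa> 3 x3"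
proof -
  have yc: "y \<in> carrier D" by (rule D.ideal_rules(2)[OF D.max_ideal assms])
  obtain x0 x1 x2 x3 where x: "x0 \<in> P 0" "x1 \<in> P 1" "x2 \<in> P 2" "x3 \<in> P 3"
    and y: "y = \<kappa> 0 x0 \<oplus>\<^bsub>D\<^esub> \<kappa> 1 x1 \<oplus>\<^bsub>D\<^esub> \<kappa> 2 x2 \<oplus>\<^bsub>D\<^esub> \<kappa> 3 x3" using D_decomp[OF yc] by blast
  obtain c where k0: "\<kappa> 0 x0 = c \<odot>\<^bsub>D\<^esub> \<one>\<^bsub>D\<^esub>" by (rule kappa_0_scalar[OF x(1)])
  note kc = kappa_carrier[OF x(1)] kappa_carrier[OF x(2)] kappa_carrier[OF x(3)] kappa_carrier[OF x(4)]
  let ?t = "\<kappa> 1 x1 \<oplus>\<^bsub>D\<^esub> \<kappa> 2 x2 \<oplus>\<^bsub>D\<^esub> \<kappa> 3 x3"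
  have t: "?t \<in> max_ideal D" by (intro D.ideal_rules(3)[OF D.max_ideal] kappa_max x) auto
  have yt: "y = \<kappa> 0 x0 \<oplus>\<^bsub>D\<^esub> ?t" unfolding y using kc by (simp add: D.a_assoc)
  have tc: "?t \<in> carrier D" by (rule D.ideal_rules(2)[OF D.max_ideal t])
  have "y \<ominus>\<^bsub>D\<^esub> ?t \<in> max_ideal D" by (rule D.ideal_rules(5)[OF D.max_ideal assms t])
  also have "y \<ominus>\<^bsub>D\<^esub> ?t = \<kappa> 0 x0" unfolding yt using kc(1) tc by (simp add: D.minus_eq D.a_assoc D.r_neg)
  finally have "c \<odot>\<^bsub>D\<^esub> \<one>\<^bsub>D\<^esub> \<in> max_ideal D" using k0 by simp
  then have "(1 / c) \<odot>\<^bsub>D\<^esub> (c \<odot>\<^bsub>D\<^esub> \<one>\<^bsub>D\<^esub>) \<in> max_ideal D" by (rule D.ideal_smult[OF D.max_ideal])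
  then have "c = 0" using D.one_notin_max by (cases "c = 0") (auto simp: D.smult_rules simp flip: D.smult_rules(4))
  then have "y = ?t" using yt k0 tc by (simp add: D.smult_rules)
  then show thesis using that x by blast
qed

text \<open>
  Otherwise the cube of the maximal ideal of \<open>D\<close>, which consists of classes of
  degree 3, would vanish, contrary to the socle degree.
\<close>

lemma kappa3_nonzero: "\<exists>w\<in>P 3. \<kappa> 3 w \<noteq> \<zero>\<^bsub>D\<^esub>"
proof (rule ccontr)
  assume "\<not> (\<exists>w\<in>P 3. \<kappa> 3 w \<noteq> \<zero>\<^bsub>D\<^esub>)"
  then have k3: "\<kappa> 3 w = \<zero>\<^bsub>D\<^esub>" if "w \<in> P 3" for w using that by blast
  have m1: "\<exists>x\<in>P 1. \<exists>x'\<in>P 2. y = \<kappa> 1 x \<oplus>\<^bsub>D\<^esub> \<kappa> 2 x'" if y: "y \<in> max_ideal D" for y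
  proof -
    obtain x1 x2 x3 where x: "x1 \<in> P 1" "x2 \<in> P 2" "x3 \<in> P 3" "y = \<kappa> 1 x1 \<oplus>\<^bsub>D\<^esub> \<kappa> 2 x2 \<oplus>\<^bsub>D\<^esub> \<kappa> 3 x3"
      using max_D_decomp[OF y] by blast
    have "y = \<kappa> 1 x1 \<oplus>\<^bsub>D\<^esub> \<kappa> 2 x2"
      unfolding x(4) k3[OF x(3)] using kappa_carrier[OF x(1)] kappa_carrier[OF x(2)] by simp
    then show ?thesis using x by blast
  qed
  have m2: "\<exists>x\<in>P 2. y = \<kappa> 2 x" if y: "y \<in> max_ideal D \<cdot>\<^bsub>D\<^esub> max_ideal D" for y
    using y
  proof induction
    case (prod a b)
    obtain x x' where x: "x \<in> P 1" "x' \<in> P 2" "a = \<kappa> 1 x \<oplus>\<^bsub>D\<^esub> \<kappa> 2 x'" using m1[OF prod(1)] by blast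
    obtain z z' where z: "z \<in> P 1" "z' \<in> P 2" "b = \<kappa> 1 z \<oplus>\<^bsub>D\<^esub> \<kappa> 2 z'" using m1[OF prod(2)] by blast
    note c = kappa_carrier[OF x(1)] kappa_carrier[OF x(2)] kappa_carrier[OF z(1)] kappa_carrier[OF z(2)]
    have e: "\<kappa> 1 x \<otimes>\<^bsub>D\<^esub> \<kappa> 1 z = \<kappa> 2 (x \<otimes> z)" "\<kappa> 1 x \<otimes>\<^bsub>D\<^esub> \<kappa> 2 z' = \<zero>\<^bsub>D\<^esub>"
      "\<kappa> 2 x' \<otimes>\<^bsub>D\<^esub> \<kappa> 1 z = \<zero>\<^bsub>D\<^esub>" "\<kappa> 2 x' \<otimes>\<^bsub>D\<^esub> \<kappa> 2 z' = \<zero>\<^bsub>D\<^esub>"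
      using kappa_mult[OF x(1) z(1)] kappa_mult[OF x(1) z(2)] kappa_mult[OF x(2) z(1)] kappa_mult[OF x(2) z(2)]
        k3 max_pow_mult[OF z(2) x(1)] max_pow_mult[OF z(1) x(2)] kappa_high[OF max_pow_mult[OF z(2) x(2)]]
      by (simp_all add: numeral_eq_Suc)
    have xz: "x \<otimes> z \<in> P 2" using max_pow_mult[OF z(1) x(1)] by (simp add: numeral_eq_Suc)
    have "a \<otimes>\<^bsub>D\<^esub> b = \<kappa> 2 (x \<otimes> z)"
      unfolding x(3) z(3) using c kappa_carrier[OF xz] by (simp add: D.l_distr D.r_distr e del: One_nat_def)
    then show ?case using xz by blast
  next
    case (sum a b)
    then show ?case using kappa_add P_rules(3) by metis
  qed
  have "y = \<zero>\<^bsub>D\<^esub>" if y: "y \<in> max_ideal D \<cdot>\<^bsub>D\<^esub> (max_ideal D \<cdot>\<^bsub>D\<^esub> max_ideal D)" for y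
    using y
  proof induction
    case (prod a b)
    obtain x x' where x: "x \<in> P 1" "x' \<in> P 2" "a = \<kappa> 1 x \<oplus>\<^bsub>D\<^esub> \<kappa> 2 x'" using m1[OF prod(1)] by blast
    obtain z where z: "z \<in> P 2" "b = \<kappa> 2 z" using m2[OF prod(2)] by blast
    note c = kappa_carrier[OF x(1)] kappa_carrier[OF x(2)] kappa_carrier[OF z(1)]
    have "\<kappa> 1 x \<otimes>\<^bsub>D\<^esub> \<kappa> 2 z = \<zero>\<^bsub>D\<^esub>" "\<kappa> 2 x' \<otimes>\<^bsub>D\<^esub> \<kappa> 2 z = \<zero>\<^bsub>D\<^esub>"
      using kappa_mult[OF x(1) z(1)] kappa_mult[OF x(2) z(1)] k3 max_pow_mult[OF z(1) x(1)] kappa_high[OF max_pow_mult[OF z(1) x(2)]]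
      by (simp_all add: numeral_eq_Suc)
    then show ?case unfolding x(3) z(2) using c by (simp add: D.l_distr)
  qed simp
  moreover have "max_pow D 3 = max_ideal D \<cdot>\<^bsub>D\<^esub> (max_ideal D \<cdot>\<^bsub>D\<^esub> max_ideal D)"
    using D.max_pow_one by (simp add: numeral_3_eq_3 ideal_pow.simps(2))
  ultimately have "max_pow D 3 \<subseteq> {\<zero>\<^bsub>D\<^esub>}" by blast
  then have "max_pow D 3 = {\<zero>\<^bsub>D\<^esub>}" using D.P_rules(1) by blast
  then show False using D_deg by (simp add: has_socle_degree_def)
qed

text \<open>
  The class of \<open>z\<close> lies in the socle of \<open>D\<close>, which is spanned by a
  nonzero class \<open>\<kappa> 3 w\<close>. Hence the symbol of \<open>z\<close> plus a
  multiple of the symbol of \<open>w\<close> lies in \<open>C\<close>; as \<open>C\<close> is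
  homogeneous, so does its component of degree 1, the symbol of \<open>z\<close>.
\<close>

lemma kappa1_zero:
  assumes z: "z \<in> P 1" and z2: "\<And>y. y \<in> P 2 \<Longrightarrow> z \<otimes> y = \<zero>" and z1: "\<And>y. y \<in> P 1 \<Longrightarrow> z \<otimes> y \<in> P 3"
  shows "\<kappa> 1 z = \<zero>\<^bsub>D\<^esub>"
proof -
  have soc_sub: "socle D \<subseteq> carrier D" by (auto simp: socle_def)
  have "has_kdim D (socle D) 1" using D_gor by (simp add: artinian_gorenstein_local_def)
  then obtain \<theta> where \<theta>: "D.lin_iso 1 \<theta> (socle D)" using D.has_kdim_iff[OF soc_sub] by blast
  note th = D.lin_isoD[OF \<theta> soc_sub]
  obtain w where w: "w \<in> P 3" "\<kappa> 3 w \<noteq> \<zero>\<^bsub>D\<^esub>" using kappa3_nonzero by blast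
  have Pm: "a \<otimes> b \<in> P k" if "a \<in> P i" "b \<in> P j" "k = i + j" for a b i j k
    using max_pow_mult[OF that(2,1)] that(3) by simp
  have "\<kappa> 3 w \<in> socle D"
    unfolding socle_def
  proof (intro CollectI conjI ballI kappa_carrier w)
    fix y assume "y \<in> max_ideal D"
    then obtain x1 x2 x3 where x: "x1 \<in> P 1" "x2 \<in> P 2" "x3 \<in> P 3" "y = \<kappa> 1 x1 \<oplus>\<^bsub>D\<^esub> \<kappa> 2 x2 \<oplus>\<^bsub>D\<^esub> \<kappa> 3 x3"
      by (rule max_D_decomp)
    have "\<kappa> 3 w \<otimes>\<^bsub>D\<^esub> \<kappa> j x = \<zero>\<^bsub>D\<^esub>" if "x \<in> P j" "j > 0" for j x
      unfolding kappa_mult[OF w(1) that(1)] by (rule kappa_high[OF Pm[OF w(1) that(1)]]) (use that in auto)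
    then show "\<kappa> 3 w \<otimes>\<^bsub>D\<^esub> y = \<zero>\<^bsub>D\<^esub>"
      using x kappa_carrier[OF x(1)] kappa_carrier[OF x(2)] kappa_carrier[OF x(3)] kappa_carrier[OF w(1)]
      by (simp add: D.r_distr)
  qed
  then obtain p where p: "p \<in> vecs 1" "\<kappa> 3 w = \<theta> p" using th(7) by blast
  have "\<kappa> 1 z \<in> socle D"
    unfolding socle_def
  proof (intro CollectI conjI ballI kappa_carrier z)
    fix y assume "y \<in> max_ideal D"
    then obtain x1 x2 x3 where x: "x1 \<in> P 1" "x2 \<in> P 2" "x3 \<in> P 3" "y = \<kappa> 1 x1 \<oplus>\<^bsub>D\<^esub> \<kappa> 2 x2 \<oplus>\<^bsub>D\<^esub> \<kappa> 3 x3"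
      by (rule max_D_decomp)
    have "\<kappa> 1 z \<otimes>\<^bsub>D\<^esub> \<kappa> 1 x1 = \<zero>\<^bsub>D\<^esub>"
      unfolding kappa_mult[OF z x(1)] using z1[OF x(1)] by (intro kappa_zero) (simp add: numeral_eq_Suc)
    moreover have "\<kappa> 1 z \<otimes>\<^bsub>D\<^esub> \<kappa> 2 x2 = \<zero>\<^bsub>D\<^esub>"
      unfolding kappa_mult[OF z x(2)] z2[OF x(2)] by (intro kappa_zero P_rules)
    moreover have "\<kappa> 1 z \<otimes>\<^bsub>D\<^esub> \<kappa> 3 x3 = \<zero>\<^bsub>D\<^esub>"
      unfolding kappa_mult[OF z x(3)] by (rule kappa_high[OF Pm[OF z x(3)]]) auto
    ultimately show "\<kappa> 1 z \<otimes>\<^bsub>D\<^esub> y = \<zero>\<^bsub>D\<^esub>"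
      using x kappa_carrier[OF x(1)] kappa_carrier[OF x(2)] kappa_carrier[OF x(3)] kappa_carrier[OF z]
      by (simp add: D.r_distr)
  qed
  then obtain q where q: "q \<in> vecs 1" "\<kappa> 1 z = \<theta> q" using th(7) by blast
  have p0: "p 0 \<noteq> 0"
  proof
    assume "p 0 = 0"
    then have "p = 0" using vecs_expand[OF p(1)] by simp
    then show False using w(2) p(2) th(5) by simp
  qed
  let ?c = "- (q 0 / p 0)"
  have "q + scale ?c p = 0"
  proof
    fix i show "(q + scale ?c p) i = 0 i"
      using p0 vecsD[OF p(1), of i] vecsD[OF q(1), of i] by (cases i) (simp_all add: vec_apply)
  qed
  then have qp: "\<theta> (q + scale ?c p) = \<zero>\<^bsub>D\<^esub>" by (simp only: th(5))
  have "\<kappa> 1 z \<oplus>\<^bsub>D\<^esub> \<kappa> 3 (?c \<odot> w) = \<theta> q \<oplus>\<^bsub>D\<^esub> ?c \<odot>\<^bsub>D\<^esub> \<theta> p"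
    unfolding q(2) kappa_smult[OF w(1)] p(2) ..
  also have "\<dots> = \<theta> (q + scale ?c p)"
    by (simp only: th(3)[OF q(1) vecs_closed(4)[OF p(1)]] th(4)[OF p(1)])
  finally have sum0: "\<kappa> 1 z \<oplus>\<^bsub>D\<^esub> \<kappa> 3 (?c \<odot> w) = \<zero>\<^bsub>D\<^esub>" using qp by (rule trans)
  define w' where "w' = ?c \<odot> w"
  have w': "w' \<in> P 3" unfolding w'_def by (rule ideal_smult[OF max_pow_ideal w(1)])
  have f: "symb 1 z \<oplus>\<^bsub>gr_algebra A\<^esub> symb 3 w' \<in> carrier (gr_algebra A)"
    by (rule C.a_closed[OF symb_carrier[OF z] symb_carrier[OF w']])
  have "C +>\<^bsub>gr_algebra A\<^esub> (symb 1 z \<oplus>\<^bsub>gr_algebra A\<^esub> symb 3 w') = C"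
    using sum0 unfolding w'_def[symmetric] \<kappa>_def D_simps C.a_rcos_sum[OF symb_carrier[OF z] symb_carrier[OF w']] .
  then have inC: "symb 1 z \<oplus>\<^bsub>gr_algebra A\<^esub> symb 3 w' \<in> C" using C.a_rcos_self[OF f] by simp
  have zc: "z \<in> carrier A" by (rule P_rules(2)[OF z])
  have add0: "(P k +> z) <+> P k = P k +> z" for k
    using P_rules(8)[OF zc zero_closed, of k] zc by (simp add: coset_zero)
  have "(\<lambda>j. if j = 1 then (symb 1 z \<oplus>\<^bsub>gr_algebra A\<^esub> symb 3 w') 1 else P (Suc j)) \<in> C"
    using hom inC unfolding homogeneous_ideal_def by blast
  also have "(\<lambda>j. if j = 1 then (symb 1 z \<oplus>\<^bsub>gr_algebra A\<^esub> symb 3 w') 1 else P (Suc j)) = symb 1 z"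
    unfolding gr_simps symb_def by (rule ext) (simp add: coset_zero add0)
  finally have "symb 1 z \<in> C" .
  then show ?thesis unfolding \<kappa>_def D_simps by (rule coset_eq_C)
qed

end

section \<open>Smoothability from the graded quotient\<close>

lemma presents_isomorphic:
  assumes D: "k_algebra D" and iso: "alg_isomorphic D Q" and pres: "presents e T Q \<iota>" and alg: "is_algebra e T"
  obtains \<iota>' where "presents e T D \<iota>'"
proof -
  obtain \<chi> where \<chi>: "\<chi> \<in> alg_hom D Q" "bij_betw \<chi> (carrier D) (carrier Q)"
    using iso unfolding alg_isomorphic_def by blast
  interpret D: k_alg D using D by (simp add: k_alg_def)
  note h = \<chi>(1)[unfolded alg_hom_def Ring.ring_hom_def]
  define g where "g = inv_into (carrier D) \<chi>"
  have g: "g y \<in> carrier D" "\<chi> (g y) = y" if "y \<in> carrier Q" for y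
    using that \<chi>(2) unfolding g_def bij_betw_def by (auto intro: inv_into_into f_inv_into_f)
  have gx: "x = g y" if "x \<in> carrier D" "\<chi> x = y" for x y
    using that \<chi>(2) unfolding g_def bij_betw_def by (metis inv_into_f_f)
  note p = pres[unfolded presents_def]
  have ic: "\<iota> v \<in> carrier Q" if "v \<in> vecs e" for v using p that by (auto simp: bij_betw_def)
  have sm: "smul e (fst T) v w \<in> vecs e" for v w by simp
  have "presents e T D (\<lambda>v. g (\<iota> v))"
    unfolding presents_def
  proof (intro conjI ballI allI)
    have "bij_betw g (carrier Q) (carrier D)" unfolding g_def by (rule bij_betw_inv_into[OF \<chi>(2)])
    moreover have "bij_betw \<iota> (vecs e) (carrier Q)" using p by blast
    ultimately show "bij_betw (\<lambda>v. g (\<iota> v)) (vecs e) (carrier D)"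
      using bij_betw_trans[of \<iota> "vecs e" "carrier Q" g "carrier D"] by (simp add: comp_def)
    show "snd T \<in> vecs e" using p by blast
    have "\<chi> \<one>\<^bsub>D\<^esub> = \<one>\<^bsub>Q\<^esub>" using h by blast
    then show "g (\<iota> (snd T)) = \<one>\<^bsub>D\<^esub>" using p gx[OF D.one_closed] by simp
    fix v :: "nat \<Rightarrow> 'a" assume v: "v \<in> vecs e"
    show "g (\<iota> (scale k v)) = k \<odot>\<^bsub>D\<^esub> g (\<iota> v)" for k
    proof (rule gx[symmetric, OF D.smult_rules(1)[OF g(1)[OF ic[OF v]]]])
      have "\<chi> (k \<odot>\<^bsub>D\<^esub> g (\<iota> v)) = k \<odot>\<^bsub>Q\<^esub> \<chi> (g (\<iota> v))" using h g(1)[OF ic[OF v]] by blast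
      then show "\<chi> (k \<odot>\<^bsub>D\<^esub> g (\<iota> v)) = \<iota> (scale k v)" using p v g(2)[OF ic[OF v]] by simp
    qed
    fix w :: "nat \<Rightarrow> 'a" assume w: "w \<in> vecs e"
    show "g (\<iota> (v + w)) = g (\<iota> v) \<oplus>\<^bsub>D\<^esub> g (\<iota> w)"
    proof (rule gx[symmetric, OF D.a_closed[OF g(1)[OF ic[OF v]] g(1)[OF ic[OF w]]]])
      have "\<chi> (g (\<iota> v) \<oplus>\<^bsub>D\<^esub> g (\<iota> w)) = \<chi> (g (\<iota> v)) \<oplus>\<^bsub>Q\<^esub> \<chi> (g (\<iota> w))"
        using h g(1)[OF ic[OF v]] g(1)[OF ic[OF w]] by blast
      then show "\<chi> (g (\<iota> v) \<oplus>\<^bsub>D\<^esub> g (\<iota> w)) = \<iota> (v + w)"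
        using p v w g(2)[OF ic[OF v]] g(2)[OF ic[OF w]] by simp
    qed
    show "g (\<iota> (smul e (fst T) v w)) = g (\<iota> v) \<otimes>\<^bsub>D\<^esub> g (\<iota> w)"
    proof (rule gx[symmetric, OF D.m_closed[OF g(1)[OF ic[OF v]] g(1)[OF ic[OF w]]]])
      have "\<chi> (g (\<iota> v) \<otimes>\<^bsub>D\<^esub> g (\<iota> w)) = \<chi> (g (\<iota> v)) \<otimes>\<^bsub>Q\<^esub> \<chi> (g (\<iota> w))"
        using h g(1)[OF ic[OF v]] g(1)[OF ic[OF w]] by blast
      then show "\<chi> (g (\<iota> v) \<otimes>\<^bsub>D\<^esub> g (\<iota> w)) = \<iota> (smul e (fst T) v w)"
        using p v w g(2)[OF ic[OF v]] g(2)[OF ic[OF w]] by simp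
    qed
  qed
  then show thesis using that by blast
qed

lemma ring_alg_quot:
  assumes "ideal I A"
  shows "ring (alg_quot A I)"
proof -
  interpret ideal I A by fact
  interpret Q: ring "A Quot I" by (rule quotient_is_ring)
  have eq: "carrier (alg_quot A I) = carrier (A Quot I)" "(\<otimes>\<^bsub>alg_quot A I\<^esub>) = (\<otimes>\<^bsub>A Quot I\<^esub>)"
    "\<one>\<^bsub>alg_quot A I\<^esub> = \<one>\<^bsub>A Quot I\<^esub>" "\<zero>\<^bsub>alg_quot A I\<^esub> = \<zero>\<^bsub>A Quot I\<^esub>" "(\<oplus>\<^bsub>alg_quot A I\<^esub>) = (\<oplus>\<^bsub>A Quot I\<^esub>)"
    by (simp_all add: alg_quot_def)
  show ?thesis
  proof (rule ringI)
    show "abelian_group (alg_quot A I)"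
    proof (rule abelian_groupI)
      show "\<exists>y\<in>carrier (alg_quot A I). y \<oplus>\<^bsub>alg_quot A I\<^esub> x = \<zero>\<^bsub>alg_quot A I\<^esub>" if "x \<in> carrier (alg_quot A I)" for x
        using that Q.l_neg[of x] Q.a_inv_closed[of x] unfolding eq by blast
    qed (simp_all add: eq Q.a_ac)
    show "monoid (alg_quot A I)"
      by (rule monoidI) (simp_all add: eq Q.m_assoc)
  qed (simp_all add: eq Q.l_distr Q.r_distr)
qed

lemma has_kdim_zero:
  assumes "ring A" "has_kdim A V 0"
  shows "V = {\<zero>\<^bsub>A\<^esub>}"
  using assms(2) unfolding has_kdim_def by (cases rule: ring.dimension.cases[OF assms(1)]) auto

lemma has_kdim_one:
  assumes "ring A" "\<one>\<^bsub>A\<^esub> \<in> scalars A" "has_kdim A V 1"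
  shows "V \<noteq> {\<zero>\<^bsub>A\<^esub>}"
proof -
  interpret ring A by fact
  obtain v E where v: "v \<in> carrier A" "v \<notin> E" "dimension 0 (scalars A) E" "V = line_extension (scalars A) v E"
    using assms(3) unfolding has_kdim_def by (cases rule: dimension.cases) auto
  have E: "E = {\<zero>\<^bsub>A\<^esub>}" using v(3) by (cases rule: dimension.cases) auto
  have "v = \<one>\<^bsub>A\<^esub> \<otimes>\<^bsub>A\<^esub> v \<oplus>\<^bsub>A\<^esub> \<zero>\<^bsub>A\<^esub>" using v(1) by simp
  then have "v \<in> V" unfolding v(4) line_extension_mem_iff using assms(2) E by blast
  then show ?thesis using v(2) E by blast
qed

context local_alg
begin

lemma hilbert_function_jump:
  assumes "has_hilbert_function A H"
  shows "H i = 1 \<Longrightarrow> \<not> P i \<subseteq> P (Suc i)" and "H i = 0 \<Longrightarrow> P i \<subseteq> P (Suc i)"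
proof -
  let ?Q = "alg_quot A (P (Suc i))"
  have dim: "has_kdim ?Q (gr_piece A i) (H i)" using assms by (simp add: has_hilbert_function_def)
  have ring: "ring ?Q" by (rule ring_alg_quot[OF max_pow_ideal])
  have zero: "\<zero>\<^bsub>?Q\<^esub> = P (Suc i)" by (simp add: alg_quot_simps)
  have "1 \<odot>\<^bsub>?Q\<^esub> \<one>\<^bsub>?Q\<^esub> = \<one>\<^bsub>?Q\<^esub>"
    unfolding alg_quot_simps smult_coset[OF max_pow_ideal one_closed] by (simp add: smult_rules)
  then have one: "\<one>\<^bsub>?Q\<^esub> \<in> scalars ?Q" unfolding scalars_def by (metis rangeI)
  have coset: "P (Suc i) +> x = P (Suc i) \<longleftrightarrow> x \<in> P (Suc i)" if "x \<in> P i" for x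
    using P_rules(6) P_rules(2)[OF that] by blast
  show "P i \<subseteq> P (Suc i)" if "H i = 0"
  proof
    fix x assume x: "x \<in> P i"
    have "gr_piece A i = {P (Suc i)}" using has_kdim_zero[OF ring] dim that zero by simp
    then show "x \<in> P (Suc i)" using coset[OF x] x unfolding gr_piece_def by blast
  qed
  show "\<not> P i \<subseteq> P (Suc i)" if "H i = 1"
  proof
    assume "P i \<subseteq> P (Suc i)"
    then have "gr_piece A i = {P (Suc i)}"
      unfolding gr_piece_def using coset P_rules(1)[of i] by blast
    then show False using has_kdim_one[OF ring one, of "gr_piece A i"] dim that zero by simp
  qed
qed

text \<open>
  \<open>H 4 = 0\<close> means \<open>m\<^sup>4 = m\<^sup>5\<close>, so all higher powers agree
  with \<open>m\<^sup>4\<close> and the socle degree is less than 4; it is at least 3 because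
  \<open>m\<^sup>3 \<noteq> m\<^sup>4\<close>.
\<close>

lemma socle_degree_three:
  assumes H: "has_hilbert_function A H" "H 3 = 1" "H 4 = 0" and s: "has_socle_degree A s"
  shows "s = 3"
proof -
  have nz: "P s \<noteq> {\<zero>}" and z: "P (Suc s) = {\<zero>}" using s by (auto simp: has_socle_degree_def)
  have 3: "\<not> P 3 \<subseteq> P 4" using hilbert_function_jump(1)[OF H(1), of 3] H(2) by simp
  have 4: "P 4 = P (Suc 4)"
    by (rule equalityI[OF hilbert_function_jump(2)[OF H(1), of 4] max_pow_antimono]) (simp_all add: H(3))
  have stable: "P (4 + k) = P 4" for k
  proof (induction k)
    case (Suc k)
    have "P (4 + Suc k) = max_ideal A \<cdot> P (4 + k)" by (simp only: add_Suc_right ideal_pow.simps(2))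
    also have "\<dots> = P (Suc 4)" by (simp only: Suc ideal_pow.simps(2))
    finally show ?case using 4 by (rule trans[OF _ sym])
  qed simp
  have "s < 4"
  proof (rule ccontr)
    assume "\<not> s < 4"
    then have "P s = P 4" "P (Suc s) = P 4" using stable[of "s - 4"] stable[of "Suc s - 4"] by auto
    then show False using nz z by simp
  qed
  moreover have "\<not> s < 3"
  proof
    assume "s < 3"
    then have "P 3 \<subseteq> P (Suc s)" by (intro max_pow_antimono) simp
    moreover have "P (Suc s) \<subseteq> P 4" using z P_rules(1)[of 4] by simp
    ultimately show False using 3 by (meson subset_trans)
  qed
  ultimately show ?thesis by simp
qed

end

text \<open>
  The maps \<open>\<kappa> i\<close>, written in coordinates, satisfy the hypotheses of the
  comparison, which then realizes \<open>A\<close> as a limit of reduced algebras.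
\<close>

lemma comparison_limit:
  fixes A :: "('k::{alg_closed_field, field_char_0}, 'a) module"
  assumes pl: "presented_local_alg A d S \<iota>" and gq: "gr_quotient A C D"
    and soc: "has_kdim A (socle A) 1" and nz: "max_pow A 3 \<noteq> {\<zero>\<^bsub>A\<^esub>}"
    and T: "is_algebra e T" "presents e T D \<iota>D" "limit_of_reduced e T"
  obtains n T' \<iota>' where "is_algebra n T'" "presents n T' A \<iota>'" "limit_of_reduced n T'"
proof -
  interpret presented_local_alg A d S \<iota> by (rule pl)
  interpret gr: gr_quotient A C D by (rule gq)
  obtain \<sigma> where sg: "short_gorenstein d S (pre (max_pow A 1)) (pre (max_pow A 2)) (pre (max_pow A 3)) \<sigma>"
    by (rule short_gorenstein[OF soc nz])
  interpret G: short_gorenstein d S "pre (max_pow A 1)" "pre (max_pow A 2)" "pre (max_pow A 3)" \<sigma> by (rule sg)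
  interpret T: algebra_structure e T by unfold_locales (rule T)
  note iD = gr.D.lin_isoD[OF gr.D.presents_lin_iso[OF T(2)] subset_refl]
  have iD_mult: "\<iota>D (smul e (fst T) p q) = \<iota>D p \<otimes>\<^bsub>D\<^esub> \<iota>D q" if "p \<in> vecs e" "q \<in> vecs e" for p q
    using T(2) that by (simp add: presents_def)
  have iD_one: "\<iota>D (snd T) = \<one>\<^bsub>D\<^esub>" using T(2) by (simp add: presents_def)
  define kk where "kk i p = (SOME q. q \<in> vecs e \<and> \<iota>D q = gr.\<kappa> i (\<iota> p))" for i p
  have preD: "p \<in> vecs d" "\<iota> p \<in> max_pow A i" if "p \<in> pre (max_pow A i)" for p i
    using that by (auto simp: pre_def)
  have kk: "kk i p \<in> vecs e" "\<iota>D (kk i p) = gr.\<kappa> i (\<iota> p)" if "p \<in> pre (max_pow A i)" for i p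
  proof -
    from iD(7)[OF gr.kappa_carrier[OF preD(2)[OF that]]] obtain q where "q \<in> vecs e \<and> \<iota>D q = gr.\<kappa> i (\<iota> p)" by auto
    then have "kk i p \<in> vecs e \<and> \<iota>D (kk i p) = gr.\<kappa> i (\<iota> p)"
      unfolding kk_def by (rule someI[of "\<lambda>q. q \<in> vecs e \<and> \<iota>D q = gr.\<kappa> i (\<iota> p)"])
    then show "kk i p \<in> vecs e" "\<iota>D (kk i p) = gr.\<kappa> i (\<iota> p)" by auto
  qed
  have inj: "u = v" if "\<iota>D u = \<iota>D v" "u \<in> vecs e" "v \<in> vecs e" for u v using iD(6)[OF that(2,3)] that(1) by blast
  have sub: "vs.subspace (pre (max_pow A i))" for i by (rule subspace_pre[OF max_pow_ideal])
  have kadd: "kk i (p + q) = kk i p + kk i q" if pq: "p \<in> pre (max_pow A i)" "q \<in> pre (max_pow A i)" for i p q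
  proof (rule inj)
    have pq': "p + q \<in> pre (max_pow A i)" using vs.subspace_add[OF sub] pq by blast
    show "kk i (p + q) \<in> vecs e" "kk i p + kk i q \<in> vecs e" using kk(1) pq pq' by auto
    show "\<iota>D (kk i (p + q)) = \<iota>D (kk i p + kk i q)"
      unfolding kk(2)[OF pq'] iD(3)[OF kk(1)[OF pq(1)] kk(1)[OF pq(2)]] kk(2)[OF pq(1)] kk(2)[OF pq(2)]
        \<iota>(3)[OF preD(1)[OF pq(1)] preD(1)[OF pq(2)]]
      by (rule gr.kappa_add) (rule preD(2)[OF pq(1)] preD(2)[OF pq(2)])+
  qed
  have kscale: "kk i (scale k p) = scale k (kk i p)" if p: "p \<in> pre (max_pow A i)" for i k p
  proof (rule inj)
    have p': "scale k p \<in> pre (max_pow A i)" using vs.subspace_scale[OF sub] p by blast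
    show "kk i (scale k p) \<in> vecs e" "scale k (kk i p) \<in> vecs e" using kk(1) p p' by auto
    show "\<iota>D (kk i (scale k p)) = \<iota>D (scale k (kk i p))"
      unfolding kk(2)[OF p'] iD(4)[OF kk(1)[OF p]] kk(2)[OF p] \<iota>(4)[OF preD(1)[OF p]]
      by (rule gr.kappa_smult[OF preD(2)[OF p]])
  qed
  have pm: "p \<star> q \<in> pre (max_pow A (i + j))" if "p \<in> pre (max_pow A i)" "q \<in> pre (max_pow A j)" for p q i j
    using max_pow_mult[OF preD(2)[OF that(2)] preD(2)[OF that(1)]] preD(1) that by (simp add: pre_def \<iota>_mult)
  have kmult: "smul e (fst T) (kk i p) (kk j q) = kk (i + j) (p \<star> q)"
    if pq: "p \<in> pre (max_pow A i)" "q \<in> pre (max_pow A j)" for i j p q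
  proof (rule inj)
    show "kk (i + j) (p \<star> q) \<in> vecs e" by (rule kk(1)[OF pm[OF pq]])
    show "\<iota>D (smul e (fst T) (kk i p) (kk j q)) = \<iota>D (kk (i + j) (p \<star> q))"
      unfolding iD_mult[OF kk(1)[OF pq(1)] kk(1)[OF pq(2)]] kk(2)[OF pq(1)] kk(2)[OF pq(2)] kk(2)[OF pm[OF pq]]
        \<iota>_mult[OF preD(1)[OF pq(1)] preD(1)[OF pq(2)]]
      by (rule gr.kappa_mult[OF preD(2)[OF pq(1)] preD(2)[OF pq(2)]])
  qed simp
  have kzero: "kk i p = 0" if "p \<in> pre (max_pow A i)" "gr.\<kappa> i (\<iota> p) = \<zero>\<^bsub>D\<^esub>" for i p
    by (rule inj) (use kk[OF that(1)] that(2) iD(5) in auto)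
  have khigh: "kk i p = 0" if "p \<in> pre (max_pow A i)" "4 \<le> i" for i p
    by (rule kzero[OF that(1) gr.kappa_high[OF preD(2)[OF that(1)] that(2)]])
  have kSuc: "kk i p = 0" if p: "p \<in> pre (max_pow A (Suc i))" for i p
  proof (rule kzero)
    show "p \<in> pre (max_pow A i)" using p max_pow_antimono[of i "Suc i"] by (auto simp: pre_def)
    show "gr.\<kappa> i (\<iota> p) = \<zero>\<^bsub>D\<^esub>" by (rule gr.kappa_zero[OF preD(2)[OF p]])
  qed
  have lift: "\<exists>p\<in>pre (max_pow A i). x = \<iota> p" if "x \<in> max_pow A i" for x i
    using \<iota>(7)[OF ideal_rules(2)[OF max_pow_ideal that]] that by (auto simp: pre_def)
  have ksigma: "kk 3 \<sigma> \<noteq> 0"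
  proof
    assume 0: "kk 3 \<sigma> = 0"
    obtain w where w: "w \<in> max_pow A 3" "gr.\<kappa> 3 w \<noteq> \<zero>\<^bsub>D\<^esub>" using gr.kappa3_nonzero by blast
    obtain p where p: "p \<in> pre (max_pow A 3)" "w = \<iota> p" using lift[OF w(1)] by blast
    obtain k where k: "p = scale k \<sigma>" using G.M3_sigma[OF p(1)] by blast
    have "kk 3 p = 0" unfolding k kscale[OF G.sigma(1)] 0 by simp
    then show False using kk(2)[OF p(1)] w(2) p(2) iD(5) by simp
  qed
  have kann: "kk 1 x = 0" if x: "x \<in> G.ann2" for x
  proof (rule kzero)
    show xM: "x \<in> pre (max_pow A 1)" by (rule G.ann2_M1[OF x])
    show "gr.\<kappa> 1 (\<iota> x) = \<zero>\<^bsub>D\<^esub>"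
    proof (rule gr.kappa1_zero[OF preD(2)[OF xM]])
      fix y assume "y \<in> max_pow A 2"
      from lift[OF this] obtain p where p: "p \<in> pre (max_pow A 2)" "y = \<iota> p" by blast
      have "x \<star> p = 0" using x p(1) unfolding G.ann2_def by blast
      then show "\<iota> x \<otimes>\<^bsub>A\<^esub> y = \<zero>\<^bsub>A\<^esub>" using \<iota>_mult[OF preD(1)[OF xM] preD(1)[OF p(1)]] p(2) \<iota>(5) by simp
    next
      fix y assume "y \<in> max_pow A 1"
      from lift[OF this] obtain p where p: "p \<in> pre (max_pow A 1)" "y = \<iota> p" by blast
      have "x \<star> p \<in> pre (max_pow A 3)"
        by (subst G.ann2_mult[OF x p(1)]) (rule vs.subspace_scale[OF sub G.sigma(1)])
      then show "\<iota> x \<otimes>\<^bsub>A\<^esub> y \<in> max_pow A 3"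
        using \<iota>_mult[OF preD(1)[OF xM] preD(1)[OF p(1)]] p(2) preD(2) by metis
    qed
  qed
  have ksurj: "\<exists>c x y w. x \<in> pre (max_pow A 1) \<and> y \<in> pre (max_pow A 2) \<and> w \<in> pre (max_pow A 3) \<and>
      q = scale c (snd T) + kk 1 x + kk 2 y + kk 3 w" if q: "q \<in> vecs e" for q
  proof -
    obtain x0 x1 x2 x3 where x: "x0 \<in> max_pow A 0" "x1 \<in> max_pow A 1" "x2 \<in> max_pow A 2" "x3 \<in> max_pow A 3"
      "\<iota>D q = gr.\<kappa> 0 x0 \<oplus>\<^bsub>D\<^esub> gr.\<kappa> 1 x1 \<oplus>\<^bsub>D\<^esub> gr.\<kappa> 2 x2 \<oplus>\<^bsub>D\<^esub> gr.\<kappa> 3 x3"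
      by (rule gr.D_decomp[OF iD(2)[OF q]])
    obtain c where c: "gr.\<kappa> 0 x0 = c \<odot>\<^bsub>D\<^esub> \<one>\<^bsub>D\<^esub>" by (rule gr.kappa_0_scalar[OF x(1)])
    obtain p1 where p1: "p1 \<in> pre (max_pow A 1)" "x1 = \<iota> p1" using lift[OF x(2)] by blast
    obtain p2 where p2: "p2 \<in> pre (max_pow A 2)" "x2 = \<iota> p2" using lift[OF x(3)] by blast
    obtain p3 where p3: "p3 \<in> pre (max_pow A 3)" "x3 = \<iota> p3" using lift[OF x(4)] by blast
    have u: "scale c (snd T) \<in> vecs e" using T.mul_unit(1) by blast
    note v = kk(1)[OF p1(1)] kk(1)[OF p2(1)] kk(1)[OF p3(1)]
    have "q = scale c (snd T) + kk 1 p1 + kk 2 p2 + kk 3 p3"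
    proof (rule inj)
      show "\<iota>D q = \<iota>D (scale c (snd T) + kk 1 p1 + kk 2 p2 + kk 3 p3)"
        unfolding iD(3)[OF vecs_closed(2)[OF vecs_closed(2)[OF u v(1)] v(2)] v(3)] iD(3)[OF vecs_closed(2)[OF u v(1)] v(2)]
          iD(3)[OF u v(1)] kk(2)[OF p1(1)] kk(2)[OF p2(1)] kk(2)[OF p3(1)] iD(4)[OF T.mul_unit(1)] iD_one
          p1(2)[symmetric] p2(2)[symmetric] p3(2)[symmetric] c[symmetric] by (rule x(5))
      show "scale c (snd T) + kk 1 p1 + kk 2 p2 + kk 3 p3 \<in> vecs e" by (intro vecs_closed u v)
    qed (rule q)
    then show ?thesis using p1 p2 p3 by blast
  qed
  have num: "(1::nat) + 1 = 2" "(1::nat) + 2 = 3" "Suc 1 = 2" "Suc 2 = 3" by simp_all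
  interpret gorenstein_quotient d S "pre (max_pow A 1)" "pre (max_pow A 2)" "pre (max_pow A 3)" \<sigma> e T "kk 1" "kk 2" "kk 3"
  proof unfold_locales
    show "smul e (fst T) (kk 1 x) (kk 1 y) = kk 2 (x \<star> y)" if "x \<in> pre (max_pow A 1)" "y \<in> pre (max_pow A 1)" for x y
      using kmult[OF that] unfolding num .
    show "smul e (fst T) (kk 1 x) (kk 2 y) = kk 3 (x \<star> y)" if "x \<in> pre (max_pow A 1)" "y \<in> pre (max_pow A 2)" for x y
      using kmult[OF that] unfolding num .
    have high: "smul e (fst T) (kk i x) (kk j y) = 0" if "x \<in> pre (max_pow A i)" "y \<in> pre (max_pow A j)" "4 \<le> i + j" for i j x y
      unfolding kmult[OF that(1,2)] by (rule khigh[OF pm[OF that(1,2)] that(3)])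
    show "smul e (fst T) (kk 1 x) (kk 3 y) = 0" if "x \<in> pre (max_pow A 1)" "y \<in> pre (max_pow A 3)" for x y by (rule high[OF that]) simp
    show "smul e (fst T) (kk 2 x) (kk 2 y) = 0" if "x \<in> pre (max_pow A 2)" "y \<in> pre (max_pow A 2)" for x y by (rule high[OF that]) simp
    show "smul e (fst T) (kk 2 x) (kk 3 y) = 0" if "x \<in> pre (max_pow A 2)" "y \<in> pre (max_pow A 3)" for x y by (rule high[OF that]) simp
    show "smul e (fst T) (kk 3 x) (kk 3 y) = 0" if "x \<in> pre (max_pow A 3)" "y \<in> pre (max_pow A 3)" for x y by (rule high[OF that]) simp
    show "kk 1 x = 0" if "x \<in> pre (max_pow A 2)" for x using kSuc[of x 1] that unfolding num by blast
    show "kk 2 x = 0" if "x \<in> pre (max_pow A 3)" for x using kSuc[of x 2] that unfolding num by blast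
  qed (rule kk(1) kadd kscale kann ksigma ksurj; assumption)+
  obtain n T' a where re: "S.realizes n T' a" and lim: "limit_of_reduced n T'" and sj: "\<And>x. x \<in> vecs d \<Longrightarrow> \<exists>p\<in>vecs n. comb n a p = x"
    using limit_realization[OF T(3)] by blast
  note r = S.realizesD[OF re]
  have "presents n T' A (\<lambda>p. \<iota> (comb n a p))"
    unfolding presents_def
  proof (intro conjI ballI allI)
    show "bij_betw (\<lambda>p. \<iota> (comb n a p)) (vecs n) (carrier A)"
      unfolding bij_betw_def
    proof
      show "inj_on (\<lambda>p. \<iota> (comb n a p)) (vecs n)"
        by (rule inj_onI) (use \<iota>(6)[OF r(6) r(6)] r(7) in blast)
      show "(\<lambda>p. \<iota> (comb n a p)) ` vecs n = carrier A"
      proof (intro equalityI subsetI)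
        fix y assume "y \<in> carrier A"
        from \<iota>(7)[OF this] obtain x where x: "x \<in> vecs d" "y = \<iota> x" by blast
        from sj[OF x(1)] obtain p where "p \<in> vecs n" "comb n a p = x" by blast
        then show "y \<in> (\<lambda>p. \<iota> (comb n a p)) ` vecs n" using x(2) by blast
      qed (use \<iota>(2)[OF r(6)] in auto)
    qed
    show "\<iota> (comb n a (snd T')) = \<one>\<^bsub>A\<^esub>" unfolding r(5) by (rule \<iota>_one)
    show "snd T' \<in> vecs n" by (rule r(4))
  qed (simp_all add: comb_linear \<iota>(3)[OF r(6) r(6)] \<iota>(4)[OF r(6)] r(3) \<iota>_mult[OF r(6) r(6)])
  then show thesis using that S.realizes_is_algebra[OF re] lim by blast
qed

theorem theorem4p2:
  fixes A :: "('k::{alg_closed_field, field_char_0}, 'a) module"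
    and Q :: "('k, 'q) module"
    and h n :: nat
  assumes "artinian_gorenstein_local A"
    and "h > 0" and "n > 0"
    and "has_hilbert_function A (\<lambda>i. if i < 4 then [1, h, n, 1] ! i else 0)"
    and "is_Q0 A Q"
    and "smoothable Q"
  shows "smoothable A"
proof -
  have art: "artinian_local A" and soc: "has_kdim A (socle A) 1"
    using assms(1) by (auto simp: artinian_gorenstein_local_def)
  interpret local_alg A by (rule artinian_local_imp_local_alg[OF art])
  obtain C s where C: "homogeneous_ideal A C" "has_socle_degree A s"
      "artinian_gorenstein_local (alg_quot (gr_algebra A) C)"
      "has_socle_degree (alg_quot (gr_algebra A) C) s" "alg_isomorphic (alg_quot (gr_algebra A) C) Q"
    and Q: "k_algebra Q"
    using assms(5) unfolding is_Q0_def by blast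
  have "s = 3" by (rule socle_degree_three[OF assms(4) _ _ C(2)]) simp_all
  then have nz: "max_pow A 3 \<noteq> {\<zero>\<^bsub>A\<^esub>}" and nil: "max_pow A 4 = {\<zero>\<^bsub>A\<^esub>}" and D3: "has_socle_degree (alg_quot (gr_algebra A) C) 3"
    using C(2,4) by (auto simp: has_socle_degree_def)
  obtain d where "has_kdim A (carrier A) d" using art by (auto simp: artinian_local_def)
  then obtain S \<iota> where S: "is_algebra d S" "presents d S A \<iota>" by (rule presentation_exists)
  interpret presented_local_alg A d S \<iota> by unfold_locales (rule S nil)+
  have gq: "gr_quotient A C (alg_quot (gr_algebra A) C)"
    by unfold_locales (use C D3 nil residue_field in auto)
  obtain e T \<iota>Q where T: "is_algebra e T" "presents e T Q \<iota>Q" "limit_of_reduced e T"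
    by (rule smoothable_imp_limit_of_reduced[OF Q assms(6)])
  have kD: "k_algebra (alg_quot (gr_algebra A) C)"
    using C(3) by (simp add: artinian_gorenstein_local_def artinian_local_def)
  obtain \<iota>D where "presents e T (alg_quot (gr_algebra A) C) \<iota>D"
    by (rule presents_isomorphic[OF kD C(5) T(2,1)])
  from comparison_limit[OF presented_local_alg_axioms gq soc nz T(1) this T(3)]
  obtain m T' \<iota>' where T': "is_algebra m T'" "presents m T' A \<iota>'" "limit_of_reduced m T'" .
  show ?thesis
    by (rule limit_of_reduced_imp_smoothable[OF _ presents_has_kdim[OF T'(2)] T'])
      (use art in \<open>simp add: artinian_local_def\<close>)
qed

end
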